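(* Let $\sigma=\{\sigma_i\mid i\in I\}$ be a partition of the set $\mathbb{P}$ of all primes and let $G$ be a finite $\sigma$-full group. Then any two of the following conditions are equivalent: (i) Every subgroup of $G$ is $H_\sigma$-subnormally embedded in $G$. (ii) Every $\sigma$-subnormal subgroup $H$ of $G$ is an $H\sigma E$-group of the form $H=D\rtimes M$, where $D=H^{\mathfrak{N}_\sigma}$ and $M$ is a $\sigma$-Carter subgroup of $H$. (iii) Every $\sigma$-subnormal subgroup of $G$ is an $H\sigma E$-group.
   Context: All groups are finite. $\pi(n)$ is the set of primes dividing $n$, $\pi(G)=\pi(|G|)$. $\sigma=\{\sigma_i\mid i\in I\}$ is a partition of $\mathbb P$; $\sigma(n)=\{\sigma_i\mid \sigma_i\cap\pi(n)\neq\emptyset\}$ and $\sigma(G)=\sigma(|G|)$. A group is $\sigma$-primary if it is a $\sigma_i$-group for some $i$. A set $\mathcal H$ of subgroups of $G$ is a complete Hall $\sigma$-set of $G$ if every member of $\mathcal H\setminus\{1\}$ is a Hall $\sigma_i$-subgroup of $G$ for some $i$ and $\mathcal H$ contains exactly one Hall $\sigma_i$-subgroup of $G$ for every $\sigma_i\in\sigma(G)$. $G$ is $\sigma$-full if it possesses a complete Hall $\sigma$-set. A subgroup $A$ of $G$ is a $\sigma$-Hall subgroup of $G$ if $\sigma(|A|)\cap\sigma(|G:A|)=\emptyset$. $A$ is $\sigma$-subnormal in $G$ if there is a chain $A=A_0\le A_1\le\cdots\le A_t=G$ such that for each $i=1,\ldots,t$ either $A_{i-1}\trianglelefteq A_i$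 or $A_i/(A_{i-1})_{A_i}$ is $\sigma$-primary, where $(A_{i-1})_{A_i}$ is the normal core of $A_{i-1}$ in $A_i$. $A$ is $H_\sigma$-subnormally embedded in $G$ if $A$ is a $\sigma$-Hall subgroup of some $\sigma$-subnormal subgroup of $G$. A group is $\sigma$-nilpotent if it is a direct product of $\sigma$-primary groups; $\mathfrak N_\sigma$ is the class of $\sigma$-nilpotent groups. $G^{\mathfrak N_\sigma}$ is the intersection of all normal subgroups $N$ of $G$ with $G/N$ $\sigma$-nilpotent. A $\sigma$-Carter subgroup of $G$ is an $\mathfrak N_\sigma$-covering subgroup of $G$, i.e. a subgroup $H\in\mathfrak N_\sigma$ such that for every subgroup $E$ of $G$ with $H\le E$ and every normal subgroup $N$ of $E$ with $E/N\in\mathfrak N_\sigma$ one has $E=NH$. A group has a Sylow tower if it has a normal series $1=G_0<G_1<\cdots<G_t=G$ such that each $|G_i/G_{i-1}|$ is the order of some Sylow subgroup of $G$. A chief factor $H/K$ of $G$ is $\sigma$-central in $G$ if $(H/K)\rtimes(G/C_G(H/K))$ is $\sigma$-primary, and $\sigma$-eccentric otherwise. $G$ is an $H\sigma E$-group if: (a) $G=D\rtimes M$, where $D=G^{\mathfrak N_\sigma}$ is a $\sigma$-Hall subgroup of $G$ and $|\sigma(D)|=|\pi(D)|$; (b) $D$ has a Sylow tower and every chief factor of $G$ below $D$ is $\sigma$-eccentric; (c) $M$ acts irreducibly on every $M$-invariant Sylow subgroup of $D$. In "an $H\sigma E$-group of the form $D\rtimes M$", $D$ and $M$ are the subgroups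 appearing in (a)–(c). *)

theory Defs
  imports "HOL-Algebra.Algebra" "HOL-Library.Disjoint_Sets"
begin

text \<open>
  A partition of the primes is given by its set \<open>\<sigma>\<close> of blocks.  Groups are records as in
  HOL-Algebra; a subgroup \<open>H\<close> of \<open>G\<close> is a set, and is regarded as a group as
  \<open>G\<lparr>carrier := H\<rparr>\<close>.  All notions are meant for finite groups.
\<close>

definition primes_of :: "nat \<Rightarrow> nat set" where
  "primes_of n = {p. Factorial_Ring.prime p \<and> p dvd n}"

definition sigma_of :: "nat set set \<Rightarrow> nat \<Rightarrow> nat set set" where
  "sigma_of \<sigma> n = {S \<in> \<sigma>. S \<inter> primes_of n \<noteq> {}}"

definition sigma_primary :: "nat set set \<Rightarrow> ('a, 'b) monoid_scheme \<Rightarrow> bool" where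
  "sigma_primary \<sigma> G \<longleftrightarrow> (\<exists>S\<in>\<sigma>. primes_of (order G) \<subseteq> S)"

definition hall_subgroup :: "nat set \<Rightarrow> ('a, 'b) monoid_scheme \<Rightarrow> 'a set \<Rightarrow> bool" where
  "hall_subgroup S G A \<longleftrightarrow>
     subgroup A G \<and> primes_of (card A) \<subseteq> S \<and> primes_of (card (rcosets\<^bsub>G\<^esub> A)) \<inter> S = {}"

definition complete_Hall_set :: "nat set set \<Rightarrow> ('a, 'b) monoid_scheme \<Rightarrow> 'a set set \<Rightarrow> bool" where
  "complete_Hall_set \<sigma> G \<H> \<longleftrightarrow>
     (\<forall>A\<in>\<H>. subgroup A G) \<and>
     (\<forall>A\<in>\<H> - {{\<one>\<^bsub>G\<^esub>}}. \<exists>S\<in>\<sigma>. hall_subgroup S G A) \<and>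
     (\<forall>S\<in>sigma_of \<sigma> (order G). \<exists>!A. A \<in> \<H> \<and> hall_subgroup S G A)"

definition sigma_full :: "nat set set \<Rightarrow> ('a, 'b) monoid_scheme \<Rightarrow> bool" where
  "sigma_full \<sigma> G \<longleftrightarrow> (\<exists>\<H>. complete_Hall_set \<sigma> G \<H>)"

definition sigma_Hall_subgroup :: "nat set set \<Rightarrow> ('a, 'b) monoid_scheme \<Rightarrow> 'a set \<Rightarrow> bool" where
  "sigma_Hall_subgroup \<sigma> G A \<longleftrightarrow>
     subgroup A G \<and> sigma_of \<sigma> (card A) \<inter> sigma_of \<sigma> (card (rcosets\<^bsub>G\<^esub> A)) = {}"

definition normal_core :: "('a, 'b) monoid_scheme \<Rightarrow> 'a set \<Rightarrow> 'a set" where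
  "normal_core G A = (\<Inter>x\<in>carrier G. (x <#\<^bsub>G\<^esub> A) #>\<^bsub>G\<^esub> inv\<^bsub>G\<^esub> x)"

definition sigma_subnormal :: "nat set set \<Rightarrow> ('a, 'b) monoid_scheme \<Rightarrow> 'a set \<Rightarrow> bool" where
  "sigma_subnormal \<sigma> G A \<longleftrightarrow>
     (\<exists>(t::nat) (C :: nat \<Rightarrow> 'a set).
        C 0 = A \<and> C t = carrier G \<and>
        (\<forall>i\<le>t. subgroup (C i) G) \<and>
        (\<forall>i<t. C i \<subseteq> C (Suc i) \<and>
           (C i \<lhd> G\<lparr>carrier := C (Suc i)\<rparr> \<or>
            sigma_primary \<sigma>
              (G\<lparr>carrier := C (Suc i)\<rparr> Mod normal_core (G\<lparr>carrier := C (Suc i)\<rparr>) (C i)))))"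

definition H_sigma_subnormally_embedded ::
    "nat set set \<Rightarrow> ('a, 'b) monoid_scheme \<Rightarrow> 'a set \<Rightarrow> bool" where
  "H_sigma_subnormally_embedded \<sigma> G A \<longleftrightarrow>
     (\<exists>B. sigma_subnormal \<sigma> G B \<and> sigma_Hall_subgroup \<sigma> (G\<lparr>carrier := B\<rparr>) A)"

text \<open>
  Direct factors of \<open>G\<close> embed into \<open>G\<close>, so it is no restriction to take the elements of
  the factors from the element type of \<open>G\<close>.
\<close>

definition sigma_nilpotent :: "nat set set \<Rightarrow> ('a, 'b) monoid_scheme \<Rightarrow> bool" where
  "sigma_nilpotent \<sigma> G \<longleftrightarrow>
     (\<exists>(n::nat) (K :: nat \<Rightarrow> 'a monoid).
        (\<forall>i<n. group (K i) \<and> sigma_primary \<sigma> (K i)) \<and> G \<cong> product_group {..<n} K)"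

definition sigma_nilpotent_residual :: "nat set set \<Rightarrow> ('a, 'b) monoid_scheme \<Rightarrow> 'a set" where
  "sigma_nilpotent_residual \<sigma> G = \<Inter>{N. N \<lhd> G \<and> sigma_nilpotent \<sigma> (G Mod N)}"

definition sigma_Carter_subgroup :: "nat set set \<Rightarrow> ('a, 'b) monoid_scheme \<Rightarrow> 'a set \<Rightarrow> bool" where
  "sigma_Carter_subgroup \<sigma> G H \<longleftrightarrow>
     subgroup H G \<and> sigma_nilpotent \<sigma> (G\<lparr>carrier := H\<rparr>) \<and>
     (\<forall>E N. subgroup E G \<and> H \<subseteq> E \<and> N \<lhd> G\<lparr>carrier := E\<rparr> \<and>
        sigma_nilpotent \<sigma> (G\<lparr>carrier := E\<rparr> Mod N) \<longrightarrow> E = N <#>\<^bsub>G\<^esub> H)"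

text \<open>Only primes dividing the group order are considered, so a Sylow subgroup is nontrivial.\<close>

definition sylow_subgroup :: "nat \<Rightarrow> ('a, 'b) monoid_scheme \<Rightarrow> 'a set \<Rightarrow> bool" where
  "sylow_subgroup p G P \<longleftrightarrow>
     p \<in> primes_of (order G) \<and> subgroup P G \<and> card P = p ^ multiplicity p (order G)"

definition has_Sylow_tower :: "('a, 'b) monoid_scheme \<Rightarrow> bool" where
  "has_Sylow_tower G \<longleftrightarrow>
     (\<exists>(t::nat) (C :: nat \<Rightarrow> 'a set).
        C 0 = {\<one>\<^bsub>G\<^esub>} \<and> C t = carrier G \<and>
        (\<forall>i\<le>t. C i \<lhd> G) \<and>
        (\<forall>i<t. C i \<subset> C (Suc i) \<and>
           (\<exists>p P. sylow_subgroup p G P \<and>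
              order (G\<lparr>carrier := C (Suc i)\<rparr> Mod C i) = card P)))"

definition chief_factor :: "('a, 'b) monoid_scheme \<Rightarrow> 'a set \<Rightarrow> 'a set \<Rightarrow> bool" where
  "chief_factor G H K \<longleftrightarrow>
     H \<lhd> G \<and> K \<lhd> G \<and> K \<subset> H \<and> \<not> (\<exists>L. L \<lhd> G \<and> K \<subset> L \<and> L \<subset> H)"

definition factor_centralizer :: "('a, 'b) monoid_scheme \<Rightarrow> 'a set \<Rightarrow> 'a set \<Rightarrow> 'a set" where
  "factor_centralizer G H K =
     {g \<in> carrier G. \<forall>h\<in>H. K #>\<^bsub>G\<^esub> (g \<otimes>\<^bsub>G\<^esub> h \<otimes>\<^bsub>G\<^esub> inv\<^bsub>G\<^esub> g) = K #>\<^bsub>G\<^esub> h}"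

definition semidirect_product ::
    "('a, 'c) monoid_scheme \<Rightarrow> ('b, 'd) monoid_scheme \<Rightarrow> ('b \<Rightarrow> 'a \<Rightarrow> 'a) \<Rightarrow> ('a \<times> 'b) monoid" where
  "semidirect_product N A act =
     \<lparr>carrier = carrier N \<times> carrier A,
      monoid.mult = (\<lambda>(x, a) (y, b). (x \<otimes>\<^bsub>N\<^esub> act a y, a \<otimes>\<^bsub>A\<^esub> b)),
      one = (\<one>\<^bsub>N\<^esub>, \<one>\<^bsub>A\<^esub>)\<rparr>"

text \<open>
  The conjugation action of \<open>G / C\<^sub>G(H/K)\<close> on \<open>H/K\<close>, written on cosets as sets; see
  \<open>coset_conj_coset\<close> below.
\<close>

definition coset_conj :: "('a, 'b) monoid_scheme \<Rightarrow> 'a set \<Rightarrow> 'a set \<Rightarrow> 'a set" where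
  "coset_conj G a x = {g \<otimes>\<^bsub>G\<^esub> h \<otimes>\<^bsub>G\<^esub> inv\<^bsub>G\<^esub> g | g h. g \<in> a \<and> h \<in> x}"

definition sigma_central_factor ::
    "nat set set \<Rightarrow> ('a, 'b) monoid_scheme \<Rightarrow> 'a set \<Rightarrow> 'a set \<Rightarrow> bool" where
  "sigma_central_factor \<sigma> G H K \<longleftrightarrow>
     sigma_primary \<sigma>
       (semidirect_product (G\<lparr>carrier := H\<rparr> Mod K) (G Mod factor_centralizer G H K) (coset_conj G))"

abbreviation sigma_eccentric_factor ::
    "nat set set \<Rightarrow> ('a, 'b) monoid_scheme \<Rightarrow> 'a set \<Rightarrow> 'a set \<Rightarrow> bool" where
  "sigma_eccentric_factor \<sigma> G H K \<equiv> \<not> sigma_central_factor \<sigma> G H K"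

definition is_semidirect :: "('a, 'b) monoid_scheme \<Rightarrow> 'a set \<Rightarrow> 'a set \<Rightarrow> bool" where
  "is_semidirect G D M \<longleftrightarrow>
     D \<lhd> G \<and> subgroup M G \<and> D \<inter> M = {\<one>\<^bsub>G\<^esub>} \<and> D <#>\<^bsub>G\<^esub> M = carrier G"

definition conj_invariant :: "('a, 'b) monoid_scheme \<Rightarrow> 'a set \<Rightarrow> 'a set \<Rightarrow> bool" where
  "conj_invariant G M P \<longleftrightarrow> (\<forall>m\<in>M. (m <#\<^bsub>G\<^esub> P) #>\<^bsub>G\<^esub> inv\<^bsub>G\<^esub> m = P)"

definition acts_irreducibly :: "('a, 'b) monoid_scheme \<Rightarrow> 'a set \<Rightarrow> 'a set \<Rightarrow> bool" where
  "acts_irreducibly G M P \<longleftrightarrow>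
     P \<noteq> {\<one>\<^bsub>G\<^esub>} \<and>
     (\<forall>Q. subgroup Q G \<and> Q \<subseteq> P \<and> conj_invariant G M Q \<longrightarrow> Q = {\<one>\<^bsub>G\<^esub>} \<or> Q = P)"

definition HsigmaE_group_form ::
    "nat set set \<Rightarrow> ('a, 'b) monoid_scheme \<Rightarrow> 'a set \<Rightarrow> 'a set \<Rightarrow> bool" where
  "HsigmaE_group_form \<sigma> G D M \<longleftrightarrow>
     is_semidirect G D M \<and>
     D = sigma_nilpotent_residual \<sigma> G \<and>
     sigma_Hall_subgroup \<sigma> G D \<and>
     card (sigma_of \<sigma> (card D)) = card (primes_of (card D)) \<and>
     has_Sylow_tower (G\<lparr>carrier := D\<rparr>) \<and>
     (\<forall>H K. chief_factor G H K \<and> H \<subseteq> D \<longrightarrow> sigma_eccentric_factor \<sigma> G H K) \<and>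
     (\<forall>p P. sylow_subgroup p (G\<lparr>carrier := D\<rparr>) P \<and> conj_invariant G M P \<longrightarrow>
        acts_irreducibly G M P)"

definition HsigmaE_group :: "nat set set \<Rightarrow> ('a, 'b) monoid_scheme \<Rightarrow> bool" where
  "HsigmaE_group \<sigma> G \<longleftrightarrow> (\<exists>D M. HsigmaE_group_form \<sigma> G D M)"

lemma coset_conj_coset:
  assumes "group G" "H \<lhd> G" "K \<lhd> G" "K \<subseteq> H" "g \<in> carrier G" "h \<in> H"
  shows "coset_conj G (factor_centralizer G H K #>\<^bsub>G\<^esub> g) (K #>\<^bsub>G\<^esub> h)
           = K #>\<^bsub>G\<^esub> (g \<otimes>\<^bsub>G\<^esub> h \<otimes>\<^bsub>G\<^esub> inv\<^bsub>G\<^esub> g)"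
proof -
  interpret group G by fact
  interpret H: normal H G by fact
  interpret K: normal K G by fact
  note Hc = H.mem_carrier and Kc = K.mem_carrier
  have conjH: "g \<otimes>\<^bsub>G\<^esub> h \<otimes>\<^bsub>G\<^esub> inv\<^bsub>G\<^esub> g \<in> H"
    using assms H.inv_op_closed2 by blast
  have conj_mult: "(c \<otimes>\<^bsub>G\<^esub> g) \<otimes>\<^bsub>G\<^esub> x \<otimes>\<^bsub>G\<^esub> inv\<^bsub>G\<^esub> (c \<otimes>\<^bsub>G\<^esub> g)
      = c \<otimes>\<^bsub>G\<^esub> (g \<otimes>\<^bsub>G\<^esub> x \<otimes>\<^bsub>G\<^esub> inv\<^bsub>G\<^esub> g) \<otimes>\<^bsub>G\<^esub> inv\<^bsub>G\<^esub> c"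
    if "c \<in> carrier G" "x \<in> carrier G" for c x
    using that assms(5) by (simp add: m_assoc inv_mult_group)
  have split: "g \<otimes>\<^bsub>G\<^esub> (k \<otimes>\<^bsub>G\<^esub> h) \<otimes>\<^bsub>G\<^esub> inv\<^bsub>G\<^esub> g
      = (g \<otimes>\<^bsub>G\<^esub> k \<otimes>\<^bsub>G\<^esub> inv\<^bsub>G\<^esub> g) \<otimes>\<^bsub>G\<^esub> (g \<otimes>\<^bsub>G\<^esub> h \<otimes>\<^bsub>G\<^esub> inv\<^bsub>G\<^esub> g)" if "k \<in> K" for k
    using that assms(5,6) Hc Kc by (simp add: m_assoc inv_solve_left)
  show ?thesis
  proof (intro equalityI subsetI)
    fix y assume "y \<in> coset_conj G (factor_centralizer G H K #>\<^bsub>G\<^esub> g) (K #>\<^bsub>G\<^esub> h)"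
    then obtain c k where c: "c \<in> factor_centralizer G H K" and k: "k \<in> K"
      and y: "y = (c \<otimes>\<^bsub>G\<^esub> g) \<otimes>\<^bsub>G\<^esub> (k \<otimes>\<^bsub>G\<^esub> h) \<otimes>\<^bsub>G\<^esub> inv\<^bsub>G\<^esub> (c \<otimes>\<^bsub>G\<^esub> g)"
      unfolding coset_conj_def r_coset_def by auto
    have cc: "c \<in> carrier G" using c unfolding factor_centralizer_def by simp
    let ?z = "g \<otimes>\<^bsub>G\<^esub> (k \<otimes>\<^bsub>G\<^esub> h) \<otimes>\<^bsub>G\<^esub> inv\<^bsub>G\<^esub> g"
    have khH: "k \<otimes>\<^bsub>G\<^esub> h \<in> H" using k assms(4,6) by blast
    have zH: "?z \<in> H" using H.inv_op_closed2[OF assms(5) khH] .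
    have y': "y = c \<otimes>\<^bsub>G\<^esub> ?z \<otimes>\<^bsub>G\<^esub> inv\<^bsub>G\<^esub> c"
      using y conj_mult[OF cc] khH Hc by simp
    have "K #>\<^bsub>G\<^esub> y = K #>\<^bsub>G\<^esub> ?z"
      using c zH y' unfolding factor_centralizer_def by auto
    moreover have "?z \<in> K #>\<^bsub>G\<^esub> (g \<otimes>\<^bsub>G\<^esub> h \<otimes>\<^bsub>G\<^esub> inv\<^bsub>G\<^esub> g)"
      using split[OF k] K.inv_op_closed2[OF assms(5) k] unfolding r_coset_def by auto
    ultimately have "K #>\<^bsub>G\<^esub> y = K #>\<^bsub>G\<^esub> (g \<otimes>\<^bsub>G\<^esub> h \<otimes>\<^bsub>G\<^esub> inv\<^bsub>G\<^esub> g)"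
      using repr_independence[OF _ _ K.subgroup_axioms] conjH Hc by metis
    moreover have "y \<in> carrier G" using y' cc zH Hc by simp
    ultimately show "y \<in> K #>\<^bsub>G\<^esub> (g \<otimes>\<^bsub>G\<^esub> h \<otimes>\<^bsub>G\<^esub> inv\<^bsub>G\<^esub> g)"
      using rcos_self[OF _ K.subgroup_axioms] by blast
  next
    fix y assume "y \<in> K #>\<^bsub>G\<^esub> (g \<otimes>\<^bsub>G\<^esub> h \<otimes>\<^bsub>G\<^esub> inv\<^bsub>G\<^esub> g)"
    then obtain k where k: "k \<in> K" and y: "y = k \<otimes>\<^bsub>G\<^esub> (g \<otimes>\<^bsub>G\<^esub> h \<otimes>\<^bsub>G\<^esub> inv\<^bsub>G\<^esub> g)"
      unfolding r_coset_def by auto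
    let ?l = "inv\<^bsub>G\<^esub> g \<otimes>\<^bsub>G\<^esub> k \<otimes>\<^bsub>G\<^esub> g"
    have l: "?l \<in> K" using K.inv_op_closed1[OF assms(5) k] .
    have "g \<otimes>\<^bsub>G\<^esub> ?l \<otimes>\<^bsub>G\<^esub> inv\<^bsub>G\<^esub> g = k"
      using assms(5) Kc[OF k] by (simp add: m_assoc[symmetric]) (simp add: m_assoc)
    hence y': "y = g \<otimes>\<^bsub>G\<^esub> (?l \<otimes>\<^bsub>G\<^esub> h) \<otimes>\<^bsub>G\<^esub> inv\<^bsub>G\<^esub> g"
      using split[OF l] y by simp
    have "\<one>\<^bsub>G\<^esub> \<in> factor_centralizer G H K"
      unfolding factor_centralizer_def using Hc by simp
    hence "g \<in> factor_centralizer G H K #>\<^bsub>G\<^esub> g"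
      unfolding r_coset_def using assms(5) by force
    moreover have "?l \<otimes>\<^bsub>G\<^esub> h \<in> K #>\<^bsub>G\<^esub> h" unfolding r_coset_def using l by auto
    ultimately show "y \<in> coset_conj G (factor_centralizer G H K #>\<^bsub>G\<^esub> g) (K #>\<^bsub>G\<^esub> h)"
      unfolding coset_conj_def using y' by blast
  qed
qed

end

theory Submission
  imports Defs "HOL-Number_Theory.Cong"
begin

text \<open>
  Call \<open>S \<in> \<sigma>\<close> a block.  The key to (i) \<open>\<Longrightarrow>\<close> (iii) is that a subgroup of \<open>S\<close>-index
  whose order is not prime to \<open>S\<close> must itself be \<sigma>-subnormal, hence, if proper, lies in a
  proper subgroup containing \<open>O\<^sup>S(G)\<close>.  Applied to normalizers and to complements this shows
  that a normal Hall \<open>S\<close>-subgroup of a group without proper normal subgroups of \<open>S\<close>-index is a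
  minimal normal \<open>p\<close>-subgroup, and then that every \<open>G\<close> with a proper normal subgroup of
  \<open>S\<close>-index has a normal \<open>S\<close>-complement.  That some block \<open>S\<close> admits such a subgroup comes down
  to simple groups, all of whose subgroups would be \<sigma>-Hall: their order is squarefree, and
  transfer at the smallest prime excludes them.  So \<open>G\<close> has a \<sigma>-Hall tower, from which the
  \<open>H\<sigma>E\<close>-structure is read off.

  For (iii) \<open>\<Longrightarrow>\<close> (i), take the least \<sigma>-subnormal \<open>H = D \<rtimes> M\<close> containing a given \<open>A\<close>.
  Then \<open>H = DA\<close>, some conjugate of \<open>M\<close> lies in \<open>A\<close> by Schur--Zassenhaus, and irreducibility
  makes every \<open>M\<close>-invariant Sylow subgroup of \<open>D \<inter> A\<close> a Sylow subgroup of \<open>D\<close>; so \<open>A\<close> is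
  \<sigma>-Hall in \<open>H\<close>.
\<close>

section \<open>Numbers with prime divisors in a given set\<close>

text \<open>That (iii) implies (ii) rests on a fact about one group: the complement M in any
  H\<sigma>E-form D M is a \<sigma>-Carter subgroup. If N M were too small in some E, then for a
  prime p of |D| an M-invariant Sylow p-subgroup P of D would meet trivially a subgroup that
  contains M and is normalized by P. So P and M commute, irreducibility gives |P| = p, and M
  centralizes a chief factor of order p below D, against eccentricity. Two choices shape the rest.
  The \<sigma>-conditions are tested on orders and indices only: being \<sigma>-primary or
  \<sigma>-Hall is divisibility, and \<sigma>-nilpotency asks for normal subgroups of prescribed
  index. Conjugacy of complements is wanted only over a normal p-subgroup or over D, which has a
  Sylow tower; it is therefore proved for solvable normal subgroups, without the theorem of Feit and
  Thompson.\<close>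

lemma primes_of_mult: "primes_of (m * n) = primes_of m \<union> primes_of n"
  by (auto simp: primes_of_def prime_dvd_mult_iff)

lemma primes_of_mono: "m dvd n \<Longrightarrow> primes_of m \<subseteq> primes_of n"
  by (auto simp: primes_of_def intro: dvd_trans)

lemma primes_of_1 [simp]: "primes_of (Suc 0) = {}"
  by (auto simp: primes_of_def)

lemma finite_primes_of: "n > 0 \<Longrightarrow> finite (primes_of n)"
  by (rule finite_subset[of _ "{..n}"]) (auto simp: primes_of_def dest: dvd_imp_le)

lemma primes_of_empty_iff: "primes_of n = {} \<longleftrightarrow> n = 1"
  by (auto simp: primes_of_def) (metis One_nat_def prime_factor_nat)

text \<open>Being an S-group is a property of the order. The set \<open>- S\<close> also contains
  composite numbers, but only prime divisors are tested, so it serves as the complementary set of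
  primes.\<close>

definition pi_number :: "nat set \<Rightarrow> nat \<Rightarrow> bool" where
  "pi_number S n \<longleftrightarrow> primes_of n \<subseteq> S"

lemma pi_number_mult: "pi_number S (m * n) \<longleftrightarrow> pi_number S m \<and> pi_number S n"
  by (auto simp: pi_number_def primes_of_mult)

lemma pi_number_dvd: "pi_number S n \<Longrightarrow> m dvd n \<Longrightarrow> pi_number S m"
  using primes_of_mono by (auto simp: pi_number_def)

lemma pi_number_1 [simp]: "pi_number S (Suc 0)"
  by (simp add: pi_number_def)

text \<open>The usual way to collapse an index: if it divides an S-number and a number prime to S,
  the two subgroups coincide.\<close>

lemma pi_number_both: "pi_number S n \<Longrightarrow> pi_number (-S) n \<Longrightarrow> n = 1"
  by (metis Compl_disjoint Int_absorb2 le_infI pi_number_def primes_of_empty_iff subset_empty)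

lemma pi_number_coprime:
  assumes "pi_number S m" "pi_number (-S) n"
  shows "coprime m n"
proof (rule ccontr)
  assume "\<not> coprime m n"
  then obtain p where "Factorial_Ring.prime p" "p dvd gcd m n"
    using prime_factor_nat[of "gcd m n"] by (auto simp: coprime_iff_gcd_eq_1)
  then show False using assms by (auto simp: pi_number_def primes_of_def)
qed

lemma pi_number_prime_power:
  assumes "Factorial_Ring.prime p"
  shows "pi_number {p} (p ^ k)"
  using assms by (auto simp: pi_number_def primes_of_def dest: prime_dvd_power primes_dvd_imp_eq)

lemma pi_number_singleton_imp_power:
  assumes "pi_number {p} n" "n > 0" "Factorial_Ring.prime p"
  shows "n = p ^ multiplicity p n"
proof -
  obtain m where m: "n = p ^ multiplicity p n * m" "\<not> p dvd m"
    using multiplicity_decompose'[of n p] assms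
    by (metis multiplicity_decompose mult.commute neq0_conv not_prime_unit)
  have "primes_of m \<subseteq> {p}" using assms(1) m(1) primes_of_mono[of m n]
    by (metis dvd_triv_right pi_number_def subset_trans)
  then have "primes_of m = {}" using m(2) by (auto simp: primes_of_def)
  then have "m = 1" by (simp add: primes_of_empty_iff)
  then show ?thesis using m(1) by simp
qed

section \<open>Finite groups and epimorphisms\<close>

locale fin_group = group +
  assumes fin: "finite (carrier G)"
begin

lemma finite_subgroup: "subgroup H G \<Longrightarrow> finite H"
  using fin finite_subset subgroup.subset by blast

lemma card_subgroup_pos: "subgroup H G \<Longrightarrow> card H > 0"
  using finite_subgroup subgroup.one_closed by (metis card_gt_0_iff empty_iff)

lemma card_carrier_pos: "card (carrier G) > 0"
  using card_subgroup_pos subgroup_self by blast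

text \<open>Indices are written as quotients of cardinalities throughout, so that chains of
  subgroups become arithmetic of natural numbers; this is the link to the cosets in the
  definitions.\<close>

lemma card_rcosets: 
  assumes "subgroup H G"
  shows "card (rcosets H) = card (carrier G) div card H"
  using lagrange[OF assms] card_subgroup_pos[OF assms] unfolding order_def
  by (metis nonzero_mult_div_cancel_right less_numeral_extra(3))

lemma card_subgroup_dvd: "subgroup H G \<Longrightarrow> card H dvd card (carrier G)"
  using lagrange unfolding order_def by (metis dvd_triv_right)

lemma fin_group_subgroup: "subgroup H G \<Longrightarrow> fin_group (G\<lparr>carrier := H\<rparr>)"
  by (simp add: fin_group_def fin_group_axioms_def subgroup.subgroup_is_group finite_subgroup is_group)

lemma card_subgroup_dvd_subgroup:
  assumes "subgroup H G" "subgroup K G" "H \<subseteq> K"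
  shows "card H dvd card K"
  using fin_group.card_subgroup_dvd[OF fin_group_subgroup[OF assms(2)] subgroup_incl[OF assms]] by simp

lemma card_eq_imp_eq: "subgroup H G \<Longrightarrow> subgroup K G \<Longrightarrow> H \<subseteq> K \<Longrightarrow> card K = card H \<Longrightarrow> H = K"
  by (simp add: card_subset_eq finite_subgroup)

lemma index_mult:
  assumes "subgroup H G" "subgroup K G" "subgroup L G" "H \<subseteq> K" "K \<subseteq> L"
  shows "card L div card H = (card L div card K) * (card K div card H)"
proof -
  obtain a b where ab: "card L = card K * a" "card K = card H * b"
    using card_subgroup_dvd_subgroup assms by (meson dvdE)
  moreover have "card K > 0" "card H > 0" using card_subgroup_pos assms(1,2) by auto
  ultimately show ?thesis by simp
qed

lemma card_index: 
  assumes "subgroup H G" "subgroup K G" "H \<subseteq> K"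
  shows "card K = card H * (card K div card H)"
  using card_subgroup_dvd_subgroup[OF assms] by simp

lemma index_1_imp_eq: 
  assumes "subgroup H G" "subgroup K G" "H \<subseteq> K" "card K div card H = 1"
  shows "H = K"
  using assms card_eq_imp_eq[of H K] card_index[of H K] by simp

lemma index_pos: 
  assumes "subgroup H G" "subgroup K G" "H \<subseteq> K"
  shows "card K div card H > 0"
  using assms card_index[of H K] card_subgroup_pos[of K] by (metis gr0I mult_0_right)

text \<open>Inverses in the restricted record agree on \<open>Y\<close> with those of
  \<open>G\<close>, so normality inside a subgroup can be tested with the operations of
  \<open>G\<close>.\<close>

lemma normal_in_iff:
  assumes "subgroup Y G"
  shows "N \<lhd> G\<lparr>carrier := Y\<rparr> \<longleftrightarrow>
    subgroup N G \<and> N \<subseteq> Y \<and> (\<forall>y\<in>Y. \<forall>n\<in>N. y \<otimes> n \<otimes> inv y \<in> N)"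
proof -
  interpret Y: group "G\<lparr>carrier := Y\<rparr>" using assms by (simp add: subgroup.subgroup_is_group is_group)
  have i: "inv\<^bsub>G\<lparr>carrier := Y\<rparr>\<^esub> y = inv y" if "y \<in> Y" for y using assms that by (simp add: m_inv_consistent)
  have s: "subgroup N (G\<lparr>carrier := Y\<rparr>) \<longleftrightarrow> subgroup N G \<and> N \<subseteq> Y"
    using incl_subgroup[OF assms] subgroup_incl[OF _ assms] subgroup.subset[of N "G\<lparr>carrier := Y\<rparr>"]
    by (metis partial_object.select_convs(1) partial_object.surjective partial_object.update_convs(1))
  show ?thesis unfolding Y.normal_inv_iff s using i by auto
qed

lemma normal_iff: "N \<lhd> G \<longleftrightarrow> subgroup N G \<and> (\<forall>x\<in>carrier G. \<forall>n\<in>N. x \<otimes> n \<otimes> inv x \<in> N)"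
  by (rule normal_inv_iff)

lemma normal_in_imp:
  assumes "N \<lhd> G\<lparr>carrier := Y\<rparr>" "subgroup Y G"
  shows "subgroup N G" "N \<subseteq> Y" "\<And>y n. y \<in> Y \<Longrightarrow> n \<in> N \<Longrightarrow> y \<otimes> n \<otimes> inv y \<in> N"
  using assms normal_in_iff by auto

lemma normal_in_subgroup:
  assumes "N \<lhd> G" "subgroup Y G" "N \<subseteq> Y"
  shows "N \<lhd> G\<lparr>carrier := Y\<rparr>"
  using assms by (auto simp: normal_in_iff normal_iff dest: subgroup.mem_carrier)

lemma normal_in_Int:
  assumes "N \<lhd> G\<lparr>carrier := Y\<rparr>" "subgroup Y G" "subgroup H G"
  shows "N \<inter> H \<lhd> G\<lparr>carrier := Y \<inter> H\<rparr>"
  using assms normal_in_imp[OF assms(1,2)]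
  by (subst normal_in_iff) (auto intro!: subgroups_Inter_pair subgroup.m_closed subgroup.m_inv_closed)

lemma normal_Int: "N \<lhd> G \<Longrightarrow> K \<lhd> G \<Longrightarrow> N \<inter> K \<lhd> G"
  by (auto simp: normal_iff subgroups_Inter_pair)

lemma conj_conj:
  assumes "x \<in> carrier G" "y \<in> carrier G" "h \<in> carrier G"
  shows "x \<otimes> (y \<otimes> h \<otimes> inv y) \<otimes> inv x = (x \<otimes> y) \<otimes> h \<otimes> inv (x \<otimes> y)"
  using assms by (simp add: m_assoc inv_mult_group)

end

text \<open>Quotients are handled as arbitrary epimorphisms, so that every fact applies both to
  \<open>G Mod N\<close> and to the copy of the quotient built on coset representatives.\<close>

locale fin_epi = group_hom + G?: fin_group G +
  assumes surj: "h ` carrier G = carrier H"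
begin

lemma fin_group_codom: "fin_group H"
  by (metis H.is_group fin fin_group_axioms_def fin_group_def finite_imageI surj)

sublocale H: fin_group H by (rule fin_group_codom)

definition pre where "pre B = {g \<in> carrier G. h g \<in> B}"

lemma subgroup_pre: "subgroup B H \<Longrightarrow> subgroup (pre B) G"
  by (rule G.subgroupI) (auto simp: pre_def subgroup.one_closed subgroup.m_closed subgroup.m_inv_closed
      intro!: exI[of _ \<one>])

lemma normal_pre: "B \<lhd> H \<Longrightarrow> pre B \<lhd> G"
  using subgroup_pre by (auto simp: G.normal_iff H.normal_iff pre_def subgroup.mem_carrier)

lemma ker_subset_pre: "subgroup B H \<Longrightarrow> kernel G H h \<subseteq> pre B"
  by (auto simp: pre_def kernel_def subgroup.one_closed)

lemma image_pre: "B \<subseteq> carrier H \<Longrightarrow> h ` pre B = B"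
  using surj by (auto simp: pre_def)

lemma subgroup_image: "subgroup K G \<Longrightarrow> subgroup (h ` K) H"
  using subgroup_img_is_subgroup by blast

lemma normal_image:
  assumes "K \<lhd> G"
  shows "h ` K \<lhd> H"
proof -
  have K: "subgroup K G" using assms normal_imp_subgroup by blast
  have "x \<otimes>\<^bsub>H\<^esub> h k \<otimes>\<^bsub>H\<^esub> inv\<^bsub>H\<^esub> x \<in> h ` K" if "x \<in> carrier H" "k \<in> K" for x k
  proof -
    have "x \<in> h ` carrier G" using that(1) by (simp only: surj)
    then obtain g where g: "g \<in> carrier G" "x = h g" by (elim imageE) simp
    have "k \<in> carrier G" using that K subgroup.mem_carrier by metis
    then have "h (g \<otimes> k \<otimes> inv g) = x \<otimes>\<^bsub>H\<^esub> h k \<otimes>\<^bsub>H\<^esub> inv\<^bsub>H\<^esub> x" using g by simp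
    moreover have "g \<otimes> k \<otimes> inv g \<in> K" using assms g that normal.inv_op_closed2 by metis
    ultimately show ?thesis by (metis imageI)
  qed
  then show ?thesis unfolding H.normal_iff using subgroup_image[OF K] by auto
qed

lemma pre_image: 
  assumes "subgroup K G" "kernel G H h \<subseteq> K"
  shows "pre (h ` K) = K"
proof
  show "K \<subseteq> pre (h ` K)" using assms(1) by (auto simp: pre_def subgroup.mem_carrier)
  show "pre (h ` K) \<subseteq> K"
  proof
    fix g assume "g \<in> pre (h ` K)"
    then obtain k where k: "g \<in> carrier G" "k \<in> K" "h g = h k" by (auto simp: pre_def)
    have kc: "k \<in> carrier G" using k assms(1) subgroup.mem_carrier by metis
    have "g \<otimes> inv k \<in> kernel G H h" using k kc by (simp add: kernel_def)
    then have "(g \<otimes> inv k) \<otimes> k \<in> K" using assms k by (meson subgroup.m_closed subsetD)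
    then show "g \<in> K" using k kc by (simp add: G.m_assoc)
  qed
qed

end

text \<open>The fibres of \<open>h\<close> on \<open>K\<close> are translates of the intersection
  with the kernel, hence all of the same size. It is stated outside \<open>fin_epi\<close> because
  the transfer homomorphism uses it as well.\<close>

lemma (in group_hom) card_image_kernel:
  assumes "finite (carrier G)" "subgroup K G"
  shows "card K = card (h ` K) * card (K \<inter> kernel G H h)"
proof -
  let ?K = "K \<inter> kernel G H h"
  interpret G: fin_group G by unfold_locales (rule assms)
  have Kc: "\<And>x. x \<in> K \<Longrightarrow> x \<in> carrier G" using assms(2) subgroup.mem_carrier by metis
  have fK: "finite K" using G.finite_subgroup assms(2) by simp
  have "card {x \<in> K. h x = y} = card ?K" if "y \<in> h ` K" for y
  proof -
    from that obtain k where k: "k \<in> K" "y = h k" by blast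
    have "bij_betw (\<lambda>x. x \<otimes> k) ?K {x \<in> K. h x = y}"
    proof (rule bij_betw_byWitness[where f' = "\<lambda>x. x \<otimes> inv k"])
      show "(\<lambda>x. x \<otimes> k) ` ?K \<subseteq> {x \<in> K. h x = y}"
        using k Kc assms(2) by (auto simp: kernel_def subgroup.m_closed)
      show "(\<lambda>x. x \<otimes> inv k) ` {x \<in> K. h x = y} \<subseteq> ?K"
        using k Kc assms(2) by (auto simp: kernel_def subgroup.m_closed subgroup.m_inv_closed)
    qed (use k Kc in \<open>auto simp: G.m_assoc kernel_def\<close>)
    then show ?thesis by (simp add: bij_betw_same_card)
  qed
  moreover have "card K = (\<Sum>y\<in>h ` K. card {x \<in> K. h x = y})"
    using fK by (subst card_UN_disjoint[symmetric]) (auto intro!: arg_cong[where f=card])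
  ultimately show ?thesis by simp
qed

context fin_epi begin

lemma card_image_ker: "subgroup K G \<Longrightarrow> card K = card (h ` K) * card (K \<inter> kernel G H h)"
  using card_image_kernel fin by blast

lemma card_image_ker': "subgroup K G \<Longrightarrow> kernel G H h \<subseteq> K \<Longrightarrow> card K = card (h ` K) * card (kernel G H h)"
  using card_image_ker by (metis inf.absorb2)

lemma card_pre: "subgroup B H \<Longrightarrow> card (pre B) = card B * card (kernel G H h)"
  using card_image_ker'[OF subgroup_pre ker_subset_pre] image_pre subgroup.subset by metis

lemma card_kernel_pos: "card (kernel G H h) > 0"
  using G.card_subgroup_pos subgroup_kernel by blast

lemma card_carrier: "card (carrier G) = card (carrier H) * card (kernel G H h)"
  using card_image_ker'[OF G.subgroup_self] surj by (auto simp: kernel_def)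

lemma index_image:
  assumes "subgroup B G" "subgroup C G" "kernel G H h \<subseteq> B" "B \<subseteq> C"
  shows "card (h ` C) div card (h ` B) = card C div card B"
  using card_image_ker'[of B] card_image_ker'[of C] assms card_kernel_pos by auto

lemma normal_image_in:
  assumes "B \<lhd> G\<lparr>carrier := C\<rparr>" "subgroup C G"
  shows "h ` B \<lhd> H\<lparr>carrier := h ` C\<rparr>"
proof -
  note * = G.normal_in_imp[OF assms]
  have "h c \<otimes>\<^bsub>H\<^esub> h b \<otimes>\<^bsub>H\<^esub> inv\<^bsub>H\<^esub> h c \<in> h ` B" if "c \<in> C" "b \<in> B" for b c
  proof -
    have "c \<in> carrier G" "b \<in> carrier G" using that assms(2) *(1) by (auto dest: subgroup.mem_carrier)
    then have "h (c \<otimes> b \<otimes> inv c) = h c \<otimes>\<^bsub>H\<^esub> h b \<otimes>\<^bsub>H\<^esub> inv\<^bsub>H\<^esub> h c" by simp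
    then show ?thesis using *(3)[OF that] by (metis imageI)
  qed
  then show ?thesis unfolding H.normal_in_iff[OF subgroup_image[OF assms(2)]]
    using * subgroup_image[OF *(1)] by auto
qed

end

context fin_group begin

lemma fin_epi_Mod:
  assumes "N \<lhd> G"
  shows "fin_epi G (G Mod N) (\<lambda>g. N #> g)" "kernel G (G Mod N) (\<lambda>g. N #> g) = N"
proof -
  interpret N: normal N G by fact
  interpret Q: group "G Mod N" by (rule N.factorgroup_is_group)
  show "fin_epi G (G Mod N) (\<lambda>g. N #> g)"
    by unfold_locales (auto simp: N.r_coset_hom_Mod fin carrier_FactGroup)
  show "kernel G (G Mod N) (\<lambda>g. N #> g) = N"
  proof (intro equalityI subsetI)
    fix g assume "g \<in> kernel G (G Mod N) (\<lambda>g. N #> g)"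
    then show "g \<in> N" using coset_join1[OF _ _ N.subgroup_axioms] by (simp add: kernel_def)
  next
    fix g assume "g \<in> N"
    then show "g \<in> kernel G (G Mod N) (\<lambda>g. N #> g)"
      using coset_join2[OF _ N.subgroup_axioms] by (simp add: kernel_def)
  qed
qed

text \<open>Inductions over quotients cannot leave the element type, so quotients are also provided
  on coset representatives.\<close>

lemma ex_quotient:
  assumes "N \<lhd> G"
  obtains Q :: "('a, 'b) monoid_scheme" and f where "fin_epi G Q f" "kernel G Q f = N"
proof -
  interpret E: fin_epi G "G Mod N" "\<lambda>g. N #> g" using fin_epi_Mod[OF assms] by simp
  define rep :: "'a set \<Rightarrow> 'a" where "rep c = (SOME x. x \<in> c)" for c
  interpret N: normal N G by fact
  have rep: "N #> rep c = c" if "c \<in> carrier (G Mod N)" for c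
  proof -
    from that obtain x where x: "x \<in> carrier G" "c = N #> x" by (auto simp: carrier_FactGroup)
    then have "rep c \<in> c" unfolding rep_def using rcos_self[OF x(1) N.subgroup_axioms] by (auto intro: someI)
    then show ?thesis using x repr_independence[OF _ x(1) N.subgroup_axioms] by metis
  qed
  \<comment> \<open>Updating the fields of \<open>G\<close> itself keeps the record extension, so
    the quotient has exactly the type of \<open>G\<close>.\<close>
  define Q where "Q = G\<lparr>mult := (\<lambda>x y. rep ((N #> x) <#> (N #> y))),
     carrier := rep ` carrier (G Mod N), one := rep N\<rparr>"
  have hom: "rep \<in> hom (G Mod N) Q" 
    by (rule homI) (auto simp: Q_def rep)
  have inj: "inj_on rep (carrier (G Mod N))" using rep by (metis inj_onI)
  have 1: "\<one>\<^bsub>Q\<^esub> = rep \<one>\<^bsub>G Mod N\<^esub>" by (simp add: Q_def)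
  have "group (Q\<lparr>carrier := rep ` carrier (G Mod N), one := rep \<one>\<^bsub>G Mod N\<^esub>\<rparr>)"
    using E.H.hom_imp_img_group[OF hom] .
  then have Q: "group Q" by (simp add: Q_def)
  let ?f = "\<lambda>g. rep (N #> g)"
  have Nc: "N #> g \<in> carrier (G Mod N)" if "g \<in> carrier G" for g using that by (auto simp: carrier_FactGroup)
  have "fin_epi G Q ?f"
    unfolding fin_epi_def fin_epi_axioms_def group_hom_def group_hom_axioms_def
    using Q fin_group_axioms is_group
  proof (intro conjI; assumption?)
    show "?f \<in> hom G Q"
      using Group.hom_compose[OF E.homh hom] by (simp add: comp_def)
    show "?f ` carrier G = carrier Q" by (auto simp: Q_def carrier_FactGroup)
  qed
  moreover have "kernel G Q ?f = N"
  proof -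
    have "rep (N #> g) = rep N \<longleftrightarrow> N #> g = N" if "g \<in> carrier G" for g
      using inj_on_eq_iff[OF inj Nc[OF that], of N] E.H.one_closed by simp
    then have "kernel G Q ?f = kernel G (G Mod N) (\<lambda>g. N #> g)" by (auto simp: kernel_def Q_def)
    then show ?thesis using fin_epi_Mod(2)[OF assms] by simp
  qed
  ultimately show ?thesis using that by blast
qed

text \<open>Modulo \<open>N\<close> the sets \<open>N <#> K\<close> and \<open>K\<close> have the
  same image, so the two instances of the image-kernel count can be compared.\<close>

lemma card_set_mult_normal:
  assumes "N \<lhd> G" "subgroup K G"
  shows "card (N <#> K) * card (N \<inter> K) = card N * card K" "subgroup (N <#> K) G"
    "N \<subseteq> N <#> K" "K \<subseteq> N <#> K"
proof -
  interpret E: fin_epi G "G Mod N" "\<lambda>g. N #> g" using fin_epi_Mod[OF assms(1)] by simp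
  have N: "subgroup N G" using assms normal_imp_subgroup by blast
  show s: "subgroup (N <#> K) G" using mult_norm_subgroup[OF assms] .
  show NK: "N \<subseteq> N <#> K" using subgroup.one_closed[OF assms(2)] N subgroup.mem_carrier[OF N]
    by (force simp: set_mult_def)
  show KK: "K \<subseteq> N <#> K" using subgroup.one_closed[OF N] subgroup.mem_carrier[OF assms(2)]
    by (force simp: set_mult_def)
  have im: "(\<lambda>g. N #> g) ` (N <#> K) = (\<lambda>g. N #> g) ` K"
  proof
    show "(\<lambda>g. N #> g) ` (N <#> K) \<subseteq> (\<lambda>g. N #> g) ` K"
    proof
      fix c assume "c \<in> (\<lambda>g. N #> g) ` (N <#> K)"
      then obtain n k where nk: "n \<in> N" "k \<in> K" "c = N #> (n \<otimes> k)" by (auto simp: set_mult_def)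
      have "N #> (n \<otimes> k) = N #> k" using nk N assms(2)
        by (metis coset_join2 coset_mult_assoc subgroup.mem_carrier subgroup.subset)
      then show "c \<in> (\<lambda>g. N #> g) ` K" using nk by auto
    qed
  qed (use KK in blast)
  note ker = fin_epi_Mod(2)[OF assms(1)]
  have "card (N <#> K) = card ((\<lambda>g. N #> g) ` K) * card N"
    using E.card_image_ker'[OF s] NK im ker by simp
  moreover have "card K = card ((\<lambda>g. N #> g) ` K) * card (K \<inter> N)"
    using E.card_image_ker[OF assms(2)] ker by simp
  ultimately show "card (N <#> K) * card (N \<inter> K) = card N * card K"
    by (simp add: Int_commute)
qed

end

section \<open>Sylow theory\<close>

text \<open>\<open>Bij\<close> consists of extensional functions, hence the \<open>restrict\<close>.
  Bijectivity comes for free: the inverse of \<open>g\<close> acts as the inverse map.\<close>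

lemma group_actionI:
  assumes "group G"
    and closed: "\<And>g x. g \<in> carrier G \<Longrightarrow> x \<in> E \<Longrightarrow> a g x \<in> E"
    and one: "\<And>x. x \<in> E \<Longrightarrow> a \<one>\<^bsub>G\<^esub> x = x"
    and mult: "\<And>g h x. g \<in> carrier G \<Longrightarrow> h \<in> carrier G \<Longrightarrow> x \<in> E \<Longrightarrow> a (g \<otimes>\<^bsub>G\<^esub> h) x = a g (a h x)"
  shows "group_action G E (\<lambda>g. restrict (a g) E)"
proof -
  interpret group G by fact
  have bij: "restrict (a g) E \<in> Bij E" if "g \<in> carrier G" for g
  proof -
    have "bij_betw (a g) E E"
      by (rule bij_betw_byWitness[where f' = "a (inv\<^bsub>G\<^esub> g)"])
        (use that closed one mult[symmetric] in auto)
    then show ?thesis by (auto simp: Bij_def cong: bij_betw_cong)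
  qed
  have "(\<lambda>g. restrict (a g) E) \<in> hom G (BijGroup E)"
  proof (rule homI)
    fix g h assume gh: "g \<in> carrier G" "h \<in> carrier G"
    have "restrict (a (g \<otimes>\<^bsub>G\<^esub> h)) E = compose E (restrict (a g) E) (restrict (a h) E)"
      using gh mult closed by (auto simp: compose_def)
    then show "restrict (a (g \<otimes>\<^bsub>G\<^esub> h)) E = restrict (a g) E \<otimes>\<^bsub>BijGroup E\<^esub> restrict (a h) E"
      using bij gh by (simp add: BijGroup_def)
  qed (use bij in \<open>simp add: BijGroup_def\<close>)
  then show ?thesis
    by (simp add: group_action_def group_hom_def group_hom_axioms_def group_BijGroup is_group)
qed

text \<open>Both counts are split over the orbits. An orbit of length 1 is a fixed point and counts
  once on either side; any other orbit contains no fixed point, and its length divides p^k and is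
  thus a multiple of p.\<close>

lemma (in group_action) card_fixed_points_cong:
  assumes "finite E" "finite (carrier G)" "Factorial_Ring.prime p" "order G = p ^ k"
  shows "[card {x \<in> E. \<forall>g\<in>carrier G. \<phi> g x = x} = card E] (mod p)"
proof -
  let ?fix = "\<lambda>x. \<forall>g\<in>carrier G. \<phi> g x = x"
  have orb: "[(\<Sum>x\<in>U. if ?fix x then 1 else 0) = (\<Sum>x\<in>U. 1)] (mod p)" if U: "U \<in> orbits G E \<phi>" for U
  proof -
    obtain x where x: "x \<in> E" "U = orbit G \<phi> x" using U by (auto simp: orbits_def)
    have OE: "U \<subseteq> E" using x element_image by (auto simp: orbit_def)
    have x_in: "x \<in> U" using x orbit_refl by simp
    show ?thesis
    proof (cases "\<exists>y\<in>U. ?fix y")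
      case True
      then obtain y where y: "y \<in> U" "?fix y" by auto
      then have "x \<in> orbit G \<phi> y" using x orbit_sym OE by blast
      then have "x = y" using y by (auto simp: orbit_def)
      then have "U = {x}" using y x x_in by (auto simp: orbit_def)
      then show ?thesis using y \<open>x = y\<close> by simp
    next
      case False
      have "card U \<noteq> 1"
      proof
        assume "card U = 1"
        then have "U = {x}" using x_in by (metis card_1_singletonE singletonD)
        moreover have "\<phi> g x \<in> U" if "g \<in> carrier G" for g using x(2) that by (auto simp: orbit_def)
        ultimately show False using False by auto
      qed
      moreover have "card U dvd p ^ k" using orbit_stabilizer_theorem[OF x(1)] x assms(4) by (metis dvd_triv_left)
      ultimately have "p dvd card U" using assms(3)
        by (metis divides_primepow_nat power_0 dvd_power neq0_conv)
      moreover have "(\<Sum>x\<in>U. if ?fix x then 1 else 0) = (0::nat)" using False by (intro sum.neutral) auto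
      ultimately show ?thesis by (simp add: cong_def mod_eq_0_iff_dvd del: sum.neutral_const)
    qed
  qed
  have "card {x \<in> E. ?fix x} = (\<Sum>x\<in>E. if ?fix x then 1 else 0)"
    using assms(1) by (simp add: sum.If_cases Int_def)
  also have "\<dots> = (\<Sum>U\<in>orbits G E \<phi>. \<Sum>x\<in>U. if ?fix x then 1 else 0)"
    by (rule disjoint_sum[OF assms(1), symmetric])
  also have "[\<dots> = (\<Sum>U\<in>orbits G E \<phi>. \<Sum>x\<in>U. 1)] (mod p)"
    using orb by (rule cong_sum)
  also have "(\<Sum>U\<in>orbits G E \<phi>. \<Sum>x\<in>U. 1) = card E"
    using disjoint_sum[OF assms(1), of "\<lambda>_. 1::nat"] by simp
  finally show ?thesis .
qed

context fin_group begin

text \<open>With \<open>R\<close> of index prime to p it produces a fixed coset, with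
  \<open>Q = R\<close> it relates the index of \<open>Q\<close> to its index in the normalizer, and
  in the transfer it counts the cosets that are not moved.\<close>

lemma card_fixed_rcosets_cong:
  assumes "subgroup Q G" "Factorial_Ring.prime p" "card Q = p ^ k" "subgroup R G"
  shows "[card {c \<in> rcosets R. \<forall>q\<in>Q. c #> q = c} = card (carrier G) div card R] (mod p)"
proof -
  interpret Q: fin_group "G\<lparr>carrier := Q\<rparr>" using fin_group_subgroup assms by simp
  have Qc: "q \<in> Q \<Longrightarrow> q \<in> carrier G" for q using assms subgroup.mem_carrier by metis
  have i: "inv\<^bsub>G\<lparr>carrier := Q\<rparr>\<^esub> y = inv y" if "y \<in> Q" for y using assms that by (simp add: m_inv_consistent)
  \<comment> \<open>The inverse makes right multiplication a left action; the fixed cosets are the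
    same.\<close>
  let ?a = "\<lambda>q c. c #> inv q"
  have sub: "c \<subseteq> carrier G" if "c \<in> rcosets R" for c
    using that assms by (meson rcosets_part_G Sup_upper subset_trans subgroup.rcosets_carrier is_group subsetI)
  have "group_action (G\<lparr>carrier := Q\<rparr>) (rcosets R) (\<lambda>q. restrict (?a q) (rcosets R))"
  proof (rule group_actionI)
    fix q c assume "q \<in> carrier (G\<lparr>carrier := Q\<rparr>)" "c \<in> rcosets R"
    then obtain g where g: "g \<in> carrier G" "c = R #> g" "q \<in> Q" by (auto simp: RCOSETS_def)
    then have "c #> inv q = R #> (g \<otimes> inv q)" using Qc assms by (simp add: coset_mult_assoc subgroup.subset)
    then show "c #> inv q \<in> rcosets R" using g Qc by (simp add: rcosetsI subgroup.subset assms)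
  qed (use sub Qc Q.is_group in \<open>auto simp: coset_mult_assoc inv_mult_group\<close>)
  then interpret A: group_action "G\<lparr>carrier := Q\<rparr>" "rcosets R" "\<lambda>q. restrict (?a q) (rcosets R)" .
  have "[card {c \<in> rcosets R. \<forall>q\<in>carrier (G\<lparr>carrier := Q\<rparr>). restrict (?a q) (rcosets R) c = c} = card (rcosets R)] (mod p)"
    by (rule A.card_fixed_points_cong) (use assms finite_subgroup fin in \<open>auto simp: order_def rcosets_finite cosets_finite
       intro: finite_subset[OF rcosets_subset_PowG]\<close>)
  moreover have "{c \<in> rcosets R. \<forall>q\<in>carrier (G\<lparr>carrier := Q\<rparr>). restrict (?a q) (rcosets R) c = c}
     = {c \<in> rcosets R. \<forall>q\<in>Q. c #> q = c}" (is "?A = ?B")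
  proof -
    have "(\<forall>q\<in>Q. c #> inv q = c) \<longleftrightarrow> (\<forall>q\<in>Q. c #> q = c)" for c
      using assms(1) Qc by (metis inv_inv subgroup.m_inv_closed)
    then show ?thesis by auto
  qed
  ultimately show ?thesis using card_rcosets[OF assms(4)] by simp
qed

lemma fixed_rcoset_iff:
  assumes "subgroup R G" "g \<in> carrier G" "q \<in> carrier G"
  shows "R #> g #> q = R #> g \<longleftrightarrow> g \<otimes> q \<otimes> inv g \<in> R"
proof -
  have Rc: "R \<subseteq> carrier G" using assms subgroup.subset by blast
  have "R #> g #> q = R #> g \<longleftrightarrow> R #> (g \<otimes> q) = R #> g"
    using assms Rc by (simp add: coset_mult_assoc)
  also have "\<dots> \<longleftrightarrow> R #> (g \<otimes> q \<otimes> inv g) = R"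
    using assms Rc coset_mult_inv1[of R "g \<otimes> q" g] coset_mult_inv2[of R "g \<otimes> q" g] 
    by (metis coset_mult_assoc coset_mult_one inv_closed m_closed r_inv)
  also have "\<dots> \<longleftrightarrow> g \<otimes> q \<otimes> inv g \<in> R"
    using assms coset_join1 coset_join2 by (meson inv_closed m_closed)
  finally show ?thesis .
qed

section \<open>Conjugates and normalizers\<close>

definition conjs where "conjs g A = (\<lambda>x. g \<otimes> x \<otimes> inv g) ` A"

lemma conjs_card: "g \<in> carrier G \<Longrightarrow> A \<subseteq> carrier G \<Longrightarrow> card (conjs g A) = card A"
  unfolding conjs_def by (rule card_image) (auto simp: inj_on_def subset_iff)

lemma conjs_subset: "g \<in> carrier G \<Longrightarrow> A \<subseteq> carrier G \<Longrightarrow> conjs g A \<subseteq> carrier G"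
  by (auto simp: conjs_def)

lemma conjs_mult: "g \<in> carrier G \<Longrightarrow> k \<in> carrier G \<Longrightarrow> A \<subseteq> carrier G \<Longrightarrow> conjs g (conjs k A) = conjs (g \<otimes> k) A"
  by (auto simp: conjs_def image_image conj_conj subset_iff intro!: image_cong)

lemma conjs_one: "A \<subseteq> carrier G \<Longrightarrow> conjs \<one> A = A"
  by (auto simp: conjs_def subset_iff)

lemma conjs_inv: "g \<in> carrier G \<Longrightarrow> A \<subseteq> carrier G \<Longrightarrow> conjs (inv g) (conjs g A) = A"
  by (simp add: conjs_mult conjs_one)

lemma conjs_mono: "A \<subseteq> Y \<Longrightarrow> conjs g A \<subseteq> conjs g Y"
  by (auto simp: conjs_def)

lemma conjs_hom: "g \<in> carrier G \<Longrightarrow> (\<lambda>x. g \<otimes> x \<otimes> inv g) \<in> hom G G"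
  by (rule homI) (simp_all add: m_assoc inv_solve_left)

lemma conjs_subgroup:
  assumes "g \<in> carrier G" "subgroup A G"
  shows "subgroup (conjs g A) G"
  unfolding conjs_def 
  by (rule group_hom.subgroup_img_is_subgroup[OF _ assms(2)])
     (simp add: group_hom_def group_hom_axioms_def conjs_hom assms)

lemma conjs_normal: 
  assumes "N \<lhd> G" "g \<in> carrier G"
  shows "conjs g N = N"
proof -
  have s: "subgroup N G" using assms normal_imp_subgroup by blast
  have "conjs g N \<subseteq> N" using assms by (auto simp: conjs_def normal_iff)
  then show ?thesis using conjs_card[OF assms(2) subgroup.subset[OF s]] finite_subgroup[OF s]
    by (simp add: card_subset_eq)
qed

lemma conjs_eq_coset: "g \<in> carrier G \<Longrightarrow> A \<subseteq> carrier G \<Longrightarrow> (g <# A) #> inv g = conjs g A"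
  by (auto simp: conjs_def l_coset_def r_coset_def)

definition norm_of where "norm_of A = {g \<in> carrier G. conjs g A = A}"

lemma norm_of_subset: "norm_of A \<subseteq> carrier G"
  by (auto simp: norm_of_def)

lemma norm_of_subgroup:
  assumes "A \<subseteq> carrier G"
  shows "subgroup (norm_of A) G"
proof (rule subgroupI)
  show "norm_of A \<noteq> {}" using assms conjs_one by (auto simp: norm_of_def)
  fix g assume g: "g \<in> norm_of A"
  then show "inv g \<in> norm_of A" using conjs_inv[of g A] assms by (auto simp: norm_of_def)
  fix k assume "k \<in> norm_of A"
  then show "g \<otimes> k \<in> norm_of A" using g conjs_mult[of g k A] assms by (auto simp: norm_of_def)
qed (rule norm_of_subset)

lemma subset_norm_of: "subgroup A G \<Longrightarrow> A \<subseteq> norm_of A"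
proof
  fix x assume A: "subgroup A G" and x: "x \<in> A"
  then have "conjs x A \<subseteq> A" by (auto simp: conjs_def intro!: subgroup.m_closed subgroup.m_inv_closed)
  moreover have "x \<in> carrier G" using A x subgroup.mem_carrier by metis
  ultimately show "x \<in> norm_of A" unfolding norm_of_def 
    using conjs_card[of x A] A finite_subgroup[OF A] by (auto simp: card_subset_eq subgroup.subset)
qed

text \<open>Conjugation preserves cardinality, so for a finite subgroup containment of the conjugate
  already gives equality.\<close>

lemma norm_ofI:
  assumes "g \<in> carrier G" "subgroup A G" "\<And>x. x \<in> A \<Longrightarrow> g \<otimes> x \<otimes> inv g \<in> A"
  shows "g \<in> norm_of A"
proof -
  have "conjs g A \<subseteq> A" using assms by (auto simp: conjs_def)
  then show ?thesis unfolding norm_of_def 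
    using assms conjs_card[of g A] finite_subgroup[OF assms(2)] by (auto simp: card_subset_eq subgroup.subset)
qed

lemma norm_of_eq_carrier_iff:
  assumes "subgroup A G"
  shows "norm_of A = carrier G \<longleftrightarrow> A \<lhd> G"
proof
  assume "norm_of A = carrier G"
  then show "A \<lhd> G" unfolding normal_iff using assms by (auto simp: norm_of_def conjs_def)
next
  assume "A \<lhd> G" then show "norm_of A = carrier G" using conjs_normal by (auto simp: norm_of_def)
qed

lemma norm_of_normal:
  assumes "subgroup A G"
  shows "A \<lhd> G\<lparr>carrier := norm_of A\<rparr>"
  unfolding normal_in_iff[OF norm_of_subgroup[OF subgroup.subset[OF assms]]]
  using assms subset_norm_of[OF assms] by (auto simp: norm_of_def conjs_def)

section \<open>Sylow subgroups and the Frattini argument\<close>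

lemma sylow_exists:
  assumes "Factorial_Ring.prime p"
  obtains P where "subgroup P G" "card P = p ^ multiplicity p (card (carrier G))"
    "\<not> p dvd card (carrier G) div card P"
proof -
  have 0: "card (carrier G) \<noteq> 0" using card_carrier_pos by simp
  then obtain m where m: "card (carrier G) = p ^ multiplicity p (card (carrier G)) * m" "\<not> p dvd m"
    using assms by (metis multiplicity_decompose' not_prime_unit)
  then obtain P where P: "subgroup P G" "card P = p ^ multiplicity p (card (carrier G))"
    using sylow_thm[OF assms is_group _ fin] unfolding order_def by metis
  moreover have "card (carrier G) div card P = m" using m(1) P(2) assms
    by (metis nonzero_mult_div_cancel_left not_prime_0 power_not_zero)
  ultimately show ?thesis using that m(2) by metis
qed

lemma cauchy:
  assumes "Factorial_Ring.prime p" "p dvd card (carrier G)"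
  obtains P where "subgroup P G" "card P = p"
proof -
  obtain m where "card (carrier G) = p ^ 1 * m" using assms(2) by (auto elim: dvdE)
  then obtain P where "subgroup P G" "card P = p ^ 1"
    using sylow_thm[OF assms(1) is_group _ fin] unfolding order_def by metis
  then show ?thesis using that by simp
qed

text \<open>The number of cosets of \<open>P\<close> is prime to p, so the p-group \<open>Q\<close>
  fixes one of them, and its representative conjugates \<open>Q\<close> into
  \<open>P\<close>.\<close>

lemma sylow_conj_into:
  assumes "subgroup P G" "Factorial_Ring.prime p" "\<not> p dvd card (carrier G) div card P"
    and "subgroup Q G" "card Q = p ^ k"
  obtains g where "g \<in> carrier G" "conjs g Q \<subseteq> P"
proof -
  have "card {c \<in> rcosets P. \<forall>q\<in>Q. c #> q = c} \<noteq> 0"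
    using card_fixed_rcosets_cong[OF assms(4,2,5,1)] assms(3) 
    by (metis cong_0_iff cong_sym)
  then have "{c \<in> rcosets P. \<forall>q\<in>Q. c #> q = c} \<noteq> {}" by (metis card.empty)
  then obtain c where "c \<in> rcosets P" "\<forall>q\<in>Q. c #> q = c" by blast
  then obtain g where g: "g \<in> carrier G" "\<forall>q\<in>Q. P #> g #> q = P #> g" by (auto simp: RCOSETS_def)
  then have "conjs g Q \<subseteq> P" using fixed_rcoset_iff[OF assms(1) g(1)] subgroup.mem_carrier[OF assms(4)]
    by (auto simp: conjs_def)
  then show ?thesis using that g by blast
qed

text \<open>The cosets of \<open>Q\<close> fixed by \<open>Q\<close> are exactly those inside its
  normalizer, and their number is congruent modulo p to the index of \<open>Q\<close>.\<close>

lemma normalizers_grow: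
  assumes "subgroup Q G" "Factorial_Ring.prime p" "card Q = p ^ k" "p dvd card (carrier G) div card Q"
  shows "p dvd card (norm_of Q) div card Q"
proof -
  have Nq: "subgroup (norm_of Q) G" using norm_of_subgroup assms(1) subgroup.subset by metis
  let ?N = "G\<lparr>carrier := norm_of Q\<rparr>"
  interpret N: fin_group ?N using fin_group_subgroup Nq by simp
  have QN: "Q \<subseteq> norm_of Q" by (rule subset_norm_of[OF assms(1)])
  have "{c \<in> rcosets Q. \<forall>q\<in>Q. c #> q = c} = rcosets\<^bsub>?N\<^esub> Q"
  proof (intro equalityI subsetI)
    fix c assume "c \<in> {c \<in> rcosets Q. \<forall>q\<in>Q. c #> q = c}"
    then obtain g where g: "g \<in> carrier G" "c = Q #> g" "\<forall>q\<in>Q. Q #> g #> q = Q #> g" by (auto simp: RCOSETS_def)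
    then have "g \<in> norm_of Q" using fixed_rcoset_iff[OF assms(1) g(1)] subgroup.mem_carrier[OF assms(1)]
      by (intro norm_ofI assms) auto
    then show "c \<in> rcosets\<^bsub>?N\<^esub> Q" using g by (auto simp: RCOSETS_def)
  next
    fix c assume "c \<in> rcosets\<^bsub>?N\<^esub> Q"
    then obtain g where g: "g \<in> norm_of Q" "c = Q #> g" by (auto simp: RCOSETS_def)
    have gc: "g \<in> carrier G" using g norm_of_subset by blast
    have "Q #> g #> q = Q #> g" if "q \<in> Q" for q
      using fixed_rcoset_iff[OF assms(1) gc] that g subgroup.mem_carrier[OF assms(1)] by (auto simp: norm_of_def conjs_def)
    then show "c \<in> {c \<in> rcosets Q. \<forall>q\<in>Q. c #> q = c}" using g gc by (auto simp: RCOSETS_def)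
  qed
  moreover have "card (rcosets\<^bsub>?N\<^esub> Q) = card (norm_of Q) div card Q"
    using N.card_rcosets[OF subgroup_incl[OF assms(1) Nq QN]] by simp
  ultimately show ?thesis
    using card_fixed_rcosets_cong[OF assms(1,2,3,1)] assms(4) by (metis cong_dvd_iff)
qed

text \<open>Stated for any set whose conjugates in \<open>G\<close> are already conjugates under
  \<open>N\<close>, since it is applied to Sylow subgroups and also to Schur-Zassenhaus
  complements.\<close>

lemma frattini:
  assumes "N \<lhd> G" "A \<subseteq> carrier G" 
    and "\<And>g. g \<in> carrier G \<Longrightarrow> \<exists>n\<in>N. conjs g A = conjs n A"
  shows "N <#> norm_of A = carrier G"
proof
  have Nc: "N \<subseteq> carrier G" using assms(1) normal_imp_subgroup subgroup.subset by blast
  show "N <#> norm_of A \<subseteq> carrier G" using Nc norm_of_subset by (simp add: setmult_subset_G)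
  show "carrier G \<subseteq> N <#> norm_of A"
  proof
    fix g assume g: "g \<in> carrier G"
    then obtain n where n: "n \<in> N" "conjs g A = conjs n A" using assms(3) by blast
    have nc: "n \<in> carrier G" using n Nc by auto
    have "conjs (inv n \<otimes> g) A = A" 
      using conjs_mult[of "inv n" g A] conjs_inv[OF nc assms(2)] n g nc assms(2) by simp
    then have "inv n \<otimes> g \<in> norm_of A" using nc g by (simp add: norm_of_def)
    moreover have "g = n \<otimes> (inv n \<otimes> g)" using nc g by (simp add: m_assoc[symmetric])
    ultimately show "g \<in> N <#> norm_of A" using n by (auto simp: set_mult_def)
  qed
qed

lemma conjs_sub: "subgroup H G \<Longrightarrow> g \<in> H \<Longrightarrow> fin_group.conjs (G\<lparr>carrier := H\<rparr>) g A = conjs g A"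
  by (simp add: fin_group.conjs_def fin_group_subgroup conjs_def m_inv_consistent)

lemma frattini_sylow:
  assumes "N \<lhd> G" "subgroup P G" "P \<subseteq> N" "Factorial_Ring.prime p" "card P = p ^ k"
    and "\<not> p dvd card N div card P"
  shows "N <#> norm_of P = carrier G"
proof (rule frattini[OF assms(1) subgroup.subset[OF assms(2)]])
  fix g assume g: "g \<in> carrier G"
  have N: "subgroup N G" using assms(1) normal_imp_subgroup by blast
  interpret N: fin_group "G\<lparr>carrier := N\<rparr>" by (rule fin_group_subgroup[OF N])
  have Pc: "P \<subseteq> carrier G" using assms(2) subgroup.subset by blast
  have gP: "subgroup (conjs g P) G" "conjs g P \<subseteq> N" "card (conjs g P) = card P"
    using conjs_subgroup[OF g assms(2)] conjs_mono[OF assms(3)] conjs_normal[OF assms(1) g] conjs_card[OF g Pc] by auto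
  obtain n where n: "n \<in> N" "conjs n (conjs g P) \<subseteq> P"
    using N.sylow_conj_into[OF subgroup_incl[OF assms(2) N assms(3)] assms(4) _ subgroup_incl[OF gP(1) N gP(2)], of k]
      gP(3) assms(5,6) conjs_sub[OF N] by auto
  have nc: "n \<in> carrier G" using n N subgroup.mem_carrier by metis
  have gPc: "conjs g P \<subseteq> carrier G" using conjs_subset g Pc by simp
  have "conjs n (conjs g P) = P"
    using n(2) conjs_card[OF nc gPc] gP(3) finite_subgroup[OF assms(2)] by (simp add: card_subset_eq)
  then have "conjs g P = conjs (inv n) P" using conjs_inv[OF nc gPc] by simp
  then show "\<exists>n\<in>N. conjs g P = conjs n P" using n N subgroup.m_inv_closed by metis
qed

text \<open>Any nontrivial element generates such a group, which is therefore cyclic.\<close>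

lemma no_proper_subgroup_comm:
  assumes "\<And>H. subgroup H G \<Longrightarrow> H = {\<one>} \<or> H = carrier G"
  shows "comm_group G"
proof (cases "carrier G = {\<one>}")
  case True then show ?thesis by (intro group_comm_groupI) auto
next
  case False
  then obtain x where x: "x \<in> carrier G" "x \<noteq> \<one>" by blast
  have "subgroup (generate G {x}) G" "x \<in> generate G {x}"
    using x generate_is_subgroup[of "{x}"] by (auto intro: generate.incl)
  then have gen: "carrier G = generate G {x}" using assms x by blast
  show ?thesis
  proof (rule group_comm_groupI)
    fix a b assume "a \<in> carrier G" "b \<in> carrier G"
    then obtain i j :: int where "a = x [^] i" "b = x [^] j" using gen generate_pow[OF x(1)] by auto
    then show "a \<otimes> b = b \<otimes> a" using x by (simp add: int_pow_mult[symmetric] add.commute)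
  qed
qed

lemma ex_max_subgroup:
  assumes "P K" "\<And>H. P H \<Longrightarrow> subgroup H G"
  obtains H where "P H" "\<And>K. P K \<Longrightarrow> card K \<le> card H"
proof -
  have "\<forall>H. P H \<longrightarrow> card H < Suc (card (carrier G))"
    using assms(2) fin by (meson card_mono subgroup.subset le_imp_less_Suc)
  from ex_has_greatest_nat[of P K card, OF assms(1) this] obtain H
    where "P H" "\<forall>K. P K \<longrightarrow> card K \<le> card H" by blast
  then show ?thesis using that by blast
qed

text \<open>A maximal subgroup is properly contained in its normalizer and hence normal; the
  quotient by it has no proper nontrivial subgroup and is abelian, so the derived subgroup lies in
  the maximal one.\<close>

lemma p_group_derived_neq:
  assumes "Factorial_Ring.prime p" "card (carrier G) = p ^ k" "carrier G \<noteq> {\<one>}"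
  shows "derived G (carrier G) \<noteq> carrier G"
proof -
  obtain W where W: "subgroup W G" "W \<noteq> carrier G"
    and max: "\<And>H. subgroup H G \<Longrightarrow> H \<noteq> carrier G \<Longrightarrow> card H \<le> card W"
    using ex_max_subgroup[of "\<lambda>H. subgroup H G \<and> H \<noteq> carrier G" "{\<one>}"] assms(3) triv_subgroup by metis
  have cW: "card W dvd p ^ k" using card_subgroup_dvd W assms by metis
  then obtain j where j: "card W = p ^ j" using assms(1) divides_primepow_nat by metis
  have "card (carrier G) div card W \<noteq> 1" using index_1_imp_eq[OF W(1) subgroup_self] W subgroup.subset by blast
  moreover have "card (carrier G) div card W dvd p ^ k"
    using assms(2) card_index[OF W(1) subgroup_self] W subgroup.subset by (metis dvd_triv_right)
  ultimately have "p dvd card (carrier G) div card W" using assms(1)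
    by (metis divides_primepow_nat power_0 dvd_power neq0_conv)
  then have "p dvd card (norm_of W) div card W" using normalizers_grow[OF W(1) assms(1) j] by blast
  then have "norm_of W \<noteq> W" using assms(1) card_subgroup_pos[OF W(1)] by (metis div_self less_numeral_extra(3) nat_dvd_1_iff_1 not_prime_1)
  moreover have Ns: "subgroup (norm_of W) G" using norm_of_subgroup W(1) subgroup.subset by metis
  have larger: "H = W \<or> H = carrier G" if "subgroup H G" "W \<subseteq> H" for H
    using max[OF that(1)] that W(1) by (metis card_seteq finite_subgroup)
  ultimately have "norm_of W = carrier G" using larger[OF Ns] subset_norm_of[OF W(1)] by blast
  then have Wn: "W \<lhd> G" using norm_of_eq_carrier_iff W by blast
  interpret E: fin_epi G "G Mod W" "\<lambda>g. W #> g" using fin_epi_Mod[OF Wn] by simp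
  have "comm_group (G Mod W)"
  proof (rule E.H.no_proper_subgroup_comm)
    fix H assume H: "subgroup H (G Mod W)"
    have "W \<subseteq> E.pre H" using E.ker_subset_pre[OF H] fin_epi_Mod(2)[OF Wn] by simp
    then have "E.pre H = W \<or> E.pre H = carrier G" using larger[OF E.subgroup_pre[OF H]] by simp
    then have "H = (\<lambda>g. W #> g) ` W \<or> H = (\<lambda>g. W #> g) ` carrier G"
      using E.image_pre[OF subgroup.subset[OF H]] by metis
    moreover have "(\<lambda>g. W #> g) ` W = {\<one>\<^bsub>G Mod W\<^esub>}"
      using W(1) coset_join2 subgroup.mem_carrier[OF W(1)] subgroup.one_closed[OF W(1)] by (force)
    ultimately show "H = {\<one>\<^bsub>G Mod W\<^esub>} \<or> H = carrier (G Mod W)" using E.surj by auto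
  qed
  then have "derived G (carrier G) \<subseteq> W" using derived_minimal[OF Wn] by simp
  then show ?thesis using W subgroup.subset by blast
qed

end

section \<open>The Schur--Zassenhaus theorem\<close>

text \<open>
  For a transversal \<open>R\<close> of the abelian normal subgroup \<open>N\<close> of index \<open>m\<close>, the product over all
  cosets \<open>c\<close> of \<open>x R(c) R(xc)\<^sup>-\<^sup>1\<close> is a crossed homomorphism into \<open>N\<close>, equal to the \<open>m\<close>-th power
  on \<open>N\<close>.  If \<open>m\<close> is coprime to \<open>card N\<close>, its kernel is a complement, and comparing two
  transversals gives conjugacy.
\<close>

lemma (in group) mult_inv_cancel:
  assumes "x \<in> carrier G" "y \<in> carrier G"
  shows "x \<otimes> (inv x \<otimes> y) = y" "inv x \<otimes> (x \<otimes> y) = y"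
  using assms by (simp_all add: m_assoc[symmetric])

locale abelian_normal = fin_group +
  fixes N
  assumes normal: "N \<lhd> G"
    and commute: "a \<in> N \<Longrightarrow> b \<in> N \<Longrightarrow> a \<otimes> b = b \<otimes> a"
begin

lemma subgroup_N: "subgroup N G" using normal normal_imp_subgroup by blast

lemma N_carrier: "a \<in> N \<Longrightarrow> a \<in> carrier G" using subgroup_N subgroup.mem_carrier by metis

lemma N_conj: "x \<in> carrier G \<Longrightarrow> a \<in> N \<Longrightarrow> x \<otimes> a \<otimes> inv x \<in> N"
  using normal by (simp add: normal_iff)

sublocale N: comm_group "G\<lparr>carrier := N\<rparr>"
  rewrites "carrier (G\<lparr>carrier := N\<rparr>) = N" and "monoid.mult (G\<lparr>carrier := N\<rparr>) = monoid.mult G"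
    and "one (G\<lparr>carrier := N\<rparr>) = one G"
proof -
  interpret g: group "G\<lparr>carrier := N\<rparr>" using subgroup_N by (simp add: subgroup.subgroup_is_group is_group)
  show "comm_group (G\<lparr>carrier := N\<rparr>)" by (rule g.group_comm_groupI) (use commute in simp)
qed auto

definition NP where "NP f = finprod (G\<lparr>carrier := N\<rparr>) f (rcosets N)"

lemma finite_rcosets_N: "finite (rcosets N)"
  using finite_subset[OF rcosets_subset_PowG[OF subgroup_N]] fin by simp

lemma NP_closed: "(\<And>c. c \<in> rcosets N \<Longrightarrow> f c \<in> N) \<Longrightarrow> NP f \<in> N"
  unfolding NP_def by (rule N.finprod_closed) auto

lemma NP_cong: "(\<And>c. c \<in> rcosets N \<Longrightarrow> g c \<in> N) \<Longrightarrow> (\<And>c. c \<in> rcosets N \<Longrightarrow> f c = g c) \<Longrightarrow> NP f = NP g"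
  unfolding NP_def by (rule N.finprod_cong') auto

lemma NP_mult: "(\<And>c. c \<in> rcosets N \<Longrightarrow> f c \<in> N) \<Longrightarrow> (\<And>c. c \<in> rcosets N \<Longrightarrow> g c \<in> N) \<Longrightarrow>
    NP (\<lambda>c. f c \<otimes> g c) = NP f \<otimes> NP g"
  unfolding NP_def by (rule N.finprod_multf) auto

lemma NP_const: "a \<in> N \<Longrightarrow> NP (\<lambda>c. a) = a [^] (card (rcosets N))"
  unfolding NP_def by (simp add: N.finprod_const nat_pow_consistent[symmetric])

text \<open>Conjugation by an element of \<open>G\<close> acts on \<open>N\<close> from outside the
  record in which the product is formed, so it is pushed through factor by factor.\<close>

lemma NP_conj:
  assumes "x \<in> carrier G" "\<And>c. c \<in> rcosets N \<Longrightarrow> f c \<in> N"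
  shows "NP (\<lambda>c. x \<otimes> f c \<otimes> inv x) = x \<otimes> NP f \<otimes> inv x"
proof -
  have "finprod (G\<lparr>carrier := N\<rparr>) (\<lambda>c. x \<otimes> f c \<otimes> inv x) I = x \<otimes> finprod (G\<lparr>carrier := N\<rparr>) f I \<otimes> inv x"
    if "finite I" "I \<subseteq> rcosets N" for I
    using that
  proof (induction rule: finite_induct)
    case empty
    then show ?case using assms(1) by simp
  next
    case (insert c I)
    have f: "f \<in> I \<rightarrow> N" "f c \<in> N" "(\<lambda>c. x \<otimes> f c \<otimes> inv x) \<in> I \<rightarrow> N" "x \<otimes> f c \<otimes> inv x \<in> N"
      using insert.prems assms N_conj by auto
    have "finprod (G\<lparr>carrier := N\<rparr>) f I \<in> N" using f by (intro N.finprod_closed) auto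
    then have "x \<otimes> (f c \<otimes> finprod (G\<lparr>carrier := N\<rparr>) f I) \<otimes> inv x
      = (x \<otimes> f c \<otimes> inv x) \<otimes> (x \<otimes> finprod (G\<lparr>carrier := N\<rparr>) f I \<otimes> inv x)"
      using f N_carrier assms(1) by (simp add: m_assoc mult_inv_cancel)
    then show ?case using insert f by (simp add: N.finprod_insert)
  qed
  then show ?thesis unfolding NP_def using finite_rcosets_N by blast
qed

lemma coset_shift:
  assumes "x \<in> carrier G" "r \<in> carrier G"
  shows "x <# (N #> r) = N #> (x \<otimes> r)"
  using assms normal subgroup.subset[OF subgroup_N] normal.coset_eq[OF normal]
  by (metis coset_assoc coset_mult_assoc)

lemma shift_closed: 
  assumes "x \<in> carrier G" "c \<in> rcosets N"
  shows "x <# c \<in> rcosets N"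
proof -
  from assms(2) obtain r where "r \<in> carrier G" "c = N #> r" by (auto simp: RCOSETS_def)
  then show ?thesis using coset_shift assms(1) by (simp add: rcosetsI subgroup.subset[OF subgroup_N])
qed

lemma shift_shift:
  assumes "x \<in> carrier G" "y \<in> carrier G" "c \<in> rcosets N"
  shows "x <# (y <# c) = (x \<otimes> y) <# c"
proof -
  from assms(3) obtain r where "r \<in> carrier G" "c = N #> r" by (auto simp: RCOSETS_def)
  then show ?thesis using coset_shift assms by (simp add: m_assoc)
qed

lemma shift_N:
  assumes "a \<in> N" "c \<in> rcosets N"
  shows "a <# c = c"
proof -
  from assms(2) obtain r where r: "r \<in> carrier G" "c = N #> r" by (auto simp: RCOSETS_def)
  then have "a <# c = N #> a #> r" 
    using coset_shift N_carrier[OF assms(1)] by (simp add: coset_mult_assoc subgroup.subset[OF subgroup_N])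
  then show ?thesis using r coset_join2[OF N_carrier[OF assms(1)] subgroup_N assms(1)] by simp
qed

lemma shift_bij: "x \<in> carrier G \<Longrightarrow> bij_betw (\<lambda>c. x <# c) (rcosets N) (rcosets N)"
  by (rule bij_betw_byWitness[where f' = "\<lambda>c. inv x <# c"])
    (auto simp: shift_shift shift_closed shift_N[OF subgroup.one_closed[OF subgroup_N]])

lemma NP_shift:
  assumes "x \<in> carrier G" "\<And>c. c \<in> rcosets N \<Longrightarrow> f c \<in> N"
  shows "NP (\<lambda>c. f (x <# c)) = NP f"
  unfolding NP_def
  using N.finprod_reindex[of f "\<lambda>c. x <# c" "rcosets N"] shift_bij[OF assms(1)] assms(2)
  by (auto simp: bij_betw_def)

lemma coset_diff:
  assumes "c \<in> rcosets N" "a \<in> c" "b \<in> c"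
  shows "a \<otimes> inv b \<in> N" "a \<in> carrier G"
proof -
  from assms obtain r s t where "r \<in> carrier G" "s \<in> N" "t \<in> N" "a = s \<otimes> r" "b = t \<otimes> r"
    by (auto simp: RCOSETS_def r_coset_def)
  moreover from this have "a \<otimes> inv b = s \<otimes> inv t"
    using N_carrier by (simp add: inv_mult_group m_assoc mult_inv_cancel)
  ultimately show "a \<otimes> inv b \<in> N" "a \<in> carrier G" using subgroup_N N_carrier 
    by (auto simp: subgroup.m_closed subgroup.m_inv_closed)
qed

lemma shift_mem: "x \<in> carrier G \<Longrightarrow> a \<in> c \<Longrightarrow> x \<otimes> a \<in> x <# c"
  by (auto simp: l_coset_def)

text \<open>A transversal is a choice function on the cosets rather than a set, so that its values
  can be factors of a product over all cosets.\<close>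

definition transv where "transv R \<longleftrightarrow> (\<forall>c\<in>rcosets N. R c \<in> c)"

definition dd where "dd R x = NP (\<lambda>c. x \<otimes> R c \<otimes> inv (R (x <# c)))"

lemma transv_carrier: "transv R \<Longrightarrow> c \<in> rcosets N \<Longrightarrow> R c \<in> carrier G"
  using coset_diff(2) by (auto simp: transv_def)

lemma dd_factor: "transv R \<Longrightarrow> x \<in> carrier G \<Longrightarrow> c \<in> rcosets N \<Longrightarrow> x \<otimes> R c \<otimes> inv (R (x <# c)) \<in> N"
  using coset_diff(1)[OF shift_closed] shift_mem shift_closed by (auto simp: transv_def)

lemma dd_closed: "transv R \<Longrightarrow> x \<in> carrier G \<Longrightarrow> dd R x \<in> N"
  unfolding dd_def by (intro NP_closed dd_factor)

text \<open>The factor of x y at c is the conjugate by x of the factor of y at c, times the factor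
  of x at the coset y c: the two representatives of y c cancel. Reindexing by y removes the
  shift.\<close>

lemma dd_mult:
  assumes R: "transv R" and x: "x \<in> carrier G" and y: "y \<in> carrier G"
  shows "dd R (x \<otimes> y) = (x \<otimes> dd R y \<otimes> inv x) \<otimes> dd R x"
proof -
  let ?f = "\<lambda>c. y \<otimes> R c \<otimes> inv (R (y <# c))"
  let ?g = "\<lambda>c. x \<otimes> R c \<otimes> inv (R (x <# c))"
  have f: "?f c \<in> N" "?g c \<in> N" "x \<otimes> ?f c \<otimes> inv x \<in> N" if "c \<in> rcosets N" for c
    using dd_factor[OF R x that] dd_factor[OF R y that] N_conj[OF x] by auto
  have "dd R (x \<otimes> y) = NP (\<lambda>c. (x \<otimes> ?f c \<otimes> inv x) \<otimes> ?g (y <# c))"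
    unfolding dd_def
  proof (rule NP_cong)
    fix c assume c: "c \<in> rcosets N"
    note yc = shift_closed[OF y c] and xyc = shift_closed[OF x shift_closed[OF y c]]
    show "(x \<otimes> ?f c \<otimes> inv x) \<otimes> ?g (y <# c) \<in> N"
      using f(3)[OF c] f(2)[OF yc] subgroup_N by (simp add: subgroup.m_closed)
    have [simp]: "R c \<in> carrier G" "R (y <# c) \<in> carrier G" "R (x <# (y <# c)) \<in> carrier G"
      using transv_carrier[OF R] c yc xyc by auto
    have "(x \<otimes> ?f c \<otimes> inv x) \<otimes> ?g (y <# c) = x \<otimes> y \<otimes> R c \<otimes> inv (R (x <# (y <# c)))"
      using x y by (simp add: m_assoc mult_inv_cancel)
    then show "x \<otimes> y \<otimes> R c \<otimes> inv (R (x \<otimes> y <# c)) = (x \<otimes> ?f c \<otimes> inv x) \<otimes> ?g (y <# c)"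
      using shift_shift[OF x y c] by simp
  qed
  also have "\<dots> = NP (\<lambda>c. x \<otimes> ?f c \<otimes> inv x) \<otimes> NP (\<lambda>c. ?g (y <# c))"
    by (rule NP_mult) (use f shift_closed[OF y] in auto)
  also have "\<dots> = (x \<otimes> dd R y \<otimes> inv x) \<otimes> dd R x"
    using NP_conj[OF x f(1)] NP_shift[OF y, of ?g] f(2) by (simp add: dd_def)
  finally show ?thesis .
qed

text \<open>Elements of \<open>N\<close> fix every coset, so each of the factors is \<open>a\<close>
  itself.\<close>

lemma dd_N:
  assumes R: "transv R" and a: "a \<in> N"
  shows "dd R a = a [^] card (rcosets N)"
proof -
  have "dd R a = NP (\<lambda>c. a)"
    unfolding dd_def
    by (rule NP_cong) (use a shift_N transv_carrier[OF R] N_carrier in \<open>auto simp: m_assoc\<close>)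
  then show ?thesis using NP_const[OF a] by simp
qed

lemma dd_one: "transv R \<Longrightarrow> dd R \<one> = \<one>"
  using dd_N subgroup.one_closed[OF subgroup_N] by simp

definition ddker where "ddker R = {x \<in> carrier G. dd R x = \<one>}"

lemma ddker_subgroup:
  assumes R: "transv R"
  shows "subgroup (ddker R) G"
proof (rule subgroupI)
  show "ddker R \<subseteq> carrier G" by (auto simp: ddker_def)
  show "ddker R \<noteq> {}" using dd_one[OF R] by (auto simp: ddker_def)
  fix x assume x: "x \<in> ddker R"
  then have xc: "x \<in> carrier G" and dx: "dd R x = \<one>" by (auto simp: ddker_def)
  have "dd R (inv x) = \<one>"
    using dd_mult[OF R, of "inv x" x] dd_one[OF R] xc dx dd_closed[OF R, of "inv x"] N_carrier by simp
  then show "inv x \<in> ddker R" using xc by (simp add: ddker_def)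
  fix y assume "y \<in> ddker R"
  then show "x \<otimes> y \<in> ddker R" using x dd_mult[OF R] by (auto simp: ddker_def)
qed

context assumes cop: "coprime (card N) (card (carrier G) div card N)"
begin

text \<open>Bezout inverts the index modulo |N|, so raising to this power is a bijection of
  \<open>N\<close>; the last clause is its injectivity at 1.\<close>

lemma ex_root: 
  assumes "a \<in> N"
  obtains b where "b \<in> N" "b [^] card (rcosets N) = a"
    "a [^] card (rcosets N) = \<one> \<Longrightarrow> a = \<one>"
proof -
  let ?m = "card (rcosets N)"
  have m: "?m = card (carrier G) div card N" by (rule card_rcosets[OF subgroup_N])
  have "?m \<noteq> 0" using m index_pos[OF subgroup_N subgroup_self] subgroup.subset[OF subgroup_N] by simp
  then obtain u v where uv: "?m * u = card N * v + 1" 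
    using bezout_nat[of ?m "card N"] cop m by (metis coprime_iff_gcd_eq_1 gcd.commute)
  have ac: "a \<in> carrier G" using assms N_carrier by blast
  have "a [^] card N = \<one>" 
    using group.pow_order_eq_1[OF N.is_group, of a] assms by (simp add: order_def nat_pow_consistent[symmetric])
  then have "a [^] (card N * v + 1) = a" using ac by (simp add: nat_pow_mult[symmetric] nat_pow_pow[symmetric])
  then have au: "a [^] (?m * u) = a" using uv by simp
  show ?thesis
  proof
    show "a [^] u \<in> N" using assms subgroup_N 
      by (metis nat_pow_consistent N.nat_pow_closed)
    show "(a [^] u) [^] ?m = a" using au ac by (simp add: nat_pow_pow mult.commute)
    show "a = \<one>" if "a [^] ?m = \<one>" using au ac that by (metis nat_pow_pow nat_pow_one)
  qed
qed

lemma ddker_complement: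
  assumes R: "transv R"
  shows "N \<inter> ddker R = {\<one>}" "card (ddker R) = card (carrier G) div card N"
proof -
  show i: "N \<inter> ddker R = {\<one>}"
    using dd_N[OF R] ex_root subgroup.one_closed[OF subgroup_N] subgroup.one_closed[OF ddker_subgroup[OF R]]
    by (auto simp: ddker_def) metis
  have "carrier G \<subseteq> N <#> ddker R"
  proof
    fix x assume x: "x \<in> carrier G"
    have dx: "dd R x \<in> N" using dd_closed R x by blast
    \<comment> \<open>The root is chosen so that dd(b x) = b dd(x) b^-1 dd(b) = dd(x) dd(b) = 1,
      \<open>N\<close> being abelian.\<close>
    obtain b where b: "b \<in> N" "b [^] card (rcosets N) = inv (dd R x)"
      using ex_root[OF subgroup.m_inv_closed[OF subgroup_N dx]] by metis
    have bc: "b \<in> carrier G" using b N_carrier by auto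
    have "dd R (b \<otimes> x) = \<one>"
      using dd_mult[OF R bc x] dd_N[OF R b(1)] b commute[OF b(1) dx] bc N_carrier[OF dx] by (simp add: m_assoc)
    then have "b \<otimes> x \<in> ddker R" using bc x by (simp add: ddker_def)
    moreover have "x = inv b \<otimes> (b \<otimes> x)" using bc x by (simp add: m_assoc[symmetric])
    ultimately show "x \<in> N <#> ddker R" using subgroup.m_inv_closed[OF subgroup_N b(1)] 
      unfolding set_mult_def by blast
  qed
  then have e: "N <#> ddker R = carrier G"
    using card_set_mult_normal(2)[OF normal ddker_subgroup[OF R]] subgroup.subset by blast
  show "card (ddker R) = card (carrier G) div card N"
    using card_set_mult_normal(1)[OF normal ddker_subgroup[OF R]] i e card_subgroup_pos[OF subgroup_N] by simp
qed

lemma abelian_complement_exists: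
  "\<exists>H. subgroup H G \<and> card H = card (carrier G) div card N"
proof -
  have "transv (\<lambda>c. SOME x. x \<in> c)" unfolding transv_def
    using subgroup.rcosets_non_empty[OF subgroup_N] by (auto intro!: some_in_eq[THEN iffD2])
  then show ?thesis using ddker_subgroup ddker_complement by blast
qed

text \<open>A complement is itself a set of representatives. The representative in \<open>L\<close>
  of a coset is unique, and this forces equivariance under \<open>L\<close>.\<close>

lemma complement_transversal:
  assumes L: "subgroup L G" "card L = card (carrier G) div card N"
  obtains R where "transv R" "\<And>l c. l \<in> L \<Longrightarrow> c \<in> rcosets N \<Longrightarrow> R (l <# c) = l \<otimes> R c"
proof -
  have Lc: "l \<in> carrier G" if "l \<in> L" for l using that L subgroup.mem_carrier by metis
  have NL: "subgroup (N \<inter> L) G" using subgroups_Inter_pair[OF subgroup_N L(1)] .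
  have "card (N \<inter> L) dvd card N" "card (N \<inter> L) dvd card L"
    using card_subgroup_dvd_subgroup NL subgroup_N L(1) by auto
  then have "card (N \<inter> L) = 1" using cop L(2) by (metis coprime_common_divisor_nat)
  then have i: "N \<inter> L = {\<one>}" using subgroup.one_closed[OF NL] by (metis card_1_singletonE singletonD)
  have "card (N <#> L) = card N * card L" using card_set_mult_normal(1)[OF normal L(1)] i by simp
  also have "\<dots> = card (carrier G)" using L(2) card_subgroup_dvd[OF subgroup_N] by simp
  finally have e: "N <#> L = carrier G"
    using card_set_mult_normal(2)[OF normal L(1)] card_eq_imp_eq subgroup_self subgroup.subset by metis
  define R where "R c = (SOME l. l \<in> L \<and> l \<in> c)" for c
  have R: "R c \<in> L \<and> R c \<in> c" if c: "c \<in> rcosets N" for c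
  proof -
    from c obtain r where r: "r \<in> carrier G" "c = N #> r" by (auto simp: RCOSETS_def)
    then have "r \<in> N <#> L" using e by simp
    then obtain a l where al: "a \<in> N" "l \<in> L" "r = a \<otimes> l" by (auto simp: set_mult_def)
    have "l = inv a \<otimes> r" using al N_carrier Lc by (simp add: m_assoc[symmetric])
    then have "l \<in> c" using al r subgroup.m_inv_closed[OF subgroup_N] by (auto simp: r_coset_def)
    then show ?thesis unfolding R_def using al by (intro someI[of "\<lambda>l. l \<in> L \<and> l \<in> c"]) auto
  qed
  have uniq: "l = l'" if "c \<in> rcosets N" "l \<in> L" "l' \<in> L" "l \<in> c" "l' \<in> c" for l l' c
  proof -
    have "l \<otimes> inv l' \<in> N \<inter> L" using coset_diff[OF that(1,4,5)] that L by (simp add: subgroup.m_closed subgroup.m_inv_closed)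
    then have "l \<otimes> inv l' = \<one>" using i by auto
    then show ?thesis using that Lc by (metis inv_equality inv_inv inv_closed)
  qed
  show ?thesis
  proof
    show "transv R" using R by (simp add: transv_def)
    fix l c assume lc: "l \<in> L" "c \<in> rcosets N"
    show "R (l <# c) = l \<otimes> R c"
      by (rule uniq[OF shift_closed[OF Lc[OF lc(1)] lc(2)]])
        (use R lc shift_closed Lc L shift_mem in \<open>auto simp: subgroup.m_closed\<close>)
  qed
qed

text \<open>For its own equivariant transversal \<open>R\<close>, all factors of dd on
  \<open>L\<close> are 1, so by orders \<open>L\<close> is the kernel of \<open>dd R\<close>. It
  remains to conjugate \<open>K\<close> into this kernel.\<close>

lemma abelian_complements_conj:
  assumes L: "subgroup L G" "card L = card (carrier G) div card N"
    and K: "subgroup K G" "card K = card (carrier G) div card N"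
  obtains a where "a \<in> N" "conjs a K = L"
proof -
  obtain R where R: "transv R" and RL: "\<And>l c. l \<in> L \<Longrightarrow> c \<in> rcosets N \<Longrightarrow> R (l <# c) = l \<otimes> R c"
    using complement_transversal[OF L] by metis
  obtain T where T: "transv T" and TK: "\<And>k c. k \<in> K \<Longrightarrow> c \<in> rcosets N \<Longrightarrow> T (k <# c) = k \<otimes> T c"
    using complement_transversal[OF K] by metis
  have Lc: "l \<in> carrier G" if "l \<in> L" for l using that L subgroup.mem_carrier by metis
  have Kc: "l \<in> carrier G" if "l \<in> K" for l using that K subgroup.mem_carrier by metis
  have "dd R l = \<one>" if l: "l \<in> L" for l
  proof -
    have "dd R l = NP (\<lambda>c. \<one>)" unfolding dd_def
      by (rule NP_cong) (use l RL transv_carrier[OF R] Lc subgroup.one_closed[OF subgroup_N] in auto)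
    then show ?thesis using NP_const[OF subgroup.one_closed[OF subgroup_N]] by simp
  qed
  then have "L \<subseteq> ddker R" using Lc by (auto simp: ddker_def)
  then have LR: "L = ddker R"
    using card_eq_imp_eq[OF L(1) ddker_subgroup[OF R]] ddker_complement(2)[OF R] L(2) by simp
  \<comment> \<open>The difference of the two transversals. Equivariance of \<open>T\<close> under
    \<open>K\<close> makes \<open>dd R\<close> on \<open>K\<close> the coboundary k F k^-1
    F^-1.\<close>
  define F where "F = NP (\<lambda>c. R c \<otimes> inv (T c))"
  have f: "R c \<otimes> inv (T c) \<in> N" if "c \<in> rcosets N" for c
    using coset_diff(1)[OF that] R T that by (simp add: transv_def)
  have F: "F \<in> N" unfolding F_def by (rule NP_closed[OF f])
  have Fi: "NP (\<lambda>c. T c \<otimes> inv (R c)) = inv F"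
  proof -
    have f': "T c \<otimes> inv (R c) \<in> N" if "c \<in> rcosets N" for c
      using coset_diff(1)[OF that] R T that by (simp add: transv_def)
    have "NP (\<lambda>c. (T c \<otimes> inv (R c)) \<otimes> (R c \<otimes> inv (T c))) = NP (\<lambda>c. \<one>)"
      by (rule NP_cong) (use transv_carrier[OF R] transv_carrier[OF T] subgroup.one_closed[OF subgroup_N] in
         \<open>auto simp: m_assoc mult_inv_cancel\<close>)
    then have "NP (\<lambda>c. T c \<otimes> inv (R c)) \<otimes> F = \<one>"
      using NP_mult[OF f' f] NP_const[OF subgroup.one_closed[OF subgroup_N]] by (simp add: F_def)
    from inv_equality[OF this] show ?thesis using F NP_closed[OF f'] N_carrier by simp
  qed
  have dk: "dd R k = (k \<otimes> F \<otimes> inv k) \<otimes> inv F" if k: "k \<in> K" for k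
  proof -
    have kc: "k \<in> carrier G" using k Kc by auto
    let ?g = "\<lambda>c. T c \<otimes> inv (R c)"
    have g: "?g c \<in> N" if "c \<in> rcosets N" for c
      using coset_diff(1)[OF that] R T that by (simp add: transv_def)
    have "dd R k = NP (\<lambda>c. (k \<otimes> (R c \<otimes> inv (T c)) \<otimes> inv k) \<otimes> ?g (k <# c))"
      unfolding dd_def
    proof (rule NP_cong)
      fix c assume c: "c \<in> rcosets N"
      note kc' = shift_closed[OF kc c]
      show "(k \<otimes> (R c \<otimes> inv (T c)) \<otimes> inv k) \<otimes> ?g (k <# c) \<in> N"
        using N_conj[OF kc f[OF c]] g[OF kc'] subgroup_N by (simp add: subgroup.m_closed)
      have [simp]: "R c \<in> carrier G" "T c \<in> carrier G" "R (k <# c) \<in> carrier G"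
        using transv_carrier R T c kc' by auto
      show "k \<otimes> R c \<otimes> inv (R (k <# c)) = (k \<otimes> (R c \<otimes> inv (T c)) \<otimes> inv k) \<otimes> ?g (k <# c)"
        unfolding TK[OF k c] using kc by (simp add: m_assoc mult_inv_cancel)
    qed
    also have "\<dots> = NP (\<lambda>c. k \<otimes> (R c \<otimes> inv (T c)) \<otimes> inv k) \<otimes> NP (\<lambda>c. ?g (k <# c))"
      by (rule NP_mult) (use f g N_conj[OF kc] shift_closed[OF kc] in auto)
    also have "\<dots> = (k \<otimes> F \<otimes> inv k) \<otimes> inv F"
      using NP_conj[OF kc f] NP_shift[OF kc, of ?g] g Fi by (simp add: F_def)
    finally show ?thesis .
  qed
  \<comment> \<open>Conjugating by this root of F kills the coboundary: dd(a k a^-1) = dd(k a^-1) F,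
    where dd(k a^-1) = (k F^-1 k^-1) (k F k^-1 F^-1) = F^-1.\<close>
  obtain a where a: "a \<in> N" "a [^] card (rcosets N) = F" using ex_root[OF F] by metis
  have ac: "a \<in> carrier G" and ia: "inv a \<in> N" and Fc: "F \<in> carrier G" 
    using a N_carrier F subgroup.m_inv_closed[OF subgroup_N] by auto
  have da: "dd R a = F" using dd_N[OF R a(1)] a(2) by simp
  have dia: "dd R (inv a) = inv F" using dd_N[OF R ia] a(2) ac by (simp add: nat_pow_inv)
  have "dd R (a \<otimes> k \<otimes> inv a) = \<one>" if k: "k \<in> K" for k
  proof -
    have kc: "k \<in> carrier G" using k Kc by auto
    have dk': "dd R (k \<otimes> inv a) \<in> N" using dd_closed[OF R] kc ac by simp
    have "dd R (a \<otimes> k \<otimes> inv a) = (a \<otimes> dd R (k \<otimes> inv a) \<otimes> inv a) \<otimes> F"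
      using dd_mult[OF R ac, of "k \<otimes> inv a"] kc ac da by (simp add: m_assoc)
    also have "a \<otimes> dd R (k \<otimes> inv a) \<otimes> inv a = dd R (k \<otimes> inv a)"
      using commute[OF a(1) dk'] ac N_carrier[OF dk'] by (simp add: m_assoc)
    also have "dd R (k \<otimes> inv a) = (k \<otimes> inv F \<otimes> inv k) \<otimes> ((k \<otimes> F \<otimes> inv k) \<otimes> inv F)"
      using dd_mult[OF R kc, of "inv a"] ac dia dk[OF k] by simp
    also have "\<dots> \<otimes> F = \<one>" 
      using kc Fc by (simp add: m_assoc mult_inv_cancel)
    finally show ?thesis .
  qed
  then have "conjs a K \<subseteq> L" unfolding LR using ac Kc by (auto simp: conjs_def ddker_def)
  moreover have "card (conjs a K) = card L" using conjs_card[OF ac subgroup.subset[OF K(1)]] K L by simp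
  ultimately have "conjs a K = L" using finite_subgroup[OF L(1)] card_subset_eq by blast
  then show ?thesis using that a by blast
qed

end
end

section \<open>From abelian to arbitrary normal Hall subgroups\<close>

lemma (in fin_group) card_eq_1_iff:
  assumes "subgroup A G"
  shows "card A = 1 \<longleftrightarrow> A = {\<one>}"
proof
  assume "card A = 1"
  then obtain x where "A = {x}" by (rule card_1_singletonE)
  then show "A = {\<one>}" using subgroup.one_closed[OF assms] by auto
qed auto

lemma (in fin_group) abelian_normalI:
  assumes "N \<lhd> G" "\<And>a b. a \<in> N \<Longrightarrow> b \<in> N \<Longrightarrow> a \<otimes> b = b \<otimes> a"
  shows "abelian_normal G N"
  by (rule abelian_normal.intro[OF fin_group_axioms abelian_normal_axioms.intro[OF assms]])

text \<open>The second isomorphism theorem on the level of orders: |N M| |N \<inter> M| = |N| |M|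
  with N M = G.\<close>

lemma index_set_mult_normal:
  assumes "fin_group G" "N \<lhd> G" "subgroup M G" "N <#>\<^bsub>G\<^esub> M = carrier G"
  shows "card M div card (N \<inter> M) = card (carrier G) div card N"
proof -
  interpret fin_group G by fact
  have N: "subgroup N G" using assms normal_imp_subgroup by blast
  define q where "q = card M div card (N \<inter> M)"
  have 1: "card (carrier G) * card (N \<inter> M) = card N * card M"
    using card_set_mult_normal(1)[OF assms(2,3)] assms(4) by simp
  have 2: "card M = card (N \<inter> M) * q"
    unfolding q_def using card_index[OF subgroups_Inter_pair[OF N assms(3)] assms(3)] by simp
  have 3: "card (N \<inter> M) > 0" "card N > 0"
    using card_subgroup_pos N subgroups_Inter_pair[OF N assms(3)] by auto
  have "card (carrier G) = card N * q" using 1[unfolded 2] 3 by simp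
  then show ?thesis using 3 by (simp add: q_def)
qed

lemma (in fin_group) commute_if_derived_trivial:
  assumes "N \<subseteq> carrier G" "derived G N = {\<one>}" "a \<in> N" "b \<in> N"
  shows "a \<otimes> b = b \<otimes> a"
proof -
  have "a \<otimes> b \<otimes> inv a \<otimes> inv b \<in> derived G N" unfolding derived_def 
    using assms by (intro generate.incl) auto
  then have "a \<otimes> b \<otimes> inv a \<otimes> inv b = \<one>" using assms by auto
  moreover have "a \<in> carrier G" "b \<in> carrier G" using assms by auto
  ultimately show "a \<otimes> b = b \<otimes> a"
    by (metis inv_closed inv_equality inv_inv m_assoc m_closed inv_mult_group)
qed

text \<open>Induction on |G| through a Sylow subgroup P of N. If its normalizer is proper, Frattini
  shows that a complement found there has the right order. Otherwise P is normal in G, and either P'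
  or P can be factored out, or N = P is abelian.\<close>

theorem schur_zassenhaus_exists:
  assumes "fin_group G" "N \<lhd> G" "coprime (card N) (card (carrier G) div card N)"
  shows "\<exists>H. subgroup H G \<and> card H = card (carrier G) div card N"
  using assms
proof (induction "card (carrier G)" arbitrary: G N rule: less_induct)
  case less
  interpret fin_group G by fact
  have N: "subgroup N G" using less.prems normal_imp_subgroup by blast
  have Nc: "N \<subseteq> carrier G" using N subgroup.subset by blast
  show ?case
  proof (cases "card N = 1")
    case True then show ?thesis using subgroup_self by auto
  next
    case False
    then obtain p where p: "Factorial_Ring.prime p" "p dvd card N" using prime_factor_nat by blast
    interpret N: fin_group "G\<lparr>carrier := N\<rparr>" by (rule fin_group_subgroup[OF N])
    obtain P where P0: "subgroup P (G\<lparr>carrier := N\<rparr>)" "card P = p ^ multiplicity p (card N)" 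
      "\<not> p dvd card N div card P" using N.sylow_exists[OF p(1)] by auto
    have P: "subgroup P G" "P \<subseteq> N" using P0 incl_subgroup[OF N] subgroup.subset[OF P0(1)] by auto
    have Pc: "P \<subseteq> carrier G" using P Nc by blast
    define M where "M = norm_of P"
    have M: "subgroup M G" unfolding M_def by (rule norm_of_subgroup[OF Pc])
    have NM: "N <#>\<^bsub>G\<^esub> M = carrier G"
      unfolding M_def by (rule frattini_sylow[OF less.prems(2) P(1,2) p(1) P0(2,3)])
    show ?thesis
    proof (cases "M = carrier G")
      case False
      interpret M: fin_group "G\<lparr>carrier := M\<rparr>" by (rule fin_group_subgroup[OF M])
      have "card M < card (carrier G)" using False M subgroup.subset fin by (metis psubsetI psubset_card_mono)
      moreover have NMn: "N \<inter> M \<lhd> G\<lparr>carrier := M\<rparr>"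
        using normal_Int_subgroup[OF M less.prems(2)] by (simp add: Int_commute)
      moreover have i: "card M div card (N \<inter> M) = card (carrier G) div card N"
        by (rule index_set_mult_normal[OF fin_group_axioms less.prems(2) M NM])
      moreover have "card (N \<inter> M) dvd card N" 
        using card_subgroup_dvd_subgroup[OF subgroups_Inter_pair[OF N M] N] by simp
      then have "coprime (card (N \<inter> M)) (card M div card (N \<inter> M))"
        using less.prems(3) i by (metis coprime_divisors dvd_refl)
      ultimately obtain H where "subgroup H (G\<lparr>carrier := M\<rparr>)" "card H = card M div card (N \<inter> M)"
        using less.hyps[of "G\<lparr>carrier := M\<rparr>" "N \<inter> M"] M.fin_group_axioms by auto
      then show ?thesis using i incl_subgroup[OF M] by auto
    next
      case True
      then have Pn: "P \<lhd> G" using norm_of_eq_carrier_iff P(1) M_def by blast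
      have P1: "P \<noteq> {\<one>\<^bsub>G\<^esub>}"
      proof -
        have "multiplicity p (card N) > 0" using p False card_subgroup_pos[OF N] 
          by (metis multiplicity_gt_zero_iff not_prime_unit less_numeral_extra(3))
        then have "card P \<noteq> 1" using P0(2) p(1) by (metis nat_power_eq_Suc_0_iff One_nat_def not_prime_1 neq0_conv)
        then show ?thesis by auto
      qed
      let ?D = "derived G P"
      have Dn: "?D \<lhd> G" using derived_is_normal[OF Pn] .
      interpret P: fin_group "G\<lparr>carrier := P\<rparr>" by (rule fin_group_subgroup[OF P(1)])
      have DP: "?D \<subseteq> P" "?D \<noteq> P"
        using derived_incl[OF subset_refl P(1)] P.p_group_derived_neq[OF p(1), of "multiplicity p (card N)"] P0(2) P1
          derived_consistent[OF subset_refl P(1)] by auto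
      \<comment> \<open>Such an A allows two smaller applications: to G/A, and then, with A in place
        of N, to the preimage J of the complement found there. J is smaller than G because |J| = |G
        : N| |A| and |A| < |N|.\<close>
      have red: "\<exists>H. subgroup H G \<and> card H = card (carrier G) div card N"
        if A: "A \<lhd> G" "A \<noteq> {\<one>\<^bsub>G\<^esub>}" "A \<subset> N" for A
      proof -
        have As: "subgroup A G" using A normal_imp_subgroup by blast
        obtain Q f where "fin_epi G (Q :: ('a, 'b) monoid_scheme) f" and ker: "kernel G Q f = A"
          using ex_quotient[OF A(1)] by blast
        then interpret E: fin_epi G Q f by simp
        have fN: "subgroup (f ` N) Q" using E.subgroup_image[OF N] .
        have cA: "card A > 1"
          using card_eq_1_iff[OF As] card_subgroup_pos[OF As] A(2) by linarith
        have cG: "card (carrier G) = card (carrier Q) * card A" using E.card_carrier ker by simp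
        have cN: "card N = card (f ` N) * card A" using E.card_image_ker'[OF N] ker A(3) by auto
        have "card (carrier Q) < card (carrier G)" using cG cA E.H.card_carrier_pos by simp
        moreover have i: "card (carrier Q) div card (f ` N) = card (carrier G) div card N"
          using cG cN cA by simp
        moreover have "coprime (card (f ` N)) (card (carrier Q) div card (f ` N))"
          using less.prems(3) i cN by (metis coprime_mult_left_iff)
        ultimately obtain H' where H': "subgroup H' Q" "card H' = card (carrier G) div card N"
          using less.hyps[of Q "f ` N"] E.fin_group_codom E.normal_image[OF less.prems(2)] by auto
        define J where "J = E.pre H'"
        have J: "subgroup J G" "A \<subseteq> J" "card J = card H' * card A"
          using E.subgroup_pre[OF H'(1)] E.ker_subset_pre[OF H'(1)] E.card_pre[OF H'(1)] ker by (auto simp: J_def)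
        interpret J: fin_group "G\<lparr>carrier := J\<rparr>" by (rule fin_group_subgroup[OF J(1)])
        have An: "A \<lhd> G\<lparr>carrier := J\<rparr>" using normal_in_subgroup[OF A(1) J(1,2)] .
        have iJ: "card J div card A = card H'" using J(3) cA by simp
        have "card A < card N" using A(3) finite_subgroup[OF N] psubset_card_mono by blast
        then have "card J < card (carrier G)"
          using J(3) H' card_index[OF N subgroup_self Nc] card_carrier_pos
          by (metis mult.commute mult_less_cancel2 nat_0_less_mult_iff)
        moreover have "coprime (card A) (card J div card A)"
          using less.prems(3) iJ H'(2) cN by (metis coprime_mult_left_iff)
        ultimately obtain H where "subgroup H (G\<lparr>carrier := J\<rparr>)" "card H = card J div card A"
          using less.hyps[of "G\<lparr>carrier := J\<rparr>" A] J.fin_group_axioms An by auto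
        then show ?thesis using incl_subgroup[OF J(1)] iJ H' by auto
      qed
      show ?thesis
      proof (cases "?D = {\<one>\<^bsub>G\<^esub>}")
        case False then show ?thesis using red[OF Dn] DP P(2) by auto
      next
        case D1: True
        show ?thesis
        proof (cases "P = N")
          case False then show ?thesis using red[OF Pn P1] P(2) by auto
        next
          case True
          interpret abelian_normal G N
            by (rule abelian_normalI[OF less.prems(2)], rule commute_if_derived_trivial[OF Nc]) (use D1 True in auto)
          show ?thesis using abelian_complement_exists[OF less.prems(3)] .
        qed
      qed
    qed
  qed
qed

text \<open>Solvability in a form that passes to subgroups without effort.\<close>

definition solvable_in :: "('a, 'b) monoid_scheme \<Rightarrow> 'a set \<Rightarrow> bool" where
  "solvable_in G N \<longleftrightarrow> (\<forall>A. subgroup A G \<and> A \<subseteq> N \<and> A \<noteq> {\<one>\<^bsub>G\<^esub>} \<longrightarrow> derived G A \<noteq> A)"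

text \<open>Solvability makes N' a proper subgroup of N. Modulo N' the abelian case makes the
  complements conjugate; afterwards both complement N' in the preimage of their common image, which
  is smaller than G.\<close>

theorem schur_zassenhaus_conj:
  assumes "fin_group G" "N \<lhd> G" "coprime (card N) (card (carrier G) div card N)" "solvable_in G N"
    and "subgroup K G" "card K = card (carrier G) div card N"
    and "subgroup L G" "card L = card (carrier G) div card N"
  shows "\<exists>g\<in>carrier G. fin_group.conjs G g K = L"
  using assms
proof (induction "card (carrier G)" arbitrary: G N K L rule: less_induct)
  case less
  interpret fin_group G by fact
  have N: "subgroup N G" using less.prems normal_imp_subgroup by blast
  have Nc: "N \<subseteq> carrier G" using N subgroup.subset by blast
  note K = less.prems(5,6) and L = less.prems(7,8)
  have Kc: "K \<subseteq> carrier G" using K subgroup.subset by blast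
  have Lc: "L \<subseteq> carrier G" using L subgroup.subset by blast
  let ?D = "derived G N"
  show ?case
  proof (cases "N = {\<one>\<^bsub>G\<^esub>}")
    case True
    then have "card K = card (carrier G)" "card L = card (carrier G)" using K L by auto
    then have "K = carrier G" "L = carrier G" using K L fin Kc Lc by (simp_all add: card_subset_eq)
    then show ?thesis using conjs_one by auto
  next
    case False
    have Dn: "?D \<lhd> G" using derived_is_normal[OF less.prems(2)] .
    have Ds: "subgroup ?D G" using Dn normal_imp_subgroup by blast
    have DN: "?D \<subset> N" using derived_incl[OF subset_refl N] less.prems(4) N False by (auto simp: solvable_in_def)
    obtain Q f where "fin_epi G (Q :: ('a, 'b) monoid_scheme) f" and ker: "kernel G Q f = ?D"
      using ex_quotient[OF Dn] by blast
    then interpret E: fin_epi G Q f by simp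
    have cD: "card ?D > 0" using card_subgroup_pos[OF Ds] .
    have cG: "card (carrier G) = card (carrier Q) * card ?D" using E.card_carrier ker by simp
    have cN: "card N = card (f ` N) * card ?D" using E.card_image_ker'[OF N] ker DN by auto
    have i: "card (carrier Q) div card (f ` N) = card (carrier G) div card N"
      using cG cN cD by simp
    have cop: "coprime (card (f ` N)) (card (carrier Q) div card (f ` N))"
      "coprime (card ?D) (card (carrier G) div card N)"
      using less.prems(3) i cN by (metis coprime_mult_left_iff)+
    \<comment> \<open>A complement of N meets N' trivially by coprimality, so it keeps its order in
      the quotient.\<close>
    have im: "card (f ` C) = card C" if C: "subgroup C G" "card C = card (carrier G) div card N" for C
    proof -
      have CD: "subgroup (C \<inter> ?D) G" using subgroups_Inter_pair[OF C(1) Ds] .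
      have "card (C \<inter> ?D) dvd card ?D" "card (C \<inter> ?D) dvd card C"
        using card_subgroup_dvd_subgroup[OF CD] Ds C(1) by auto
      then have "card (C \<inter> ?D) = 1" using cop(2) C(2) by (metis coprime_common_divisor_nat)
      then show ?thesis using E.card_image_ker[OF C(1)] ker by simp
    qed
    have "derived Q (f ` N) = {\<one>\<^bsub>Q\<^esub>}"
    proof -
      have "derived Q (f ` N) = f ` ?D" using E.derived_img[OF Nc] .
      also have "f ` ?D = (\<lambda>_. \<one>\<^bsub>Q\<^esub>) ` ?D" using ker by (intro image_cong) (auto simp: kernel_def)
      also have "\<dots> = {\<one>\<^bsub>Q\<^esub>}" by (rule image_constant[OF subgroup.one_closed[OF Ds]])
      finally show ?thesis .
    qed
    then interpret A: abelian_normal Q "f ` N"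
      using E.normal_image[OF less.prems(2)] E.H.commute_if_derived_trivial[of "f ` N"]
        subgroup.subset[OF E.subgroup_image[OF N]]
      by (intro E.H.abelian_normalI) blast+
    obtain q where q: "q \<in> f ` N" "E.H.conjs q (f ` K) = f ` L"
      using A.abelian_complements_conj[OF cop(1), of "f ` L" "f ` K"] im[OF K] im[OF L] i K L
        E.subgroup_image by metis
    then obtain g where g: "g \<in> N" "q = f g" by auto
    have gc: "g \<in> carrier G" using g Nc by auto
    have gKc: "conjs g K \<subseteq> carrier G" using conjs_subset[OF gc Kc] .
    have fg: "f ` conjs g K = f ` L"
    proof -
      have "f ` conjs g K = E.H.conjs q (f ` K)"
        unfolding conjs_def E.H.conjs_def image_image
        by (rule image_cong) (use gc Kc g in auto)
      then show ?thesis using q by simp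
    qed
    define J where "J = E.pre (f ` L)"
    have fL: "subgroup (f ` L) Q" using E.subgroup_image L by blast
    have J: "subgroup J G" "?D \<subseteq> J" "card J = card L * card ?D"
      using E.subgroup_pre[OF fL] E.ker_subset_pre[OF fL] E.card_pre[OF fL] ker im[OF L] by (auto simp: J_def)
    interpret J: fin_group "G\<lparr>carrier := J\<rparr>" by (rule fin_group_subgroup[OF J(1)])
    have sub: "L \<subseteq> J" "conjs g K \<subseteq> J" using fg Lc gKc unfolding J_def E.pre_def by auto
    have gKs: "subgroup (conjs g K) G" "card (conjs g K) = card K" using conjs_subgroup[OF gc K(1)] conjs_card[OF gc Kc] by auto
    have iJ: "card J div card ?D = card L" using J(3) cD by simp
    have "card ?D < card N" using DN finite_subgroup[OF N] psubset_card_mono by blast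
    then have "card J < card (carrier G)"
      using J(3) L(2) card_index[OF N subgroup_self Nc] card_carrier_pos
      by (metis mult.commute mult_less_cancel2 nat_0_less_mult_iff)
    moreover have "?D \<lhd> G\<lparr>carrier := J\<rparr>" using normal_in_subgroup[OF Dn J(1,2)] .
    moreover have "solvable_in (G\<lparr>carrier := J\<rparr>) ?D" unfolding solvable_in_def
    proof (intro allI impI; elim conjE)
      fix A assume A: "subgroup A (G\<lparr>carrier := J\<rparr>)" "A \<subseteq> ?D" "A \<noteq> {\<one>\<^bsub>G\<lparr>carrier := J\<rparr>\<^esub>}"
      then have "derived G A \<noteq> A" using less.prems(4) DN incl_subgroup[OF J(1) A(1)] by (auto simp: solvable_in_def)
      then show "derived (G\<lparr>carrier := J\<rparr>) A \<noteq> A" using derived_consistent[OF _ J(1)] A J(2) by auto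
    qed
    moreover have "subgroup (conjs g K) (G\<lparr>carrier := J\<rparr>)" "subgroup L (G\<lparr>carrier := J\<rparr>)"
      using subgroup_incl gKs L J(1) sub by auto
    ultimately have "\<exists>j\<in>carrier (G\<lparr>carrier := J\<rparr>). J.conjs j (conjs g K) = L"
      using less.hyps[of "G\<lparr>carrier := J\<rparr>" ?D "conjs g K" L] J.fin_group_axioms cop(2) iJ K(2) L(2) gKs(2) by simp
    then obtain j where j: "j \<in> J" "J.conjs j (conjs g K) = L" by auto
    have jc: "j \<in> carrier G" using j J(1) subgroup.mem_carrier by metis
    have "conjs (j \<otimes>\<^bsub>G\<^esub> g) K = L" using j conjs_sub[OF J(1) j(1)] conjs_mult[OF jc gc Kc] by simp
    then show ?thesis using jc gc by blast
  qed
qed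

lemma (in fin_group) solvable_in_subgroup:
  assumes "solvable_in G N" "subgroup J G" "A \<subseteq> N" "A \<subseteq> J"
  shows "solvable_in (G\<lparr>carrier := J\<rparr>) A"
  unfolding solvable_in_def
proof (intro allI impI; elim conjE)
  fix B assume B: "subgroup B (G\<lparr>carrier := J\<rparr>)" "B \<subseteq> A" "B \<noteq> {\<one>\<^bsub>G\<lparr>carrier := J\<rparr>\<^esub>}"
  then have "derived G B \<noteq> B" using assms incl_subgroup[OF assms(2) B(1)] by (auto simp: solvable_in_def)
  then show "derived (G\<lparr>carrier := J\<rparr>) B \<noteq> B" using derived_consistent[OF _ assms(2), of B] B assms by auto
qed

lemma (in fin_group) p_group_solvable_in:
  assumes "subgroup N G" "Factorial_Ring.prime p" "card N = p ^ k"
  shows "solvable_in G N"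
  unfolding solvable_in_def
proof (intro allI impI; elim conjE)
  fix B assume B: "subgroup B G" "B \<subseteq> N" "B \<noteq> {\<one>}"
  interpret B: fin_group "G\<lparr>carrier := B\<rparr>" by (rule fin_group_subgroup[OF B(1)])
  have "card B dvd p ^ k" using card_subgroup_dvd_subgroup[OF B(1) assms(1) B(2)] assms(3) by simp
  then obtain j where "card B = p ^ j" using divides_primepow_nat[OF assms(2)] by blast
  then show "derived G B \<noteq> B"
    using B.p_group_derived_neq[OF assms(2), of j] B(3) derived_consistent[OF subset_refl B(1)] by simp
qed

section \<open>Transfer into a Sylow subgroup of prime order\<close>

lemma (in fin_group) prime_order_subgroup:
  assumes "subgroup P G" "Factorial_Ring.prime (card P)" "subgroup H G" "H \<subseteq> P"
  shows "H = {\<one>} \<or> H = P"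
proof -
  have "card H dvd card P" using card_subgroup_dvd_subgroup assms by blast
  then have "card H = 1 \<or> card H = card P" using assms(2) by (metis prime_nat_iff)
  then show ?thesis using card_eq_1_iff[OF assms(3)] card_eq_imp_eq[OF assms(3,1,4)] by auto
qed

text \<open>The orbit of \<open>x\<close> under the normalizer has fewer than \<open>p\<close> elements, and its length divides
  the group order.\<close>

lemma (in fin_group) normalizer_centralizes_smallest_prime:
  assumes P: "subgroup P G" "card P = p"
    and p: "Factorial_Ring.prime p"
    and min: "\<And>q. Factorial_Ring.prime q \<Longrightarrow> q dvd card (carrier G) \<Longrightarrow> p \<le> q"
    and g: "g \<in> norm_of P" and x: "x \<in> P"
  shows "g \<otimes> x \<otimes> inv g = x"
proof (cases "x = \<one>")
  case True
  then show ?thesis using subsetD[OF norm_of_subset g] by simp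
next
  case False
  have Pc: "y \<in> carrier G" if "y \<in> P" for y using that P subgroup.mem_carrier by metis
  have M: "subgroup (norm_of P) G" using norm_of_subgroup P subgroup.subset by metis
  have Mc: "y \<in> carrier G" if "y \<in> norm_of P" for y using that norm_of_subset by blast
  interpret M: fin_group "G\<lparr>carrier := norm_of P\<rparr>" by (rule fin_group_subgroup[OF M])
  let ?a = "\<lambda>g x. g \<otimes> x \<otimes> inv g"
  interpret A: group_action "G\<lparr>carrier := norm_of P\<rparr>" P "\<lambda>g. restrict (?a g) P"
  proof (rule group_actionI[OF M.is_group])
    fix g x assume "g \<in> carrier (G\<lparr>carrier := norm_of P\<rparr>)" "x \<in> P"
    then show "?a g x \<in> P" by (auto simp: norm_of_def conjs_def)
  next
    fix x assume "x \<in> P" then show "?a \<one>\<^bsub>G\<lparr>carrier := norm_of P\<rparr>\<^esub> x = x" using Pc by simp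
  next
    fix g h x assume "g \<in> carrier (G\<lparr>carrier := norm_of P\<rparr>)" "h \<in> carrier (G\<lparr>carrier := norm_of P\<rparr>)" "x \<in> P"
    then show "?a (g \<otimes>\<^bsub>G\<lparr>carrier := norm_of P\<rparr>\<^esub> h) x = ?a g (?a h x)"
      using conj_conj[of g h x] Mc Pc by simp
  qed
  let ?orb = "orbit (G\<lparr>carrier := norm_of P\<rparr>) (\<lambda>g. restrict (?a g) P) x"
  have orb: "?orb = {?a g x | g. g \<in> norm_of P}" using x by (auto simp: orbit_def)
  have orbP: "?orb \<subseteq> P - {\<one>}"
  proof
    fix y assume "y \<in> ?orb"
    then obtain g where y: "g \<in> norm_of P" "y = ?a g x" using orb by auto
    then have "y \<in> P" using x by (auto simp: norm_of_def conjs_def)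
    moreover have "y \<noteq> \<one>"
    proof
      assume "y = \<one>"
      then have "?a (inv g) (?a g x) = ?a (inv g) \<one>" using y by simp
      then show False using y Mc Pc[OF x] False conj_conj[of "inv g" g x] by simp
    qed
    ultimately show "y \<in> P - {\<one>}" by simp
  qed
  have fP: "finite P" using finite_subgroup P by blast
  have "card ?orb \<le> card (P - {\<one>})" using fP by (intro card_mono[OF _ orbP]) simp
  also have "\<dots> < p" using card_Diff1_less[OF fP subgroup.one_closed[OF P(1)]] P(2) by simp
  finally have lt: "card ?orb < p" .
  have ord: "order (G\<lparr>carrier := norm_of P\<rparr>) = card (norm_of P)" by (simp add: order_def)
  have "card ?orb dvd order (G\<lparr>carrier := norm_of P\<rparr>)"
    by (rule dvdI[OF A.orbit_stabilizer_theorem[OF x, symmetric]])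
  then have "card ?orb dvd card (norm_of P)" unfolding ord .
  then have dvd: "card ?orb dvd card (carrier G)" using card_subgroup_dvd[OF M] dvd_trans by blast
  have "card ?orb = 1"
  proof (rule ccontr)
    assume "card ?orb \<noteq> 1"
    then obtain q where q: "Factorial_Ring.prime q" "q dvd card ?orb" using prime_factor_nat by blast
    have "card ?orb > 0" by (rule dvd_pos_nat[OF card_carrier_pos dvd])
    then have "q \<le> card ?orb" using q dvd_imp_le by blast
    moreover have "p \<le> q" using min[OF q(1)] q(2) dvd dvd_trans by blast
    ultimately show False using lt by simp
  qed
  then obtain z where z: "?orb = {z}" by (rule card_1_singletonE)
  have "x \<in> ?orb" using A.orbit_refl[OF x] .
  moreover have "?a g x \<in> ?orb" using orb g by auto
  ultimately show ?thesis using z by auto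
qed

text \<open>
  The transfer of \<open>x \<in> P\<close> is computed with a transversal \<open>R\<close> satisfying \<open>R(cx) = R(c)x\<close> on the
  cosets \<open>c\<close> moved by \<open>P\<close>.  Such cosets contribute \<open>1\<close>, a fixed coset contributes \<open>x\<close>, and the
  number of fixed cosets is prime to \<open>p\<close>.
\<close>

theorem (in fin_group) normal_subgroup_of_smallest_prime_index:
  assumes p: "Factorial_Ring.prime p" "p dvd card (carrier G)" "\<not> p\<^sup>2 dvd card (carrier G)"
    and min: "\<And>q. Factorial_Ring.prime q \<Longrightarrow> q dvd card (carrier G) \<Longrightarrow> p \<le> q"
  shows "\<exists>N. N \<lhd> G \<and> card (carrier G) div card N = p"
proof -
  obtain P where P: "subgroup P G" "card P = p" using cauchy[OF p(1,2)] by blast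
  have Pc: "y \<in> carrier G" if "y \<in> P" for y using that P subgroup.mem_carrier by metis
  have Ps: "P \<subseteq> carrier G" using Pc by blast
  interpret P: fin_group "G\<lparr>carrier := P\<rparr>" by (rule fin_group_subgroup[OF P(1)])
  interpret CP: comm_group "G\<lparr>carrier := P\<rparr>"
    rewrites "carrier (G\<lparr>carrier := P\<rparr>) = P" and "monoid.mult (G\<lparr>carrier := P\<rparr>) = monoid.mult G"
    and "one (G\<lparr>carrier := P\<rparr>) = one G"
  proof -
    show "comm_group (G\<lparr>carrier := P\<rparr>)"
    proof (rule P.no_proper_subgroup_comm)
      fix H assume H: "subgroup H (G\<lparr>carrier := P\<rparr>)"
      have "H \<subseteq> P" using subgroup.subset[OF H] by simp
      then show "H = {\<one>\<^bsub>G\<lparr>carrier := P\<rparr>\<^esub>} \<or> H = carrier (G\<lparr>carrier := P\<rparr>)"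
        using prime_order_subgroup[OF P(1) _ incl_subgroup[OF P(1) H]] P p(1) by simp
    qed
  qed auto
  let ?C = "rcosets P"
  have finC: "finite ?C" using finite_subset[OF rcosets_subset_PowG[OF P(1)]] fin by simp
  have Cc: "c \<subseteq> carrier G" if "c \<in> ?C" for c using rcosets_subset_PowG[OF P(1)] that by auto
  have sh: "c #> g \<in> ?C" if "c \<in> ?C" "g \<in> carrier G" for c g
    using that Ps by (auto simp: RCOSETS_def coset_mult_assoc)
  have shsh: "c #> g #> h = c #> (g \<otimes> h)" if "c \<in> ?C" "g \<in> carrier G" "h \<in> carrier G" for c g h
    using that Cc by (simp add: coset_mult_assoc)
  have shbij: "bij_betw (\<lambda>c. c #> g) ?C ?C" if "g \<in> carrier G" for g
    by (rule bij_betw_byWitness[where f' = "\<lambda>c. c #> inv g"]) (use that sh shsh Cc in auto)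
  have diff: "a \<otimes> inv b \<in> P" "a \<in> carrier G" if "c \<in> ?C" "a \<in> c" "b \<in> c" for a b c
  proof -
    from that obtain r s t where "r \<in> carrier G" "s \<in> P" "t \<in> P" "a = s \<otimes> r" "b = t \<otimes> r"
      by (auto simp: RCOSETS_def r_coset_def)
    moreover from this have "a \<otimes> inv b = s \<otimes> inv t"
      using Pc by (simp add: inv_mult_group m_assoc mult_inv_cancel)
    ultimately show "a \<otimes> inv b \<in> P" "a \<in> carrier G" using P(1) Pc 
      by (auto simp: subgroup.m_closed subgroup.m_inv_closed)
  qed
  let ?Fix = "{c \<in> ?C. \<forall>q\<in>P. c #> q = c}"
  let ?U = "?C - ?Fix"
  \<comment> \<open>A moved coset has a proper stabilizer in P, which is trivial because |P| is
    prime.\<close>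
  have stab: "q = \<one>" if c: "c \<in> ?U" and q: "q \<in> P" "c #> q = c" for c q
  proof -
    let ?S = "{q \<in> P. c #> q = c}"
    have cC: "c \<in> ?C" using c by blast
    have "subgroup ?S G"
    proof (rule subgroupI)
      show "?S \<noteq> {}" using subgroup.one_closed[OF P(1)] Cc[OF cC] by auto
      fix a assume a: "a \<in> ?S"
      then have "c #> inv a = c #> a #> inv a" by simp
      also have "\<dots> = c" using shsh[OF cC, of a "inv a"] a Pc Cc[OF cC] by simp
      finally show "inv a \<in> ?S" using a P(1) by (simp add: subgroup.m_inv_closed)
      fix b assume "b \<in> ?S"
      then show "a \<otimes> b \<in> ?S" using a P(1) shsh[OF cC, of a b] Pc by (simp add: subgroup.m_closed)
    qed (use Pc in auto)
    moreover have "?S \<noteq> P" using c by auto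
    ultimately have "?S = {\<one>}" using prime_order_subgroup[OF P(1), of ?S] P p(1) by auto
    then show ?thesis using q by blast
  qed
  define orb where "orb c = {c #> q | q. q \<in> P}" for c
  have orb_shift: "orb (c #> q) = orb c" if c: "c \<in> ?C" and q: "q \<in> P" for c q
  proof -
    have "orb (c #> q) \<subseteq> orb c" if "c \<in> ?C" "q \<in> P" for c q
      using that shsh Pc P(1) by (auto simp: orb_def) (metis subgroup.m_closed)
    from this[OF c q] this[of "c #> q" "inv q"] show ?thesis
      using sh[OF c Pc[OF q]] shsh[OF c Pc[OF q], of "inv q"] Pc[OF q] Cc[OF c] subgroup.m_inv_closed[OF P(1) q] by auto
  qed
  define rep where "rep c = (SOME e. e \<in> orb c)" for c
  have rep: "rep c \<in> orb c" if "c \<in> ?C" for c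
  proof -
    have "c \<in> orb c" using subgroup.one_closed[OF P(1)] Cc[OF that] by (auto simp: orb_def intro!: exI[of _ \<one>])
    then show ?thesis unfolding rep_def by (rule someI)
  qed
  have rep_shift: "rep (c #> q) = rep c" if "c \<in> ?C" "q \<in> P" for c q
    using orb_shift[OF that] by (simp add: rep_def)
  \<comment> \<open>The element of P leading from the base coset \<open>rep c\<close> of the P-orbit
    to c. On moved cosets it is unique by \<open>stab\<close>, which yields
    \<open>y_shift\<close>.\<close>
  define y where "y c = (SOME q. q \<in> P \<and> rep c #> q = c)" for c
  have repC: "rep c \<in> ?C" and y: "y c \<in> P" "rep c #> y c = c" if c: "c \<in> ?C" for c
  proof -
    obtain q where q: "q \<in> P" "rep c = c #> q" using rep[OF c] by (auto simp: orb_def)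
    then show "rep c \<in> ?C" using sh[OF c] Pc by simp
    have "inv q \<in> P \<and> rep c #> inv q = c" 
      using q shsh[OF c, of q "inv q"] Pc Cc[OF c] subgroup.m_inv_closed[OF P(1)] by simp
    then have "y c \<in> P \<and> rep c #> y c = c" unfolding y_def by (rule someI)
    then show "y c \<in> P" "rep c #> y c = c" by auto
  qed
  have U_shift: "c #> q \<in> ?U" if c: "c \<in> ?U" and q: "q \<in> P" for c q
  proof (rule ccontr)
    assume "c #> q \<notin> ?U"
    then have "c #> q #> inv q = c #> q" using sh[of c q] c q Pc subgroup.m_inv_closed[OF P(1) q] by auto
    moreover have "c #> q #> inv q = c" using shsh[of c q "inv q"] c q Pc Cc by auto
    ultimately have cq: "c #> q = c" by simp
    then have "c \<notin> ?U" using \<open>c #> q \<notin> ?U\<close> by simp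
    then show False using c by simp
  qed
  have y_shift: "y (c #> x) = y c \<otimes> x" if c: "c \<in> ?U" and x: "x \<in> P" for c x
  proof -
    have cC: "c \<in> ?C" using c by blast
    have cxC: "c #> x \<in> ?C" using sh[OF cC Pc[OF x]] .
    let ?d = "c #> x"
    have 1: "rep c #> y ?d = ?d" using y(2)[OF cxC] rep_shift[OF cC x] by simp
    have 2: "rep c #> (y c \<otimes> x) = ?d" using shsh[OF repC[OF cC], of "y c" x] y[OF cC] Pc x by simp
    have "?d #> (inv (y c \<otimes> x) \<otimes> y ?d) = rep c #> (y c \<otimes> x) #> (inv (y c \<otimes> x) \<otimes> y ?d)" using 2 by simp
    also have "\<dots> = rep c #> y ?d"
      using shsh[OF repC[OF cC]] y[OF cC] y[OF cxC] Pc x by (simp add: mult_inv_cancel)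
    finally have "?d #> (inv (y c \<otimes> x) \<otimes> y ?d) = ?d" using 1 by simp
    moreover have "inv (y c \<otimes> x) \<otimes> y ?d \<in> P" using y[OF cC] y[OF cxC] x P(1) 
      by (simp add: subgroup.m_closed subgroup.m_inv_closed)
    ultimately have "inv (y c \<otimes> x) \<otimes> y ?d = \<one>" using stab[OF U_shift[OF c x]] by blast
    then show ?thesis using y(1)[OF cC] y(1)[OF cxC] Pc x 
      by (metis inv_closed inv_equality inv_inv m_closed)
  qed
  define R0 where "R0 c = (SOME r. r \<in> c)" for c :: "'a set"
  have R0: "R0 c \<in> c" if "c \<in> ?C" for c
    unfolding R0_def using subgroup.rcosets_non_empty[OF P(1) that] by (simp add: some_in_eq)
  \<comment> \<open>By \<open>y_shift\<close> this choice is equivariant on moved cosets; on fixed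
    cosets any representative will do.\<close>
  define R where "R c = (if c \<in> ?U then R0 (rep c) \<otimes> y c else R0 c)" for c
  have R: "R c \<in> c" if c: "c \<in> ?C" for c
  proof (cases "c \<in> ?U")
    case True
    have "R0 (rep c) \<otimes> y c \<in> rep c #> y c" using R0[OF repC[OF c]] by (auto simp: r_coset_def)
    then show ?thesis using y(2)[OF c] True by (simp add: R_def)
  qed (use R0 c in \<open>simp add: R_def\<close>)
  have Rc: "R c \<in> carrier G" if "c \<in> ?C" for c using R that Cc by blast
  have fac: "R c \<otimes> g \<otimes> inv (R (c #> g)) \<in> P" if "c \<in> ?C" "g \<in> carrier G" for c g
  proof (rule diff(1)[OF sh[OF that]])
    show "R c \<otimes> g \<in> c #> g" using R[OF that(1)] by (auto simp: r_coset_def)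
    show "R (c #> g) \<in> c #> g" by (rule R[OF sh[OF that]])
  qed
  \<comment> \<open>The transfer into P. The factor of g h at c is the factor of g at c times that
    of h at c g, so after reindexing V is a homomorphism.\<close>
  define V where "V g = finprod (G\<lparr>carrier := P\<rparr>) (\<lambda>c. R c \<otimes> g \<otimes> inv (R (c #> g))) ?C" for g
  have VP: "V g \<in> P" if "g \<in> carrier G" for g
    unfolding V_def by (rule CP.finprod_closed) (use fac that in auto)
  have Vm: "V (g \<otimes> h) = V g \<otimes> V h" if g: "g \<in> carrier G" and h: "h \<in> carrier G" for g h
  proof -
    have "V (g \<otimes> h) = finprod (G\<lparr>carrier := P\<rparr>)
        (\<lambda>c. (R c \<otimes> g \<otimes> inv (R (c #> g))) \<otimes> (R (c #> g) \<otimes> h \<otimes> inv (R (c #> g #> h)))) ?C"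
      unfolding V_def
    proof (rule CP.finprod_cong'[OF refl])
      show "(\<lambda>c. (R c \<otimes> g \<otimes> inv (R (c #> g))) \<otimes> (R (c #> g) \<otimes> h \<otimes> inv (R (c #> g #> h)))) \<in> ?C \<rightarrow> P"
        using fac g h sh P(1) by (auto simp: subgroup.m_closed)
      fix c assume c: "c \<in> ?C"
      have [simp]: "R c \<in> carrier G" "R (c #> g) \<in> carrier G" "R (c #> (g \<otimes> h)) \<in> carrier G"
        using Rc c sh g h by auto
      show "R c \<otimes> (g \<otimes> h) \<otimes> inv (R (c #> (g \<otimes> h))) =
        (R c \<otimes> g \<otimes> inv (R (c #> g))) \<otimes> (R (c #> g) \<otimes> h \<otimes> inv (R (c #> g #> h)))"
        unfolding shsh[OF c g h] using g h by (simp add: m_assoc mult_inv_cancel)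
    qed
    also have "\<dots> = V g \<otimes> finprod (G\<lparr>carrier := P\<rparr>) (\<lambda>c. R (c #> g) \<otimes> h \<otimes> inv (R (c #> g #> h))) ?C"
      unfolding V_def by (rule CP.finprod_multf) (use fac g h sh in auto)
    also have "finprod (G\<lparr>carrier := P\<rparr>) (\<lambda>c. R (c #> g) \<otimes> h \<otimes> inv (R (c #> g #> h))) ?C = V h"
      unfolding V_def
      using CP.finprod_reindex[of "\<lambda>c. R c \<otimes> h \<otimes> inv (R (c #> h))" "\<lambda>c. c #> g" ?C] shbij[OF g] fac h
      by (auto simp: bij_betw_def)
    finally show ?thesis .
  qed
  have "group_hom G (G\<lparr>carrier := P\<rparr>) V"
    by (simp add: group_hom_def group_hom_axioms_def P.is_group hom_def VP Vm)
  then interpret V: group_hom G "G\<lparr>carrier := P\<rparr>" V .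
  have P1: "P \<noteq> {\<one>}" using P p(1) by auto
  then obtain x where x: "x \<in> P" "x \<noteq> \<one>" using subgroup.one_closed[OF P(1)] by blast
  have Vx: "V x = x [^] card ?Fix"
  proof -
    \<comment> \<open>A representative of a coset fixed by all of P normalizes P, and the normalizer
      centralizes P because p is the smallest prime divisor.\<close>
    have fixed: "R c \<otimes> x \<otimes> inv (R (c #> x)) = x" if c: "c \<in> ?Fix" for c
    proof -
      have cC: "c \<in> ?C" and cq: "\<And>q. q \<in> P \<Longrightarrow> c #> q = c" using c by auto
      have "R c \<otimes> q \<otimes> inv (R c) \<in> P" if "q \<in> P" for q using fac[OF cC, of q] that Pc cq by simp
      then have "R c \<in> norm_of P" using Rc[OF cC] P(1) by (intro norm_ofI) auto
      then show ?thesis 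
        using normalizer_centralizes_smallest_prime[OF P p(1) min _ x(1)] cq[OF x(1)] by simp
    qed
    have moved: "R c \<otimes> x \<otimes> inv (R (c #> x)) = \<one>" if c: "c \<in> ?U" for c
    proof -
      have cC: "c \<in> ?C" using c by blast
      have "R (c #> x) = R c \<otimes> x"
        using c U_shift[OF c x(1)] rep_shift[OF cC x(1)] y_shift[OF c x(1)] y(1)[OF cC] R0[OF repC[OF cC]]
          Cc[OF repC[OF cC]] Pc x(1) by (auto simp: R_def m_assoc)
      then show ?thesis using Rc[OF cC] Pc[OF x(1)] by (simp add: inv_mult_group m_assoc mult_inv_cancel)
    qed
    have "V x = finprod (G\<lparr>carrier := P\<rparr>) (\<lambda>c. x) ?Fix"
      unfolding V_def
    proof (rule CP.finprod_mono_neutral_cong_left[symmetric])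
      show "(\<lambda>c. R c \<otimes> x \<otimes> inv (R (c #> x))) \<in> ?C \<rightarrow> P" using fac Pc x by auto
    qed (use finC moved fixed in auto)
    also have "\<dots> = x [^] card ?Fix" using x by (simp add: CP.finprod_const nat_pow_consistent[symmetric])
    finally show ?thesis .
  qed
  have "\<not> p dvd card (carrier G) div card P"
  proof
    assume "p dvd card (carrier G) div card P"
    then have "p * card P dvd (card (carrier G) div card P) * card P" by (simp add: mult_dvd_mono)
    then have "p * p dvd card (carrier G)" using P card_subgroup_dvd[OF P(1)] by (metis dvd_div_mult_self)
    then show False using p(3) by (simp add: power2_eq_square)
  qed
  moreover have "[card ?Fix = card (carrier G) div card P] (mod p)"
    by (rule card_fixed_rcosets_cong[OF P(1) p(1) _ P(1), of 1]) (simp add: P(2))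
  ultimately have nF: "\<not> p dvd card ?Fix" using cong_dvd_iff by blast
  \<comment> \<open>x has order p, while the number of fixed cosets is congruent modulo p to |G :
    P|, hence prime to p.\<close>
  have "V x \<noteq> \<one>"
  proof
    assume "V x = \<one>"
    then have "x [^] card ?Fix = \<one>" using Vx by simp
    then have "ord x dvd card ?Fix" using pow_eq_id[of x] Pc x by simp
    moreover have "x [^] p = \<one>"
      using P.pow_order_eq_1[of x] x P(2) by (simp add: order_def nat_pow_consistent[symmetric])
    then have "ord x dvd p" using pow_eq_id[of x] Pc x by simp
    then have "ord x = 1 \<or> ord x = p" using p(1) by (metis prime_nat_iff)
    moreover have "ord x \<noteq> 1" using ord_eq_1 Pc x by simp
    ultimately show False using nF by auto
  qed
  moreover have "V ` carrier G = {\<one>} \<or> V ` carrier G = P"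
    using prime_order_subgroup[OF P(1)] incl_subgroup[OF P(1) V.img_is_subgroup] VP P p(1) by auto
  \<comment> \<open>The image is a nontrivial subgroup of a group of prime order, so V is onto and
    its kernel has index p.\<close>
  ultimately have img: "V ` carrier G = P" using Pc[OF x(1)] by auto
  have "card (carrier G) = card P * card (kernel G (G\<lparr>carrier := P\<rparr>) V)"
    using V.card_image_kernel[OF fin subgroup_self] img by (auto simp: kernel_def Int_def)
  then have "card (carrier G) div card (kernel G (G\<lparr>carrier := P\<rparr>) V) = p"
    using P card_subgroup_pos[OF V.subgroup_kernel] by simp
  then show ?thesis using V.normal_kernel by blast
qed

section \<open>\<sigma>-nilpotent quotients and \<sigma>-subnormal subgroups\<close>

locale prime_partition =
  fixes \<sigma> :: "nat set set"
  assumes part: "partition_on {p. Factorial_Ring.prime p} \<sigma>"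
begin

lemma block_ex: "Factorial_Ring.prime p \<Longrightarrow> \<exists>S\<in>\<sigma>. p \<in> S"
  using part by (auto simp: partition_on_def)

lemma block_unique: "S \<in> \<sigma> \<Longrightarrow> T \<in> \<sigma> \<Longrightarrow> p \<in> S \<Longrightarrow> p \<in> T \<Longrightarrow> S = T"
  using part unfolding partition_on_def disjoint_def by blast

lemma sigma_nonempty: "\<sigma> \<noteq> {}"
  using block_ex two_is_prime_nat by blast

lemma pi_number_other: "S \<in> \<sigma> \<Longrightarrow> T \<in> \<sigma> \<Longrightarrow> S \<noteq> T \<Longrightarrow> pi_number S n \<Longrightarrow> pi_number (-T) n"
  using block_unique by (auto simp: pi_number_def)

lemma pi_number_unique: "S \<in> \<sigma> \<Longrightarrow> T \<in> \<sigma> \<Longrightarrow> pi_number S n \<Longrightarrow> \<not> pi_number (-T) n \<Longrightarrow> S = T"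
  using pi_number_other by blast

lemma all_pi_number_compl:
  assumes "\<And>S. S \<in> \<sigma> \<Longrightarrow> pi_number (-S) n"
  shows "n = 1"
proof (rule ccontr)
  assume "n \<noteq> 1"
  then obtain p where p: "Factorial_Ring.prime p" "p dvd n" using prime_factor_nat by blast
  then obtain S where "S \<in> \<sigma>" "p \<in> S" using block_ex by blast
  then show False using assms[of S] p by (auto simp: pi_number_def primes_of_def)
qed

end

lemma sigma_of_iff: "S \<in> sigma_of \<sigma> n \<longleftrightarrow> S \<in> \<sigma> \<and> \<not> pi_number (-S) n"
  by (auto simp: sigma_of_def pi_number_def)

lemma pi_number_prod: "finite A \<Longrightarrow> (\<And>i. i \<in> A \<Longrightarrow> pi_number S (f i)) \<Longrightarrow> pi_number S (\<Prod>i\<in>A. f i)"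
  by (induction A rule: finite_induct) (auto simp: pi_number_mult)

context fin_group begin

text \<open>|H : N \<inter> H| equals |N H : N|, a divisor of |G : N|.\<close>

lemma index_Int_dvd:
  assumes "N \<lhd> G" "subgroup H G"
  shows "card H div card (N \<inter> H) dvd card (carrier G) div card N"
proof -
  have N: "subgroup N G" using assms normal_imp_subgroup by blast
  note NH = card_set_mult_normal[OF assms]
  have I: "subgroup (N \<inter> H) G" using subgroups_Inter_pair[OF N assms(2)] .
  define q where "q = card H div card (N \<inter> H)"
  have 1: "card H = card (N \<inter> H) * q" unfolding q_def using card_index[OF I assms(2)] by simp
  have 2: "card (N \<inter> H) > 0" "card N > 0" using card_subgroup_pos I N by auto
  have "card (N <#> H) = card N * q" using NH(1)[unfolded 1] 2 by simp
  moreover have "card (N <#> H) dvd card (carrier G)" using card_subgroup_dvd[OF NH(2)] .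
  ultimately have "card N * q dvd card N * (card (carrier G) div card N)"
    using card_subgroup_dvd[OF N] by simp
  then show ?thesis using 2 unfolding q_def[symmetric] by simp
qed

lemma index_Int_dvd_in:
  assumes "N \<lhd> G\<lparr>carrier := B\<rparr>" "subgroup B G" "subgroup H G" "H \<subseteq> B"
  shows "card H div card (N \<inter> H) dvd card B div card N"
  using fin_group.index_Int_dvd[OF fin_group_subgroup[OF assms(2)] assms(1) subgroup_incl[OF assms(3,2,4)]] by simp

lemma index_dvd_mono:
  assumes "subgroup A G" "subgroup B G" "subgroup C G" "A \<subseteq> B" "B \<subseteq> C"
  shows "card B div card A dvd card C div card A" "card C div card B dvd card C div card A"
  using index_mult[OF assms] by simp_all

lemma normal_core_props:
  assumes "subgroup A G"
  shows "normal_core G A \<lhd> G" "normal_core G A \<subseteq> A"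
    "\<And>N. N \<lhd> G \<Longrightarrow> N \<subseteq> A \<Longrightarrow> N \<subseteq> normal_core G A"
proof -
  have Ac: "A \<subseteq> carrier G" using assms subgroup.subset by blast
  have core: "normal_core G A = (\<Inter>x\<in>carrier G. conjs x A)"
    unfolding normal_core_def using conjs_eq_coset[OF _ Ac] by simp
  show "normal_core G A \<subseteq> A" using conjs_one[OF Ac] core by auto
  show "normal_core G A \<lhd> G" unfolding normal_iff
  proof (intro conjI ballI)
    show "subgroup (normal_core G A) G" unfolding core
      by (rule subgroups_Inter) (use conjs_subgroup assms in auto)
    fix g a assume g: "g \<in> carrier G" and a: "a \<in> normal_core G A"
    show "g \<otimes> a \<otimes> inv g \<in> normal_core G A" unfolding core
    proof
      fix x assume x: "x \<in> carrier G"
      have "a \<in> conjs (inv g \<otimes> x) A" using a core g x by simp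
      then have "g \<otimes> a \<otimes> inv g \<in> conjs g (conjs (inv g \<otimes> x) A)" by (auto simp: conjs_def)
      also have "\<dots> = conjs x A" using conjs_mult[OF g _ Ac, of "inv g \<otimes> x"] g x by (simp add: mult_inv_cancel)
      finally show "g \<otimes> a \<otimes> inv g \<in> conjs x A" .
    qed
  qed
  fix N assume N: "N \<lhd> G" "N \<subseteq> A"
  show "N \<subseteq> normal_core G A" unfolding core
    using conjs_normal[OF N(1)] conjs_mono[OF N(2)] by blast
qed

lemma order_Mod: "N \<lhd> G \<Longrightarrow> order (G Mod N) = card (carrier G) div card N"
  using card_rcosets[OF normal_imp_subgroup] by (simp add: order_def FactGroup_def)

lemma ex_quotient': 
  assumes "N \<lhd> G"
  shows "\<exists>(Q :: ('a, 'b) monoid_scheme) f. fin_epi G Q f \<and> kernel G Q f = N"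
  using ex_quotient[OF assms] by metis

end

section \<open>Sigma-subnormal subgroups as chains of single steps\<close>

definition sstep :: "nat set set \<Rightarrow> ('a, 'b) monoid_scheme \<Rightarrow> 'a set \<Rightarrow> 'a set \<Rightarrow> bool" where
  "sstep \<sigma> G A B \<longleftrightarrow> subgroup A G \<and> subgroup B G \<and> A \<subseteq> B \<and>
     (\<exists>N. N \<lhd> G\<lparr>carrier := B\<rparr> \<and> N \<subseteq> A \<and> (N = A \<or> (\<exists>S\<in>\<sigma>. pi_number S (card B div card N))))"

context fin_group begin

text \<open>The witness in \<open>sstep\<close> may be any suitable normal subgroup below A. The
  core is the largest candidate, so its index divides that of every other one, and the clause
  \<open>N = A\<close> absorbs plain normality. This form passes to intersections and images, where
  cores need not correspond to cores.\<close>

lemma sstep_iff: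
  assumes "subgroup A G" "subgroup B G" "A \<subseteq> B"
  shows "sstep \<sigma> G A B \<longleftrightarrow> A \<lhd> G\<lparr>carrier := B\<rparr> \<or>
    sigma_primary \<sigma> (G\<lparr>carrier := B\<rparr> Mod normal_core (G\<lparr>carrier := B\<rparr>) A)"
proof -
  let ?B = "G\<lparr>carrier := B\<rparr>"
  interpret B: fin_group ?B by (rule fin_group_subgroup[OF assms(2)])
  have A: "subgroup A ?B" using subgroup_incl[OF assms] .
  note core = B.normal_core_props[OF A]
  have prim: "sigma_primary \<sigma> (?B Mod normal_core ?B A) \<longleftrightarrow> (\<exists>S\<in>\<sigma>. pi_number S (card B div card (normal_core ?B A)))"
    using B.order_Mod[OF core(1)] by (simp add: sigma_primary_def pi_number_def)
  show ?thesis
  proof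
    assume "sstep \<sigma> G A B"
    then obtain N where N: "N \<lhd> ?B" "N \<subseteq> A" "N = A \<or> (\<exists>S\<in>\<sigma>. pi_number S (card B div card N))"
      by (auto simp: sstep_def)
    have "card B div card (normal_core ?B A) dvd card B div card N"
      using B.index_dvd_mono(2)[OF normal_imp_subgroup[OF N(1)] normal_imp_subgroup[OF core(1)] B.subgroup_self core(3)[OF N(1,2)]]
        core(2) assms(3) by simp
    then show "A \<lhd> ?B \<or> sigma_primary \<sigma> (?B Mod normal_core ?B A)"
      using N prim pi_number_dvd by blast
  next
    assume "A \<lhd> ?B \<or> sigma_primary \<sigma> (?B Mod normal_core ?B A)"
    then show "sstep \<sigma> G A B" unfolding sstep_def prim using assms core(1,2) by blast
  qed
qed

lemma sigma_subnormal_iff: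
  "sigma_subnormal \<sigma> G A \<longleftrightarrow> subgroup A G \<and> (sstep \<sigma> G)\<^sup>*\<^sup>* A (carrier G)"
proof
  assume "sigma_subnormal \<sigma> G A"
  then obtain t C where C: "C 0 = A" "C t = carrier G" "\<And>i. i \<le> t \<Longrightarrow> subgroup (C i) G"
    "\<And>i. i < t \<Longrightarrow> C i \<subseteq> C (Suc i) \<and> (C i \<lhd> G\<lparr>carrier := C (Suc i)\<rparr> \<or>
        sigma_primary \<sigma> (G\<lparr>carrier := C (Suc i)\<rparr> Mod normal_core (G\<lparr>carrier := C (Suc i)\<rparr>) (C i)))"
    unfolding sigma_subnormal_def by metis
  have "sstep \<sigma> G (C i) (C (Suc i))" if "i < t" for i
    using sstep_iff[OF C(3)[of i] C(3)[of "Suc i"]] C(4)[OF that] that by simp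
  then have "(sstep \<sigma> G ^^ t) A (carrier G)" unfolding relpowp_fun_conv using C by blast
  then show "subgroup A G \<and> (sstep \<sigma> G)\<^sup>*\<^sup>* A (carrier G)"
    using C(1) C(3)[of 0] by (auto dest: relpowp_imp_rtranclp)
next
  assume a: "subgroup A G \<and> (sstep \<sigma> G)\<^sup>*\<^sup>* A (carrier G)"
  then obtain t where "(sstep \<sigma> G ^^ t) A (carrier G)" using rtranclp_imp_relpowp by metis
  then obtain C where C: "C 0 = A" "C t = carrier G" "\<And>i. i < t \<Longrightarrow> sstep \<sigma> G (C i) (C (Suc i))"
    unfolding relpowp_fun_conv by blast
  have sub: "subgroup (C i) G" if "i \<le> t" for i
  proof (cases "i < t")
    case True then show ?thesis using C(3)[OF True] by (simp add: sstep_def)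
  next
    case False then show ?thesis using that C(2) subgroup_self by simp
  qed
  show "sigma_subnormal \<sigma> G A"
    unfolding sigma_subnormal_def
  proof (intro exI[of _ t] exI[of _ C] conjI allI impI)
    fix i assume i: "i < t"
    show s: "C i \<subseteq> C (Suc i)" using C(3)[OF i] by (simp add: sstep_def)
    show "C i \<lhd> G\<lparr>carrier := C (Suc i)\<rparr> \<or>
        sigma_primary \<sigma> (G\<lparr>carrier := C (Suc i)\<rparr> Mod normal_core (G\<lparr>carrier := C (Suc i)\<rparr>) (C i))"
      using sstep_iff[OF sub sub s] i C(3)[OF i] by auto
  qed (use C sub in auto)
qed

lemma sigma_subnormal_self: "sigma_subnormal \<sigma> G (carrier G)"
  by (simp add: sigma_subnormal_iff subgroup_self)

lemma sstep_of_subgroup: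
  assumes "subgroup H G" "sstep \<sigma> (G\<lparr>carrier := H\<rparr>) A B"
  shows "sstep \<sigma> G A B"
  using assms(2) incl_subgroup[OF assms(1)] by (auto simp: sstep_def)

lemma sigma_subnormal_trans:
  assumes "sigma_subnormal \<sigma> G H" "sigma_subnormal \<sigma> (G\<lparr>carrier := H\<rparr>) A"
  shows "sigma_subnormal \<sigma> G A"
proof -
  have H: "subgroup H G" "(sstep \<sigma> G)\<^sup>*\<^sup>* H (carrier G)" using assms(1) by (auto simp: sigma_subnormal_iff)
  interpret H: fin_group "G\<lparr>carrier := H\<rparr>" by (rule fin_group_subgroup[OF H(1)])
  have A: "subgroup A (G\<lparr>carrier := H\<rparr>)" "(sstep \<sigma> (G\<lparr>carrier := H\<rparr>))\<^sup>*\<^sup>* A H"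
    using assms(2) by (auto simp: H.sigma_subnormal_iff)
  have "(sstep \<sigma> G)\<^sup>*\<^sup>* A H" using A(2) sstep_of_subgroup[OF H(1)] by (metis mono_rtranclp)
  then show ?thesis using H incl_subgroup[OF H(1) A(1)] by (auto simp: sigma_subnormal_iff)
qed

lemma sigma_subnormal_step:
  assumes "sstep \<sigma> G E (carrier G)"
  shows "sigma_subnormal \<sigma> G E"
proof -
  have "subgroup E G" using assms by (simp add: sstep_def)
  then show ?thesis using assms by (simp add: sigma_subnormal_iff r_into_rtranclp)
qed

text \<open>Every term of the chain, and every witness, is intersected with H; |C \<inter> H : N
  \<inter> H| divides |C : N|.\<close>

lemma sigma_subnormal_Int:
  assumes "sigma_subnormal \<sigma> G B" "subgroup H G"
  shows "sigma_subnormal \<sigma> (G\<lparr>carrier := H\<rparr>) (B \<inter> H)"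
proof -
  interpret H: fin_group "G\<lparr>carrier := H\<rparr>" by (rule fin_group_subgroup[OF assms(2)])
  have B: "subgroup B G" "(sstep \<sigma> G)\<^sup>*\<^sup>* B (carrier G)" using assms(1) by (auto simp: sigma_subnormal_iff)
  have step: "sstep \<sigma> (G\<lparr>carrier := H\<rparr>) (A \<inter> H) (C \<inter> H)" if AC: "sstep \<sigma> G A C" for A C
  proof -
    from AC obtain N where A: "subgroup A G" and C: "subgroup C G" and AC': "A \<subseteq> C" 
      and N: "N \<lhd> G\<lparr>carrier := C\<rparr>" "N \<subseteq> A" 
       and e: "N = A \<or> (\<exists>S\<in>\<sigma>. pi_number S (card C div card N))"
      by (auto simp: sstep_def)
    have CH: "subgroup (C \<inter> H) G" "subgroup (A \<inter> H) G" using subgroups_Inter_pair A C assms(2) by auto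
    have N': "N \<inter> H \<lhd> G\<lparr>carrier := C \<inter> H\<rparr>" using normal_in_Int[OF N(1) C assms(2)] .
    have "N \<inter> (C \<inter> H) = N \<inter> H" using N AC' by blast
    then have "card (C \<inter> H) div card (N \<inter> H) dvd card C div card N"
      using index_Int_dvd_in[OF N(1) C CH(1)] by simp
    then have "N \<inter> H = A \<inter> H \<or> (\<exists>S\<in>\<sigma>. pi_number S (card (C \<inter> H) div card (N \<inter> H)))"
      using e pi_number_dvd by blast
    moreover have "subgroup (C \<inter> H) (G\<lparr>carrier := H\<rparr>)" "subgroup (A \<inter> H) (G\<lparr>carrier := H\<rparr>)"
      using subgroup_incl CH assms(2) by auto
    moreover have "(G\<lparr>carrier := H\<rparr>)\<lparr>carrier := C \<inter> H\<rparr> = G\<lparr>carrier := C \<inter> H\<rparr>" by simp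
    moreover have "A \<inter> H \<subseteq> C \<inter> H" "N \<inter> H \<subseteq> A \<inter> H" using AC' N by auto
    ultimately show ?thesis using N' unfolding sstep_def by metis
  qed
  have "(sstep \<sigma> (G\<lparr>carrier := H\<rparr>))\<^sup>*\<^sup>* (B \<inter> H) (C \<inter> H)" if "(sstep \<sigma> G)\<^sup>*\<^sup>* B C" for C
    using that by induction (auto intro: rtranclp.rtrancl_into_rtrancl step)
  from this[OF B(2)] have "(sstep \<sigma> (G\<lparr>carrier := H\<rparr>))\<^sup>*\<^sup>* (B \<inter> H) H"
    using subgroup.subset[OF assms(2)] by (simp add: Int_absorb1)
  moreover have "subgroup (B \<inter> H) (G\<lparr>carrier := H\<rparr>)"
    using subgroup_incl[OF subgroups_Inter_pair[OF B(1) assms(2)] assms(2)] by simp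
  ultimately show ?thesis unfolding H.sigma_subnormal_iff by simp
qed

text \<open>Chains may repeat terms; this extracts the last step that is proper.\<close>

lemma sigma_subnormal_last_step:
  assumes "sigma_subnormal \<sigma> G A" "A \<noteq> carrier G"
  obtains E where "subgroup E G" "A \<subseteq> E" "E \<noteq> carrier G" "sstep \<sigma> G E (carrier G)"
proof -
  have "(sstep \<sigma> G)\<^sup>*\<^sup>* A (carrier G)" using assms by (simp add: sigma_subnormal_iff)
  moreover have "(A \<subseteq> C) \<and> (C = A \<or> (\<exists>E. A \<subseteq> E \<and> E \<noteq> C \<and> sstep \<sigma> G E C))" if "(sstep \<sigma> G)\<^sup>*\<^sup>* A C" for C
    using that
  proof induction
    case (step C C')
    then have "A \<subseteq> C'" by (auto simp: sstep_def)
    with step show ?case by blast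
  qed simp
  ultimately show ?thesis using assms(2) that by (metis sstep_def)
qed

end

context fin_epi begin

text \<open>|B : N| is the index of the images times the index of the intersections with the
  kernel.\<close>

lemma index_image_dvd:
  assumes "subgroup N G" "subgroup B G" "N \<subseteq> B"
  shows "card (h ` B) div card (h ` N) dvd card B div card N"
proof -
  have k: "subgroup (kernel G H h) G" by (rule subgroup_kernel)
  have s: "subgroup (N \<inter> kernel G H h) G" "subgroup (B \<inter> kernel G H h) G"
    using G.subgroups_Inter_pair k assms by auto
  define a where "a = card (h ` B) div card (h ` N)"
  define b where "b = card (B \<inter> kernel G H h) div card (N \<inter> kernel G H h)"
  have "card (h ` B) = card (h ` N) * a" unfolding a_def
    using H.card_index[OF subgroup_image[OF assms(1)] subgroup_image[OF assms(2)]] assms(3) by blast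
  moreover have "card (B \<inter> kernel G H h) = card (N \<inter> kernel G H h) * b" unfolding b_def
    using G.card_index[OF s] assms(3) by blast
  ultimately have "card B = card N * (a * b)"
    using card_image_ker[OF assms(1)] card_image_ker[OF assms(2)] by simp
  then have "card B div card N = a * b" using G.card_subgroup_pos[OF assms(1)] by simp
  then show ?thesis by (simp add: a_def)
qed

lemma sigma_subnormal_image:
  assumes "sigma_subnormal \<sigma> G B"
  shows "sigma_subnormal \<sigma> H (h ` B)"
proof -
  have B: "subgroup B G" "(sstep \<sigma> G)\<^sup>*\<^sup>* B (carrier G)" using assms(1) by (auto simp: G.sigma_subnormal_iff)
  have step: "sstep \<sigma> H (h ` A) (h ` C)" if AC: "sstep \<sigma> G A C" for A C
  proof -
    from AC obtain N where A: "subgroup A G" and C: "subgroup C G" and AC': "A \<subseteq> C" 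
      and N: "N \<lhd> G\<lparr>carrier := C\<rparr>" "N \<subseteq> A" 
      and e: "N = A \<or> (\<exists>S\<in>\<sigma>. pi_number S (card C div card N))"
      by (auto simp: sstep_def)
    have Ns: "subgroup N G" using G.normal_in_imp(1)[OF N(1) C] .
    have "card (h ` C) div card (h ` N) dvd card C div card N"
      using index_image_dvd[OF Ns C] N AC' by blast
    then have "h ` N = h ` A \<or> (\<exists>S\<in>\<sigma>. pi_number S (card (h ` C) div card (h ` N)))"
      using e pi_number_dvd by blast
    then show ?thesis unfolding sstep_def
      using subgroup_image[OF A] subgroup_image[OF C] AC' N normal_image_in[OF N(1) C] by blast
  qed
  have "(sstep \<sigma> H)\<^sup>*\<^sup>* (h ` B) (h ` C)" if "(sstep \<sigma> G)\<^sup>*\<^sup>* B C" for C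
    using that by induction (auto intro: rtranclp.rtrancl_into_rtrancl step)
  from this[OF B(2)] show ?thesis using surj subgroup_image[OF B(1)] by (simp add: H.sigma_subnormal_iff)
qed

end

text \<open>\<open>nilq \<sigma> G N\<close> says that \<open>G/N\<close> has a normal complement to every \<open>\<sigma>\<^sub>i\<close>-part; this is
  \<sigma>-nilpotency of \<open>G/N\<close> without reference to the quotient.\<close>

definition nilq :: "nat set set \<Rightarrow> ('a, 'b) monoid_scheme \<Rightarrow> 'a set \<Rightarrow> bool" where
  "nilq \<sigma> G N \<longleftrightarrow> N \<lhd> G \<and> (\<forall>S\<in>\<sigma>. \<exists>T. T \<lhd> G \<and> N \<subseteq> T \<and>
     pi_number (-S) (card T div card N) \<and> pi_number S (card (carrier G) div card T))"

lemma prod_dvd_if_pairwise_coprime: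
  fixes f :: "'c \<Rightarrow> nat"
  assumes "finite A" "\<And>i. i \<in> A \<Longrightarrow> f i dvd n"
    and "\<And>i j. i \<in> A \<Longrightarrow> j \<in> A \<Longrightarrow> i \<noteq> j \<Longrightarrow> coprime (f i) (f j)"
  shows "(\<Prod>i\<in>A. f i) dvd n"
  using assms
proof (induction A rule: finite_induct)
  case (insert i A)
  have "coprime (f i) (\<Prod>i\<in>A. f i)" using insert by (intro prod_coprime_right) auto
  then show ?case using insert by (simp add: divides_mult)
qed simp

context prime_partition begin

lemma sigma_nilpotent_imp_nilq:
  assumes "fin_group G" "sigma_nilpotent \<sigma> G"
  shows "nilq \<sigma> G {\<one>\<^bsub>G\<^esub>}"
proof -
  interpret fin_group G by fact
  obtain n and K :: "nat \<Rightarrow> 'a monoid" and h where K: "\<And>i. i < n \<Longrightarrow> group (K i)" "\<And>i. i < n \<Longrightarrow> sigma_primary \<sigma> (K i)"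
    and h: "h \<in> iso G (product_group {..<n} K)"
    using assms(2) unfolding sigma_nilpotent_def is_iso_def by blast
  let ?P = "product_group {..<n} K"
  have hom: "h \<in> hom G ?P" and bij: "bij_betw h (carrier G) (carrier ?P)" using h by (auto simp: iso_def)
  interpret P: group ?P by (rule product_group) (use K in simp)
  interpret h: group_hom G ?P h by (simp add: group_hom_def group_hom_axioms_def hom is_group P.is_group)
  have cG: "card (carrier G) = (\<Prod>i<n. card (carrier (K i)))"
    using bij_betw_same_card[OF bij] by (simp add: card_PiE)
  have pos: "card (carrier (K i)) > 0" if "i < n" for i
    using card_carrier_pos cG that by (metis finite_lessThan gr0I lessThan_iff prod_zero less_numeral_extra(3))
  show ?thesis unfolding nilq_def
  proof (intro conjI ballI)
    show "{\<one>\<^bsub>G\<^esub>} \<lhd> G" using one_is_normal .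
    fix S assume S: "S \<in> \<sigma>"
    let ?J = "{i. i < n \<and> pi_number S (order (K i))}"
    let ?A = "\<lambda>i. if i \<in> ?J then {\<one>\<^bsub>K i\<^esub>} else carrier (K i)"
    \<comment> \<open>The S-complement consists of the elements whose components in all factors that
      are S-groups vanish; it corresponds to the product of the remaining factors.\<close>
    define T where "T = {g \<in> carrier G. \<forall>i\<in>?J. h g i = \<one>\<^bsub>K i\<^esub>}"
    have comp: "group_hom G (K i) (\<lambda>g. h g i)" if "i < n" for i
      using K(1)[OF that] h.hom_closed that unfolding group_hom_def group_hom_axioms_def
      by (auto intro!: homI is_group)
    have Ts: "subgroup T G"
    proof (rule subgroupI)
      have "\<one>\<^bsub>G\<^esub> \<in> T" using group_hom.hom_one[OF comp] by (auto simp: T_def)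
      then show "T \<noteq> {}" by blast
      fix a assume a: "a \<in> T"
      then show "inv\<^bsub>G\<^esub> a \<in> T" using group_hom.hom_inv[OF comp] K(1) by (auto simp: T_def group.is_monoid monoid.inv_one)
      fix b assume b: "b \<in> T"
      show "a \<otimes>\<^bsub>G\<^esub> b \<in> T" using a b group_hom.hom_mult[OF comp] K(1) by (auto simp: T_def group.is_monoid)
    qed (auto simp: T_def)
    have Tn: "T \<lhd> G" unfolding normal_iff
    proof (intro conjI ballI Ts)
      fix x a assume x: "x \<in> carrier G" and a: "a \<in> T"
      have ac: "a \<in> carrier G" using a by (simp add: T_def)
      have "h (x \<otimes>\<^bsub>G\<^esub> a \<otimes>\<^bsub>G\<^esub> inv\<^bsub>G\<^esub> x) i = \<one>\<^bsub>K i\<^esub>" if i: "i \<in> ?J" for i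
      proof -
        interpret c: group_hom G "K i" "\<lambda>g. h g i" using comp i by simp
        have "h a i = \<one>\<^bsub>K i\<^esub>" using a i by (simp add: T_def)
        then show ?thesis using c.hom_mult[of "x \<otimes>\<^bsub>G\<^esub> a" "inv\<^bsub>G\<^esub> x"] c.hom_mult[of x a] c.hom_inv[OF x] c.hom_closed[OF x] x ac
          by (simp del: h.hom_mult h.hom_inv c.hom_mult c.hom_inv)
      qed
      then show "x \<otimes>\<^bsub>G\<^esub> a \<otimes>\<^bsub>G\<^esub> inv\<^bsub>G\<^esub> x \<in> T" using x ac by (simp add: T_def)
    qed
    have sub: "PiE {..<n} ?A \<subseteq> carrier ?P"
      using K by (auto simp: PiE_iff group.is_monoid split: if_splits)
    have "h ` T = PiE {..<n} ?A"
    proof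
      show "PiE {..<n} ?A \<subseteq> h ` T"
      proof
        fix z assume z: "z \<in> PiE {..<n} ?A"
        then have "z \<in> h ` carrier G" using sub bij by (auto simp: bij_betw_def)
        then obtain g where g: "g \<in> carrier G" "z = h g" by blast
        have "z i = \<one>\<^bsub>K i\<^esub>" if "i \<in> ?J" for i using PiE_mem[OF z, of i] that by simp
        then have "g \<in> T" using g by (simp add: T_def)
        then show "z \<in> h ` T" using g by blast
      qed
      show "h ` T \<subseteq> PiE {..<n} ?A"
      proof
        fix z assume "z \<in> h ` T"
        then obtain g where g: "g \<in> carrier G" "\<forall>i\<in>?J. h g i = \<one>\<^bsub>K i\<^esub>" "z = h g" by (auto simp: T_def)
        have "h g \<in> carrier ?P" by (rule h.hom_closed[OF g(1)])
        then show "z \<in> PiE {..<n} ?A" using g by (auto simp: PiE_iff)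
      qed
    qed
    moreover have "inj_on h T" using bij by (auto simp: bij_betw_def T_def intro: inj_on_subset)
    ultimately have "card T = card (PiE {..<n} ?A)" by (metis card_image)
    then have cT: "card T = (\<Prod>i<n. card (?A i))" by (simp add: card_PiE)
    have "(\<Prod>i<n. card (carrier (K i))) = (\<Prod>i<n. card (?A i)) * (\<Prod>i<n. if i \<in> ?J then card (carrier (K i)) else 1)"
      unfolding prod.distrib[symmetric] by (rule prod.cong) auto
    then have "card (carrier G) = card T * (\<Prod>i<n. if i \<in> ?J then card (carrier (K i)) else 1)"
      using cG cT by simp
    then have ind: "card (carrier G) div card T = (\<Prod>i<n. if i \<in> ?J then card (carrier (K i)) else 1)"
      using card_subgroup_pos[OF Ts] by simp
    have "pi_number S (card (carrier G) div card T)" unfolding ind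
      by (rule pi_number_prod) (auto simp: order_def)
    moreover have "pi_number (-S) (card T)" unfolding cT
    proof (rule pi_number_prod)
      fix i assume "i \<in> {..<n}"
      then have i: "i < n" by simp
      obtain S' where S': "S' \<in> \<sigma>" "pi_number S' (order (K i))"
        using K(2)[OF i] by (auto simp: sigma_primary_def pi_number_def)
      show "pi_number (-S) (card (?A i))"
      proof (cases "i \<in> ?J")
        case False
        then have "S' \<noteq> S" using S' i by auto
        then have "pi_number (-S) (order (K i))" using pi_number_other[OF S'(1) S] S'(2) by simp
        then show ?thesis unfolding order_def using False by simp
      qed simp
    qed simp
    ultimately show "\<exists>T. T \<lhd> G \<and> {\<one>\<^bsub>G\<^esub>} \<subseteq> T \<and> pi_number (-S) (card T div card {\<one>\<^bsub>G\<^esub>}) \<and>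
        pi_number S (card (carrier G) div card T)"
      using Tn subgroup.one_closed[OF Ts] by (intro exI[of _ T]) simp
  qed
qed

text \<open>G is mapped to the product of its quotients by the S-complements, one for each block of
  \<sigma>(G). The order of the kernel is prime to every block, so the map is injective; the
  quotients have pairwise coprime orders dividing |G|, so it is also onto.\<close>

lemma nilq_imp_sigma_nilpotent:
  fixes G :: "('a, 'b) monoid_scheme"
  assumes "fin_group G" "nilq \<sigma> G {\<one>\<^bsub>G\<^esub>}"
  shows "sigma_nilpotent \<sigma> G"
proof -
  interpret fin_group G by fact
  have "finite (sigma_of \<sigma> (card (carrier G)))"
  proof -
    \<comment> \<open>Blocks are disjoint, so choosing a prime divisor of |G| in each block is
      injective; this bounds the number of blocks.\<close>
    define f where "f S = (SOME p. p \<in> S \<inter> primes_of (card (carrier G)))" for S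
    have f: "f S \<in> S \<inter> primes_of (card (carrier G))" if "S \<in> sigma_of \<sigma> (card (carrier G))" for S
    proof -
      have "\<exists>p. p \<in> S \<inter> primes_of (card (carrier G))" using that by (auto simp: sigma_of_def)
      then show ?thesis unfolding f_def by (rule someI_ex)
    qed
    show ?thesis
    proof (rule inj_on_finite[of f])
      show "inj_on f (sigma_of \<sigma> (card (carrier G)))"
        by (rule inj_onI) (metis f block_unique IntD1 sigma_of_iff)
      show "f ` sigma_of \<sigma> (card (carrier G)) \<subseteq> primes_of (card (carrier G))" using f by blast
    qed (rule finite_primes_of[OF card_carrier_pos])
  qed
  then obtain n and s :: "nat \<Rightarrow> nat set" where s: "bij_betw s {..<n} (sigma_of \<sigma> (card (carrier G)))"
    using ex_bij_betw_nat_finite by (metis atLeast0LessThan)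
  have ss: "s i \<in> \<sigma>" if "i < n" for i using s that by (auto simp: bij_betw_def sigma_of_iff)
  have sneq: "s i \<noteq> s j" if "i < n" "j < n" "i \<noteq> j" for i j
    using s that by (auto simp: bij_betw_def inj_on_def)
  have "\<forall>i. i < n \<longrightarrow> (\<exists>T. T \<lhd> G \<and> pi_number (- s i) (card T) \<and> pi_number (s i) (card (carrier G) div card T))"
    using assms(2) ss unfolding nilq_def by (metis card.empty card.insert div_by_1 empty_iff finite.emptyI One_nat_def)
  then obtain T where T: "\<And>i. i < n \<Longrightarrow> T i \<lhd> G" "\<And>i. i < n \<Longrightarrow> pi_number (- s i) (card (T i))"
    "\<And>i. i < n \<Longrightarrow> pi_number (s i) (card (carrier G) div card (T i))" by metis
  have "\<forall>i. i < n \<longrightarrow> (\<exists>(Q :: ('a, 'b) monoid_scheme) f. fin_epi G Q f \<and> kernel G Q f = T i)"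
    using ex_quotient' T(1) by blast
  then obtain Q :: "nat \<Rightarrow> ('a, 'b) monoid_scheme" and f where Q: "\<And>i. i < n \<Longrightarrow> fin_epi G (Q i) (f i)" 
    "\<And>i. i < n \<Longrightarrow> kernel G (Q i) (f i) = T i" by metis
  \<comment> \<open>The factors in \<open>sigma_nilpotent\<close> are plain monoid records, so the
    extension of \<open>Q i\<close> is dropped.\<close>
  define K where "K i = \<lparr>carrier = carrier (Q i), monoid.mult = monoid.mult (Q i), one = one (Q i)\<rparr>" for i
  have Qg: "group (Q i)" if "i < n" for i using Q(1)[OF that] by (simp add: fin_epi_def group_hom_def)
  have Kg: "group (K i)" if "i < n" for i
  proof -
    interpret g: group "Q i" using Qg[OF that] .
    show ?thesis by (rule groupI) (auto simp: K_def g.m_assoc intro: g.l_inv_ex)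
  qed
  have cQ: "card (carrier (K i)) = card (carrier G) div card (T i)" if "i < n" for i
    using fin_epi.card_carrier[OF Q(1)[OF that]] Q(2)[OF that] fin_epi.card_kernel_pos[OF Q(1)[OF that]] by (simp add: K_def)
  have Kp: "sigma_primary \<sigma> (K i)" if "i < n" for i
    using cQ[OF that] T(3)[OF that] ss[OF that] by (auto simp: sigma_primary_def order_def pi_number_def)
  let ?P = "product_group {..<n} K"
  let ?h = "\<lambda>g. \<lambda>i\<in>{..<n}. f i g"
  have fh: "f i \<in> hom G (Q i)" if "i < n" for i
    using Q(1)[OF that] by (simp add: fin_epi_def group_hom_def group_hom_axioms_def)
  have hom: "?h \<in> hom G ?P"
  proof (rule homI)
    fix x assume "x \<in> carrier G"
    then show "?h x \<in> carrier ?P" using hom_in_carrier[OF fh] by (auto simp: K_def)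
  next
    fix x y assume "x \<in> carrier G" "y \<in> carrier G"
    then show "?h (x \<otimes>\<^bsub>G\<^esub> y) = ?h x \<otimes>\<^bsub>?P\<^esub> ?h y" using hom_mult[OF fh] by (auto simp: K_def intro!: restrict_ext)
  qed
  interpret P: group ?P by (rule product_group) (use Kg in simp)
  interpret h: group_hom G ?P ?h by (simp add: group_hom_def group_hom_axioms_def hom is_group P.is_group)
  have "card (kernel G ?P ?h) = 1"
  proof (rule all_pi_number_compl)
    fix S assume S: "S \<in> \<sigma>"
    show "pi_number (-S) (card (kernel G ?P ?h))"
    proof (cases "S \<in> sigma_of \<sigma> (card (carrier G))")
      case False
      then have "pi_number (-S) (card (carrier G))" using S by (simp add: sigma_of_iff)
      then show ?thesis using card_subgroup_dvd[OF h.subgroup_kernel] pi_number_dvd by blast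
    next
      case True
      then obtain i where i: "i < n" "S = s i" using s by (auto simp: bij_betw_def)
      have "kernel G ?P ?h \<subseteq> T i"
      proof
        fix g assume "g \<in> kernel G ?P ?h"
        then have g: "g \<in> carrier G" "?h g = (\<lambda>i\<in>{..<n}. \<one>\<^bsub>K i\<^esub>)" by (auto simp: kernel_def)
        have "f i g = \<one>\<^bsub>Q i\<^esub>" using fun_cong[OF g(2), of i] i by (simp add: K_def)
        then have "g \<in> kernel G (Q i) (f i)" using g by (simp add: kernel_def)
        then show "g \<in> T i" using Q(2)[OF i(1)] by simp
      qed
      then have "card (kernel G ?P ?h) dvd card (T i)"
        using card_subgroup_dvd_subgroup[OF h.subgroup_kernel normal_imp_subgroup[OF T(1)[OF i(1)]]] by simp
      then show ?thesis using T(2)[OF i(1)] i(2) pi_number_dvd by blast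
    qed
  qed
  then have "kernel G ?P ?h = {\<one>\<^bsub>G\<^esub>}" using card_eq_1_iff[OF h.subgroup_kernel] by simp
  then have inj: "inj_on ?h (carrier G)" by (rule h.trivial_ker_imp_inj)
  have cP: "card (carrier ?P) = (\<Prod>i<n. card (carrier G) div card (T i))"
    using cQ by (simp add: card_PiE)
  have "(\<Prod>i<n. card (carrier G) div card (T i)) dvd card (carrier G)"
  proof (rule prod_dvd_if_pairwise_coprime)
    fix i assume "i \<in> {..<n}"
    then show "card (carrier G) div card (T i) dvd card (carrier G)"
      using card_subgroup_dvd[OF normal_imp_subgroup[OF T(1)]] by (simp add: div_dvd_iff_mult)
        (metis card_carrier_pos dvd_div_eq_0_iff dvd_mult_div_cancel dvd_triv_left dvd_triv_right less_numeral_extra(3) mult.commute)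
  next
    fix i j assume "i \<in> {..<n}" "j \<in> {..<n}" "i \<noteq> j"
    then show "coprime (card (carrier G) div card (T i)) (card (carrier G) div card (T j))"
      using T(3) ss sneq pi_number_other by (metis lessThan_iff pi_number_coprime)
  qed simp
  then have "card (carrier ?P) \<le> card (carrier G)" using cP card_carrier_pos dvd_imp_le by metis
  moreover have "card (?h ` carrier G) = card (carrier G)" using inj by (rule card_image)
  moreover have "?h ` carrier G \<subseteq> carrier ?P" using hom by (rule hom_carrier)
  moreover have "finite (carrier ?P)"
    using fin_group.fin[OF fin_epi.fin_group_codom[OF Q(1)]] by (auto simp: K_def intro!: finite_PiE)
  ultimately have "?h ` carrier G = carrier ?P" by (simp add: card_seteq)
  then have "?h \<in> iso G ?P" using hom inj by (simp add: iso_def bij_betw_def)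
  then have "G \<cong> ?P" by (rule is_isoI)
  then show ?thesis unfolding sigma_nilpotent_def using Kg Kp by blast
qed

lemma sigma_nilpotent_iff:
  "fin_group G \<Longrightarrow> sigma_nilpotent \<sigma> G \<longleftrightarrow> nilq \<sigma> G {\<one>\<^bsub>G\<^esub>}"
  using sigma_nilpotent_imp_nilq nilq_imp_sigma_nilpotent by blast

end

lemma (in fin_epi) nilq_one_iff: "nilq \<sigma> H {\<one>\<^bsub>H\<^esub>} \<longleftrightarrow> nilq \<sigma> G (kernel G H h)"
proof
  assume a: "nilq \<sigma> H {\<one>\<^bsub>H\<^esub>}"
  show "nilq \<sigma> G (kernel G H h)" unfolding nilq_def
  proof (intro conjI ballI normal_kernel)
    fix S assume "S \<in> \<sigma>"
    then obtain T where T: "T \<lhd> H" "pi_number (-S) (card T)" "pi_number S (card (carrier H) div card T)"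
      using a unfolding nilq_def by auto
    have Ts: "subgroup T H" using T normal_imp_subgroup by blast
    have "card (pre T) div card (kernel G H h) = card T" using card_pre[OF Ts] card_kernel_pos by simp
    moreover have "card (carrier G) div card (pre T) = card (carrier H) div card T"
      using card_pre[OF Ts] card_carrier card_kernel_pos by simp
    ultimately show "\<exists>T. T \<lhd> G \<and> kernel G H h \<subseteq> T \<and> pi_number (-S) (card T div card (kernel G H h)) \<and>
       pi_number S (card (carrier G) div card T)"
      using normal_pre[OF T(1)] ker_subset_pre[OF Ts] T by (intro exI[of _ "pre T"]) simp
  qed
next
  assume a: "nilq \<sigma> G (kernel G H h)"
  show "nilq \<sigma> H {\<one>\<^bsub>H\<^esub>}" unfolding nilq_def
  proof (intro conjI ballI H.one_is_normal)
    fix S assume "S \<in> \<sigma>"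
    then obtain T where T: "T \<lhd> G" "kernel G H h \<subseteq> T" "pi_number (-S) (card T div card (kernel G H h))" 
      "pi_number S (card (carrier G) div card T)"
      using a unfolding nilq_def by auto
    have Ts: "subgroup T G" using T normal_imp_subgroup by blast
    have "card T div card (kernel G H h) = card (h ` T)" using card_image_ker'[OF Ts T(2)] card_kernel_pos by simp
    moreover have "card (carrier G) div card T = card (carrier H) div card (h ` T)"
      using card_image_ker'[OF Ts T(2)] card_carrier card_kernel_pos by simp
    ultimately show "\<exists>T. T \<lhd> H \<and> {\<one>\<^bsub>H\<^esub>} \<subseteq> T \<and> pi_number (-S) (card T div card {\<one>\<^bsub>H\<^esub>}) \<and>
       pi_number S (card (carrier H) div card T)"
      using normal_image[OF T(1)] T subgroup.one_closed[OF subgroup_image[OF Ts]]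
      by (intro exI[of _ "h ` T"]) simp
  qed
qed

lemma (in fin_group) sigma_nilpotent_Mod_iff:
  assumes "prime_partition \<sigma>" "N \<lhd> G"
  shows "sigma_nilpotent \<sigma> (G Mod N) \<longleftrightarrow> nilq \<sigma> G N"
proof -
  interpret E: fin_epi G "G Mod N" "\<lambda>g. N #> g" using fin_epi_Mod[OF assms(2)] by simp
  show ?thesis
    using prime_partition.sigma_nilpotent_iff[OF assms(1) E.fin_group_codom] E.nilq_one_iff fin_epi_Mod(2)[OF assms(2)]
    by simp
qed


text \<open>For each block the two witnesses T and U are intersected: |T \<inter> U : N \<inter> M|
  is |T \<inter> U : N \<inter> U| times |N \<inter> U : N \<inter> M|, and these divide |T : N| and
  |U : M|.\<close>

lemma nilq_Int:
  assumes "fin_group G" "nilq \<sigma> G N" "nilq \<sigma> G M"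
  shows "nilq \<sigma> G (N \<inter> M)"
proof -
  interpret fin_group G by fact
  have Nn: "N \<lhd> G" "M \<lhd> G" using assms by (auto simp: nilq_def)
  have Ns: "subgroup N G" "subgroup M G" using Nn normal_imp_subgroup by auto
  show ?thesis unfolding nilq_def
  proof (intro conjI ballI normal_Int Nn)
    fix S assume S: "S \<in> \<sigma>"
    obtain T where T: "T \<lhd> G" "N \<subseteq> T" "pi_number (-S) (card T div card N)" "pi_number S (card (carrier G) div card T)"
      using assms(2) S unfolding nilq_def by blast
    obtain U where U: "U \<lhd> G" "M \<subseteq> U" "pi_number (-S) (card U div card M)" "pi_number S (card (carrier G) div card U)"
      using assms(3) S unfolding nilq_def by blast
    have Ts: "subgroup T G" "subgroup U G" using T U normal_imp_subgroup by auto
    have I: "subgroup (T \<inter> U) G" "subgroup (N \<inter> M) G" "subgroup (N \<inter> U) G" using subgroups_Inter_pair Ts Ns by auto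
    have "card (carrier G) div card (T \<inter> U) = (card (carrier G) div card T) * (card T div card (T \<inter> U))"
      using index_mult[OF I(1) Ts(1) subgroup_self] subgroup.subset[OF Ts(1)] by blast
    moreover have "card T div card (T \<inter> U) dvd card (carrier G) div card U"
      using index_Int_dvd[OF U(1) Ts(1)] by (simp add: Int_commute)
    ultimately have 1: "pi_number S (card (carrier G) div card (T \<inter> U))"
      using T(4) pi_number_dvd[OF U(4)] by (simp add: pi_number_mult)
    have "N \<inter> (T \<inter> U) = N \<inter> U" "M \<inter> (N \<inter> U) = N \<inter> M" using T U by auto
    then have "card (T \<inter> U) div card (N \<inter> U) dvd card T div card N" 
      "card (N \<inter> U) div card (N \<inter> M) dvd card U div card M"
      using index_Int_dvd_in[OF normal_in_subgroup[OF Nn(1) Ts(1) T(2)] Ts(1) I(1)]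
        index_Int_dvd_in[OF normal_in_subgroup[OF Nn(2) Ts(2) U(2)] Ts(2) I(3)] by auto
    moreover have "card (T \<inter> U) div card (N \<inter> M) = (card (T \<inter> U) div card (N \<inter> U)) * (card (N \<inter> U) div card (N \<inter> M))"
      by (rule index_mult[OF I(2,3,1)]) (use T U in auto)
    ultimately have 2: "pi_number (-S) (card (T \<inter> U) div card (N \<inter> M))"
      using pi_number_dvd T(3) U(3) by (simp add: pi_number_mult)
    show "\<exists>V. V \<lhd> G \<and> N \<inter> M \<subseteq> V \<and> pi_number (-S) (card V div card (N \<inter> M)) \<and> pi_number S (card (carrier G) div card V)"
      using 1 2 normal_Int[OF T(1) U(1)] T(2) U(2) by (intro exI[of _ "T \<inter> U"]) auto
  qed
qed

context prime_partition begin

text \<open>The witness is N for the block S itself and the whole group for every other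
  block.\<close>

lemma nilq_primary:
  assumes "fin_group G" "N \<lhd> G" "S \<in> \<sigma>" "pi_number S (card (carrier G) div card N)"
  shows "nilq \<sigma> G N"
  unfolding nilq_def
proof (intro conjI ballI assms(2))
  interpret fin_group G by fact
  have N: "subgroup N G" using assms normal_imp_subgroup by blast
  fix S' assume S': "S' \<in> \<sigma>"
  show "\<exists>T. T \<lhd> G \<and> N \<subseteq> T \<and> pi_number (- S') (card T div card N) \<and> pi_number S' (card (carrier G) div card T)"
  proof (cases "S' = S")
    case True
    then show ?thesis using assms N card_subgroup_pos[OF N] by (intro exI[of _ N]) simp
  next
    case False
    then show ?thesis using assms S' pi_number_other[of S S'] subgroup.subset[OF N] card_carrier_pos normal_self
      by (intro exI[of _ "carrier G"]) auto
  qed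
qed

text \<open>By \<open>nilq_Int\<close> a member of least order lies in all others, so the
  intersection defining the residual is attained.\<close>

lemma residual_props:
  assumes "fin_group G"
  shows "nilq \<sigma> G (sigma_nilpotent_residual \<sigma> G)"
    "\<And>N. nilq \<sigma> G N \<Longrightarrow> sigma_nilpotent_residual \<sigma> G \<subseteq> N"
proof -
  interpret fin_group G by fact
  have eq: "sigma_nilpotent_residual \<sigma> G = \<Inter>{N. nilq \<sigma> G N}"
  proof -
    have "N \<lhd> G \<and> sigma_nilpotent \<sigma> (G Mod N) \<longleftrightarrow> nilq \<sigma> G N" for N
      using sigma_nilpotent_Mod_iff[OF prime_partition_axioms, of N] by (auto simp: nilq_def)
    then show ?thesis unfolding sigma_nilpotent_residual_def by simp
  qed
  show sub: "\<And>N. nilq \<sigma> G N \<Longrightarrow> sigma_nilpotent_residual \<sigma> G \<subseteq> N" unfolding eq by blast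
  obtain S where S: "S \<in> \<sigma>" using sigma_nonempty by blast
  have "nilq \<sigma> G (carrier G)" using nilq_primary[OF assms normal_self S] card_carrier_pos by simp
  then obtain N where N: "nilq \<sigma> G N" and min: "\<And>M. nilq \<sigma> G M \<Longrightarrow> card N \<le> card M"
    using ex_has_least_nat[of "nilq \<sigma> G" _ card] by blast
  have "N \<subseteq> M" if M: "nilq \<sigma> G M" for M
  proof -
    have "card N \<le> card (N \<inter> M)" using min[OF nilq_Int[OF assms N M]] .
    moreover have "finite N" using N finite_subgroup normal_imp_subgroup by (auto simp: nilq_def)
    ultimately show ?thesis by (metis card_seteq inf_le1 inf.absorb_iff1)
  qed
  then have "sigma_nilpotent_residual \<sigma> G = N" using N unfolding eq by blast
  then show "nilq \<sigma> G (sigma_nilpotent_residual \<sigma> G)" using N by simp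
qed

end

section \<open>Groups in which every subgroup is \<open>H\<^sub>\<sigma>\<close>-subnormally embedded\<close>

text \<open>Condition (i) with the \<sigma>-Hall property spelled out block by block; each
  alternative is inherited by divisors, which makes the condition easy to transport.\<close>

definition hemb :: "nat set set \<Rightarrow> ('a, 'b) monoid_scheme \<Rightarrow> bool" where
  "hemb \<sigma> G \<longleftrightarrow> (\<forall>A. subgroup A G \<longrightarrow> (\<exists>B. sigma_subnormal \<sigma> G B \<and> A \<subseteq> B \<and>
     (\<forall>S\<in>\<sigma>. pi_number (-S) (card A) \<or> pi_number (-S) (card B div card A))))"

context fin_group begin

lemma sigma_Hall_subgroup_iff:
  assumes "subgroup B G"
  shows "sigma_Hall_subgroup \<sigma> (G\<lparr>carrier := B\<rparr>) A \<longleftrightarrow> subgroup A G \<and> A \<subseteq> B \<and>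
    (\<forall>S\<in>\<sigma>. pi_number (-S) (card A) \<or> pi_number (-S) (card B div card A))"
proof -
  interpret B: fin_group "G\<lparr>carrier := B\<rparr>" by (rule fin_group_subgroup[OF assms])
  have s: "subgroup A (G\<lparr>carrier := B\<rparr>) \<longleftrightarrow> subgroup A G \<and> A \<subseteq> B"
    using incl_subgroup[OF assms] subgroup_incl[OF _ assms] subgroup.subset[of A "G\<lparr>carrier := B\<rparr>"]
    by (metis partial_object.select_convs(1) partial_object.surjective partial_object.update_convs(1))
  have "sigma_of \<sigma> (card A) \<inter> sigma_of \<sigma> (card (rcosets\<^bsub>G\<lparr>carrier := B\<rparr>\<^esub> A)) = {} \<longleftrightarrow>
    (\<forall>S\<in>\<sigma>. pi_number (-S) (card A) \<or> pi_number (-S) (card B div card A))"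
    if "subgroup A (G\<lparr>carrier := B\<rparr>)"
    using B.card_rcosets[OF that] by (auto simp: sigma_of_iff set_eq_iff)
  then show ?thesis unfolding sigma_Hall_subgroup_def using s by blast
qed

lemma hemb_iff: "(\<forall>A. subgroup A G \<longrightarrow> H_sigma_subnormally_embedded \<sigma> G A) \<longleftrightarrow> hemb \<sigma> G"
proof -
  have "sigma_subnormal \<sigma> G B \<and> sigma_Hall_subgroup \<sigma> (G\<lparr>carrier := B\<rparr>) A \<longleftrightarrow>
     sigma_subnormal \<sigma> G B \<and> A \<subseteq> B \<and> (\<forall>S\<in>\<sigma>. pi_number (-S) (card A) \<or> pi_number (-S) (card B div card A))"
    if "subgroup A G" for A B
    using that sigma_Hall_subgroup_iff[of B \<sigma> A] sigma_subnormal_iff[of \<sigma> B] by auto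
  then show ?thesis unfolding hemb_def H_sigma_subnormally_embedded_def by blast
qed

text \<open>B is replaced by B \<inter> H, whose index over A divides that of B.\<close>

lemma hemb_subgroup:
  assumes "hemb \<sigma> G" "subgroup H G"
  shows "hemb \<sigma> (G\<lparr>carrier := H\<rparr>)"
  unfolding hemb_def
proof (intro allI impI)
  fix A assume A: "subgroup A (G\<lparr>carrier := H\<rparr>)"
  have As: "subgroup A G" "A \<subseteq> H" using incl_subgroup[OF assms(2) A] subgroup.subset[OF A] by auto
  obtain B where B: "sigma_subnormal \<sigma> G B" "A \<subseteq> B"
    "\<forall>S\<in>\<sigma>. pi_number (-S) (card A) \<or> pi_number (-S) (card B div card A)"
    using assms(1) As unfolding hemb_def by blast
  have Bs: "subgroup B G" using B sigma_subnormal_iff by blast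
  have "card (B \<inter> H) div card A dvd card B div card A"
    by (rule index_dvd_mono(1)) (use As Bs B subgroups_Inter_pair[OF Bs assms(2)] in auto)
  then have "\<forall>S\<in>\<sigma>. pi_number (-S) (card A) \<or> pi_number (-S) (card (B \<inter> H) div card A)"
    using B(3) pi_number_dvd by blast
  then show "\<exists>B. sigma_subnormal \<sigma> (G\<lparr>carrier := H\<rparr>) B \<and> A \<subseteq> B \<and>
    (\<forall>S\<in>\<sigma>. pi_number (-S) (card A) \<or> pi_number (-S) (card B div card A))"
    using sigma_subnormal_Int[OF B(1) assms(2)] B(2) As(2) by (intro exI[of _ "B \<inter> H"]) auto
qed

end

text \<open>The full preimage of A is embedded first; taking images keeps its index and only shrinks
  its order to a divisor.\<close>

lemma (in fin_epi) hemb_image: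
  assumes "hemb \<sigma> G"
  shows "hemb \<sigma> H"
  unfolding hemb_def
proof (intro allI impI)
  fix A assume A: "subgroup A H"
  obtain B where B: "sigma_subnormal \<sigma> G B" "pre A \<subseteq> B"
    "\<forall>S\<in>\<sigma>. pi_number (-S) (card (pre A)) \<or> pi_number (-S) (card B div card (pre A))"
    using assms subgroup_pre[OF A] unfolding hemb_def by blast
  have Bs: "subgroup B G" using B G.sigma_subnormal_iff by blast
  have im: "h ` pre A = A" using image_pre[OF subgroup.subset[OF A]] .
  have "card (h ` B) div card A = card B div card (pre A)"
    using index_image[OF subgroup_pre[OF A] Bs ker_subset_pre[OF A] B(2)] im by simp
  moreover have "card A dvd card (pre A)" using card_pre[OF A] by simp
  ultimately have "\<forall>S\<in>\<sigma>. pi_number (-S) (card A) \<or> pi_number (-S) (card (h ` B) div card A)"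
    using B(3) pi_number_dvd by metis
  then show "\<exists>B. sigma_subnormal \<sigma> H B \<and> A \<subseteq> B \<and>
    (\<forall>S\<in>\<sigma>. pi_number (-S) (card A) \<or> pi_number (-S) (card B div card A))"
    using sigma_subnormal_image[OF B(1)] image_mono[OF B(2), of h] im by (intro exI[of _ "h ` B"]) auto
qed

section \<open>The residual O^S(G) and minimal normal subgroups\<close>

context fin_group begin

text \<open>Normal subgroups of S-index are closed under intersection, so one of least order lies in
  all others: it is O^S(G).\<close>

lemma ex_least_normal_index:
  obtains K where "K \<lhd> G" "pi_number S (card (carrier G) div card K)"
    "\<And>L. L \<lhd> G \<Longrightarrow> pi_number S (card (carrier G) div card L) \<Longrightarrow> K \<subseteq> L"
proof -
  let ?P = "\<lambda>K. K \<lhd> G \<and> pi_number S (card (carrier G) div card K)"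
  have "?P (carrier G)" using normal_self card_carrier_pos by simp
  then obtain K where K: "?P K" and min: "\<And>L. ?P L \<Longrightarrow> card K \<le> card L"
    using ex_has_least_nat[of ?P _ card] by blast
  have Ks: "subgroup K G" using K normal_imp_subgroup by blast
  have "K \<subseteq> L" if L: "?P L" for L
  proof -
    have Ls: "subgroup L G" using L normal_imp_subgroup by blast
    have KL: "subgroup (K \<inter> L) G" using subgroups_Inter_pair[OF Ks Ls] .
    have "card (carrier G) div card (K \<inter> L) = (card (carrier G) div card K) * (card K div card (K \<inter> L))"
      by (rule index_mult) (use KL Ks subgroup_self subgroup.subset[OF Ks] in auto)
    moreover have "card K div card (K \<inter> L) dvd card (carrier G) div card L"
      using index_Int_dvd[of L K] L Ks by (simp add: Int_commute)
    ultimately have "?P (K \<inter> L)" using K L normal_Int[of K L] pi_number_dvd by (simp add: pi_number_mult) blast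
    then have "card K \<le> card (K \<inter> L)" by (rule min)
    then show ?thesis using finite_subgroup[OF Ks] by (metis card_seteq inf_le1 inf.absorb_iff1)
  qed
  then show ?thesis using that K by blast
qed

lemma conjs_normal_in:
  assumes "N \<lhd> G" "K \<lhd> G\<lparr>carrier := N\<rparr>" "g \<in> carrier G"
  shows "conjs g K \<lhd> G\<lparr>carrier := N\<rparr>"
proof -
  have Ns: "subgroup N G" using assms normal_imp_subgroup by blast
  note K = normal_in_imp[OF assms(2) Ns]
  have "conjs g K \<subseteq> N" using conjs_mono[OF K(2), of g] conjs_normal[OF assms(1,3)] by simp
  moreover have "y \<otimes> (g \<otimes> k \<otimes> inv g) \<otimes> inv y \<in> conjs g K" if y: "y \<in> N" and k: "k \<in> K" for y k
  proof -
    have c: "y \<in> carrier G" "k \<in> carrier G" using y k Ns K(1) subgroup.mem_carrier by metis+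
    let ?z = "inv g \<otimes> y \<otimes> g"
    have z: "?z \<in> N" using normal.inv_op_closed1[OF assms(1,3) y] .
    have "y \<otimes> (g \<otimes> k \<otimes> inv g) \<otimes> inv y = g \<otimes> (?z \<otimes> k \<otimes> inv ?z) \<otimes> inv g"
      using c assms(3) by (simp add: inv_mult_group m_assoc mult_inv_cancel)
    then show ?thesis using K(3)[OF z k] unfolding conjs_def by blast
  qed
  ultimately show ?thesis unfolding normal_in_iff[OF Ns]
    using conjs_subgroup[OF assms(3) K(1)] by (auto simp: conjs_def)
qed

text \<open>O^S(N) is determined uniquely in N, hence fixed by every conjugation that preserves
  N.\<close>

lemma least_normal_index_in_normal:
  assumes "N \<lhd> G" "K \<lhd> G\<lparr>carrier := N\<rparr>" "pi_number S (card N div card K)"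
    "\<And>L. L \<lhd> G\<lparr>carrier := N\<rparr> \<Longrightarrow> pi_number S (card N div card L) \<Longrightarrow> K \<subseteq> L"
  shows "K \<lhd> G"
proof -
  have Ns: "subgroup N G" using assms normal_imp_subgroup by blast
  have Ks: "subgroup K G" using normal_in_imp(1)[OF assms(2) Ns] .
  have Kc: "K \<subseteq> carrier G" using Ks subgroup.subset by blast
  have "conjs g K = K" if g: "g \<in> carrier G" for g
  proof -
    have c: "card (conjs g K) = card K" using conjs_card[OF g Kc] .
    have "K \<subseteq> conjs g K" using assms(4)[OF conjs_normal_in[OF assms(1,2) g]] c assms(3) by simp
    moreover have "finite (conjs g K)" using finite_subgroup[OF Ks] by (simp add: conjs_def)
    ultimately show ?thesis using c by (metis card_subset_eq)
  qed
  then have "norm_of K = carrier G" by (auto simp: norm_of_def)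
  then show ?thesis using norm_of_eq_carrier_iff[OF Ks] by simp
qed

text \<open>The other side of the same count as in \<open>index_set_mult_normal\<close>: the index
  of the supplement, which need not be normal.\<close>

lemma index_set_mult_normal':
  assumes "N \<lhd> G" "subgroup M G" "N <#> M = carrier G"
  shows "card (carrier G) div card M = card N div card (N \<inter> M)"
proof -
  have N: "subgroup N G" using assms normal_imp_subgroup by blast
  have I: "subgroup (N \<inter> M) G" using subgroups_Inter_pair[OF N assms(2)] .
  define q where "q = card N div card (N \<inter> M)"
  have 1: "card (carrier G) * card (N \<inter> M) = card N * card M"
    using card_set_mult_normal(1)[OF assms(1,2)] assms(3) by simp
  have 2: "card N = card (N \<inter> M) * q"
    unfolding q_def using card_index[OF I N] by simp
  have 3: "card (N \<inter> M) > 0" "card M > 0"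
    using card_subgroup_pos I assms(2) by auto
  have "card (carrier G) = card M * q" using 1[unfolded 2] 3 by simp
  then show ?thesis using 3 by (simp add: q_def)
qed

lemma set_mult_subset_subgroup: "subgroup E G \<Longrightarrow> A \<subseteq> E \<Longrightarrow> B \<subseteq> E \<Longrightarrow> A <#> B \<subseteq> E"
  by (auto simp: set_mult_def intro!: subgroup.m_closed)

lemma ex_min_normal:
  assumes "K \<lhd> G" "K \<noteq> {\<one>}"
  obtains N where "N \<lhd> G" "N \<noteq> {\<one>}" "N \<subseteq> K" "\<And>W. W \<lhd> G \<Longrightarrow> W \<subseteq> N \<Longrightarrow> W = {\<one>} \<or> W = N"
proof -
  let ?P = "\<lambda>N. N \<lhd> G \<and> N \<noteq> {\<one>} \<and> N \<subseteq> K"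
  obtain N where N: "?P N" and min: "\<And>L. ?P L \<Longrightarrow> card N \<le> card L"
    using ex_has_least_nat[of ?P K card] assms by blast
  have "W = {\<one>} \<or> W = N" if W: "W \<lhd> G" "W \<subseteq> N" for W
  proof (rule disjCI)
    assume "W \<noteq> N"
    moreover have "finite N" using N finite_subgroup normal_imp_subgroup by blast
    ultimately have "card W < card N" using W(2) by (simp add: psubset_card_mono psubsetI)
    then show "W = {\<one>}" using min[of W] W N by fastforce
  qed
  then show ?thesis using that N by blast
qed

end

section \<open>Subgroups of S-index and normal S-complements\<close>

context prime_partition begin

lemma hemb_index:
  assumes "fin_group G" "hemb \<sigma> G" "S \<in> \<sigma>"
    and A: "subgroup A G" "pi_number S (card (carrier G) div card A)" "\<not> pi_number (-S) (card A)" "A \<noteq> carrier G"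
  obtains E L where "subgroup E G" "A \<subseteq> E" "E \<noteq> carrier G" "L \<lhd> G" "L \<subseteq> E" "pi_number S (card (carrier G) div card L)"
proof -
  interpret fin_group G by fact
  obtain B where B: "sigma_subnormal \<sigma> G B" "A \<subseteq> B"
    "\<forall>S\<in>\<sigma>. pi_number (-S) (card A) \<or> pi_number (-S) (card B div card A)"
    using assms(2) A(1) unfolding hemb_def by blast
  have Bs: "subgroup B G" using B sigma_subnormal_iff by blast
  \<comment> \<open>The embedding condition at S makes |B : A| prime to S, while A has S-index in G.
    Hence A = B, and A itself is \<sigma>-subnormal.\<close>
  have "pi_number (-S) (card B div card A)" using B(3) assms(3) A(3) by blast
  moreover have "pi_number S (card B div card A)"
    using index_dvd_mono(1)[OF A(1) Bs subgroup_self B(2) subgroup.subset[OF Bs]] A(2) pi_number_dvd by blast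
  ultimately have "card B div card A = 1" using pi_number_both by blast
  then have "A = B" using index_1_imp_eq[OF A(1) Bs B(2)] by blast
  then obtain E where E: "subgroup E G" "A \<subseteq> E" "E \<noteq> carrier G" "sstep \<sigma> G E (carrier G)"
    using sigma_subnormal_last_step[OF B(1)] A(4) by metis
  then obtain N where N: "N \<lhd> G" "N \<subseteq> E" and NE: "N = E \<or> (\<exists>S\<in>\<sigma>. pi_number S (card (carrier G) div card N))"
    by (auto simp: sstep_def)
  have Ns: "subgroup N G" using N normal_imp_subgroup by blast
  have Ec: "E \<subseteq> carrier G" using E(1) subgroup.subset by blast
  have iE: "card (carrier G) div card E dvd card (carrier G) div card A" 
    using index_dvd_mono(2)[OF A(1) E(1) subgroup_self E(2) Ec] .
  \<comment> \<open>In a primary last step the block can only be S, since |G : E| is nontrivial and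
    an S-number.\<close>
  have "pi_number S (card (carrier G) div card N)"
  proof (cases "N = E")
    case True then show ?thesis using iE A(2) pi_number_dvd by blast
  next
    case False
    then obtain S' where S': "S' \<in> \<sigma>" "pi_number S' (card (carrier G) div card N)" using NE by blast
    have "card (carrier G) div card E \<noteq> 1" using index_1_imp_eq[OF E(1) subgroup_self Ec] E(3) by blast
    moreover have "pi_number S (card (carrier G) div card E)" using iE A(2) pi_number_dvd by blast
    ultimately have "\<not> pi_number (-S) (card (carrier G) div card E)" using pi_number_both by blast
    moreover have "pi_number S' (card (carrier G) div card E)"
      using index_dvd_mono(2)[OF Ns E(1) subgroup_self N(2) Ec] S'(2) pi_number_dvd by blast
    ultimately have "S' = S" using pi_number_unique[OF S'(1) assms(3)] by blast
    then show ?thesis using S' by simp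
  qed
  then show ?thesis using that E N by blast
qed

text \<open>The form used when O^S(G) = G: the normal subgroup supplied by \<open>hemb_index\<close>
  would be G, yet lie in a proper subgroup.\<close>

lemma hemb_index_no_normal:
  assumes "fin_group G" "hemb \<sigma> G" "S \<in> \<sigma>"
    and no: "\<And>L. L \<lhd> G \<Longrightarrow> pi_number S (card (carrier G) div card L) \<Longrightarrow> L = carrier G"
    and A: "subgroup A G" "pi_number S (card (carrier G) div card A)" "\<not> pi_number (-S) (card A)"
  shows "A = carrier G"
proof (rule ccontr)
  assume "A \<noteq> carrier G"
  then obtain E L where E: "subgroup E G" "A \<subseteq> E" "E \<noteq> carrier G" "L \<lhd> G" "L \<subseteq> E" "pi_number S (card (carrier G) div card L)"
    using hemb_index[OF assms(1,2,3) A] by metis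
  then show False using no[of L] subgroup.subset[OF E(1)] by blast
qed

lemma hemb_normal_Hall:
  assumes "fin_group G" "hemb \<sigma> G" "S \<in> \<sigma>"
    and no: "\<And>L. L \<lhd> G \<Longrightarrow> pi_number S (card (carrier G) div card L) \<Longrightarrow> L = carrier G"
    and N: "N \<lhd> G" "pi_number S (card N)" "pi_number (-S) (card (carrier G) div card N)" "N \<noteq> {\<one>\<^bsub>G\<^esub>}"
  shows "\<exists>p k. Factorial_Ring.prime p \<and> card N = p ^ k"
    "\<And>W. W \<lhd> G \<Longrightarrow> W \<subseteq> N \<Longrightarrow> W = {\<one>\<^bsub>G\<^esub>} \<or> W = N"
proof -
  interpret fin_group G by fact
  note L = hemb_index_no_normal[OF assms(1,2,3) no]
  have Ns: "subgroup N G" using N normal_imp_subgroup by blast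
  have Nc: "N \<subseteq> carrier G" using Ns subgroup.subset by blast
  have notcompl: "\<not> pi_number (-S) n" if "m dvd n" "m dvd card N" "m \<noteq> 1" for m n
    using that N(2) pi_number_both pi_number_dvd by blast
  have "card N \<noteq> 1" using card_eq_1_iff[OF Ns] N(4) by simp
  then obtain p where p: "Factorial_Ring.prime p" "p dvd card N" using prime_factor_nat by blast
  interpret N: fin_group "G\<lparr>carrier := N\<rparr>" by (rule fin_group_subgroup[OF Ns])
  obtain P where P0: "subgroup P (G\<lparr>carrier := N\<rparr>)" "card P = p ^ multiplicity p (card N)" 
      "\<not> p dvd card N div card P" using N.sylow_exists[OF p(1)] by auto
  have P: "subgroup P G" "P \<subseteq> N" using P0 incl_subgroup[OF Ns] subgroup.subset[OF P0(1)] by auto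
  have Pc: "P \<subseteq> carrier G" using P Nc by blast
  have iP: "card P dvd card N" using card_subgroup_dvd_subgroup[OF P(1) Ns P(2)] .
  have P1: "card P \<noteq> 1"
  proof
    assume "card P = 1"
    then show False using P0(3) p(2) by simp
  qed
  \<comment> \<open>By Frattini the normalizer has index dividing |N|, an S-number, and it contains
    P; so it is G, and P is normal.\<close>
  let ?A = "norm_of P"
  have A: "subgroup ?A G" by (rule norm_of_subgroup[OF Pc])
  have NA: "N <#>\<^bsub>G\<^esub> ?A = carrier G"
    by (rule frattini_sylow[OF N(1) P(1,2) p(1) P0(2,3)])
  have NAs: "subgroup (N \<inter> ?A) G" using subgroups_Inter_pair[OF Ns A] .
  have "card (carrier G) div card ?A dvd card N"
    using index_set_mult_normal'[OF N(1) A NA] card_index[OF NAs Ns] by (metis dvd_triv_right inf_le1)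
  then have "pi_number S (card (carrier G) div card ?A)" using N(2) pi_number_dvd by blast
  moreover have "card P dvd card ?A" using card_subgroup_dvd_subgroup[OF P(1) A subset_norm_of[OF P(1)]] .
  then have "\<not> pi_number (-S) (card ?A)" using notcompl iP P1 by blast
  ultimately have "?A = carrier G" using L[OF _ _ A] by blast
  then have Pn: "P \<lhd> G" using norm_of_eq_carrier_iff[OF P(1)] by simp
  \<comment> \<open>A complement H of P has index |P|, and its order is divisible by |N : P|. If the
    latter were nontrivial, H would be G, although P is not 1.\<close>
  have NP: "N = P"
  proof (rule ccontr)
    assume ne: "N \<noteq> P"
    have ci: "card (carrier G) div card P = (card (carrier G) div card N) * (card N div card P)"
      using index_mult[OF P(1) Ns subgroup_self P(2) Nc] .
    have "p \<in> S" using p N(2) by (auto simp: pi_number_def primes_of_def)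
    then have "\<not> p dvd card (carrier G) div card N" using N(3) p(1) by (auto simp: pi_number_def primes_of_def)
    then have "\<not> p dvd card (carrier G) div card P" using ci P0(3) p(1) by (simp add: prime_dvd_mult_iff)
    then have "coprime (card P) (card (carrier G) div card P)"
      using P0(2) p(1) by (simp add: prime_imp_coprime)
    then obtain H where H: "subgroup H G" "card H = card (carrier G) div card P"
      using schur_zassenhaus_exists[OF assms(1) Pn] by blast
    have cG: "card (carrier G) = card P * card H" using H card_subgroup_dvd[OF P(1)] by simp
    then have "card (carrier G) div card H = card P" using card_subgroup_pos[OF H(1)] by simp
    then have "pi_number S (card (carrier G) div card H)" using iP N(2) pi_number_dvd by auto
    moreover have "card N div card P \<noteq> 1" using index_1_imp_eq[OF P(1) Ns P(2)] ne by blast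
    then have "\<not> pi_number (-S) (card H)"
      using notcompl[of "card N div card P" "card H"] H ci card_index[OF P(1) Ns P(2)] by (metis dvd_triv_right)
    ultimately have "H = carrier G" using L[OF _ _ H(1)] by blast
    then have "card P = 1" using cG card_carrier_pos by simp
    then show False using P1 by simp
  qed
  then show "\<exists>p k. Factorial_Ring.prime p \<and> card N = p ^ k" using p(1) P0(2) by blast
  \<comment> \<open>The preimage A of a complement of N/W in G/W has S-index |N : W| and contains W.
    If W is not trivial, this makes A all of G, and W = N.\<close>
  fix W assume W: "W \<lhd> G" "W \<subseteq> N"
  show "W = {\<one>\<^bsub>G\<^esub>} \<or> W = N"
  proof (rule ccontr)
    assume "\<not> (W = {\<one>\<^bsub>G\<^esub>} \<or> W = N)"
    then have ne: "W \<noteq> {\<one>\<^bsub>G\<^esub>}" "W \<noteq> N" by auto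
    have Ws: "subgroup W G" using W normal_imp_subgroup by blast
    obtain Q :: "('a, 'b) monoid_scheme" and f where "fin_epi G Q f" and ker: "kernel G Q f = W"
      using ex_quotient[OF W(1)] by blast
    then interpret E: fin_epi G Q f by simp
    have iN: "card (carrier Q) div card (f ` N) = card (carrier G) div card N"
      using E.index_image[OF Ns subgroup_self] ker W(2) Nc E.surj by simp
    have cN: "card N = card (f ` N) * card W" using E.card_image_ker'[OF Ns] ker W(2) by simp
    have "coprime (card (f ` N)) (card (carrier Q) div card (f ` N))"
      using iN pi_number_coprime[OF N(2,3)] cN by (metis coprime_mult_left_iff)
    then obtain H where H: "subgroup H Q" "card H = card (carrier G) div card N"
      using schur_zassenhaus_exists[OF E.fin_group_codom E.normal_image[OF N(1)]] iN by auto
    define A where "A = E.pre H"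
    have A: "subgroup A G" "card A = card H * card W" "W \<subseteq> A"
      using E.subgroup_pre[OF H(1)] E.card_pre[OF H(1)] E.ker_subset_pre[OF H(1)] ker by (auto simp: A_def)
    have cG: "card (carrier G) = card N * card H" using H(2) card_subgroup_dvd[OF Ns] by simp
    then have cG': "card (carrier G) = card (f ` N) * card A" using cN A(2) by simp
    then have "card (carrier G) div card A = card (f ` N)" using card_subgroup_pos[OF A(1)] by simp
    then have "pi_number S (card (carrier G) div card A)" using cN N(2) by (simp add: pi_number_mult)
    moreover have "\<not> pi_number (-S) (card A)"
      using notcompl[of "card W" "card A"] A(2) cN card_eq_1_iff[OF Ws] ne(1) by simp
    ultimately have "A = carrier G" using L[OF _ _ A(1)] by blast
    then have "card (f ` N) = 1" using cG' card_carrier_pos by simp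
    then have "card N = card W" using cN by simp
    then show False using card_eq_imp_eq[OF Ws Ns W(2)] ne(2) by simp
  qed
qed

text \<open>A maximal normal subgroup gives a simple quotient Q inheriting the hypothesis. Unless
  |Q| is an S-number for some block, 1 and Q are its only \<sigma>-subnormal subgroups, and transfer
  leads to a contradiction.\<close>

lemma hemb_primary_quotient:
  assumes "fin_group G" "hemb \<sigma> G" "carrier G \<noteq> {\<one>\<^bsub>G\<^esub>}"
  shows "\<exists>S\<in>\<sigma>. \<exists>L. L \<lhd> G \<and> L \<noteq> carrier G \<and> pi_number S (card (carrier G) div card L)"
proof -
  interpret fin_group G by fact
  obtain L where L: "L \<lhd> G" "L \<noteq> carrier G" and max: "\<And>K. K \<lhd> G \<Longrightarrow> K \<noteq> carrier G \<Longrightarrow> card K \<le> card L"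
    using ex_max_subgroup[of "\<lambda>H. H \<lhd> G \<and> H \<noteq> carrier G" "{\<one>\<^bsub>G\<^esub>}"] assms(3) one_is_normal normal_imp_subgroup by metis
  have Ls: "subgroup L G" using L normal_imp_subgroup by blast
  obtain Q :: "('a, 'b) monoid_scheme" and f where "fin_epi G Q f" and ker: "kernel G Q f = L"
    using ex_quotient[OF L(1)] by blast
  then interpret E: fin_epi G Q f by simp
  have cQ: "card (carrier Q) = card (carrier G) div card L"
    using E.card_carrier ker card_subgroup_pos[OF Ls] by simp
  have hQ: "hemb \<sigma> Q" using E.hemb_image[OF assms(2)] .
  have simple: "B = {\<one>\<^bsub>Q\<^esub>} \<or> B = carrier Q" if B: "B \<lhd> Q" for B
  proof -
    have Bs: "subgroup B Q" using B normal_imp_subgroup by blast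
    have LB: "L \<subseteq> E.pre B" using E.ker_subset_pre[OF Bs] ker by simp
    note cB = E.card_pre[OF Bs, unfolded ker]
    show ?thesis
    proof (cases "E.pre B = carrier G")
      case True
      then have "B = carrier Q" using E.image_pre[OF subgroup.subset[OF Bs]] E.surj by simp
      then show ?thesis by simp
    next
      case False
      then have "card (E.pre B) \<le> card L" using max[OF E.normal_pre[OF B]] by simp
      then have "card B \<le> 1" using cB card_subgroup_pos[OF Ls] by simp
      then have "card B = 1" using E.H.card_subgroup_pos[OF Bs] by simp
      then show ?thesis using E.H.card_eq_1_iff[OF Bs] by simp
    qed
  qed
  have Q1: "card (carrier Q) \<noteq> 1"
    using cQ index_1_imp_eq[OF Ls subgroup_self subgroup.subset[OF Ls]] L(2) by auto
  have "\<exists>S\<in>\<sigma>. pi_number S (card (carrier Q))"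
  proof (rule ccontr)
    assume np: "\<not> (\<exists>S\<in>\<sigma>. pi_number S (card (carrier Q)))"
    have subn: "B = {\<one>\<^bsub>Q\<^esub>} \<or> B = carrier Q" if B: "sigma_subnormal \<sigma> Q B" for B
    proof (rule disjCI)
      assume "B \<noteq> carrier Q"
      then obtain F where F: "subgroup F Q" "B \<subseteq> F" "F \<noteq> carrier Q" "sstep \<sigma> Q F (carrier Q)"
        using E.H.sigma_subnormal_last_step[OF B] by metis
      then obtain N where N: "N \<lhd> Q" "N \<subseteq> F" and NE: "N = F \<or> (\<exists>S\<in>\<sigma>. pi_number S (card (carrier Q) div card N))"
        by (auto simp: sstep_def)
      have "N \<noteq> carrier Q" using N(2) F(3) subgroup.subset[OF F(1)] by blast
      then have N1: "N = {\<one>\<^bsub>Q\<^esub>}" using simple[OF N(1)] by simp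
      then have "N = F" using NE np by auto
      moreover have "\<one>\<^bsub>Q\<^esub> \<in> B" using B E.H.sigma_subnormal_iff subgroup.one_closed by metis
      ultimately show "B = {\<one>\<^bsub>Q\<^esub>}" using N1 F(2) by auto
    qed
    define p where "p = (LEAST p. Factorial_Ring.prime p \<and> p dvd card (carrier Q))"
    have "\<exists>p. Factorial_Ring.prime p \<and> p dvd card (carrier Q)" using prime_factor_nat[OF Q1] by blast
    then have p: "Factorial_Ring.prime p" "p dvd card (carrier Q)" unfolding p_def by (metis (mono_tags, lifting) LeastI_ex)+
    have pmin: "p \<le> q" if "Factorial_Ring.prime q" "q dvd card (carrier Q)" for q
      unfolding p_def using that by (intro Least_le) simp
    obtain P where P: "subgroup P Q" "card P = p" using E.H.cauchy[OF p] by blast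
    obtain B where B: "sigma_subnormal \<sigma> Q B" "P \<subseteq> B" 
      "\<forall>S\<in>\<sigma>. pi_number (-S) (card P) \<or> pi_number (-S) (card B div card P)"
      using hQ P(1) unfolding hemb_def by blast
    have "B \<noteq> {\<one>\<^bsub>Q\<^esub>}"
    proof
      assume "B = {\<one>\<^bsub>Q\<^esub>}"
      then have "P = {\<one>\<^bsub>Q\<^esub>}" using B(2) subgroup.one_closed[OF P(1)] by blast
      then have "p = 1" using P(2) by simp
      then show False using p(1) not_prime_1 by blast
    qed
    \<comment> \<open>So P is \<sigma>-Hall in Q itself; hence p divides |Q| exactly once, as
      transfer at the smallest prime requires.\<close>
    then have BQ: "B = carrier Q" using subn[OF B(1)] by simp
    obtain S where S: "S \<in> \<sigma>" "p \<in> S" using block_ex[OF p(1)] by blast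
    have pS: "pi_number S p" using pi_number_prime_power[OF p(1), of 1] S(2) by (auto simp: pi_number_def)
    then have "\<not> pi_number (-S) p" using pi_number_both p(1) by (metis not_prime_1)
    then have "pi_number (-S) (card (carrier Q) div p)" using B(3) S(1) P(2) BQ by auto
    then have "\<not> p dvd card (carrier Q) div p" using p(1) S(2) by (auto simp: pi_number_def primes_of_def)
    then have "\<not> p\<^sup>2 dvd card (carrier Q)"
      using p by (metis dvd_div_iff_mult not_prime_0 power2_eq_square)
    then obtain N where N: "N \<lhd> Q" "card (carrier Q) div card N = p"
      using E.H.normal_subgroup_of_smallest_prime_index[OF p _ pmin] by blast
    have "N \<noteq> carrier Q" using N(2) p(1) E.H.card_carrier_pos by auto
    then have "N = {\<one>\<^bsub>Q\<^esub>}" using simple[OF N(1)] by simp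
    then have "card (carrier Q) = p" using N(2) by simp
    then show False using np S(1) pS by auto
  qed
  then show ?thesis using L cQ by auto
qed

text \<open>For a block S with a proper normal subgroup of S-index in N, the subgroup O^S(N) is
  proper in N and normal in G, hence trivial.\<close>

lemma hemb_min_normal_primary:
  assumes "fin_group G" "hemb \<sigma> G" "N \<lhd> G" "N \<noteq> {\<one>\<^bsub>G\<^esub>}"
    and min: "\<And>W. W \<lhd> G \<Longrightarrow> W \<subseteq> N \<Longrightarrow> W = {\<one>\<^bsub>G\<^esub>} \<or> W = N"
  shows "\<exists>S\<in>\<sigma>. pi_number S (card N)"
proof -
  interpret fin_group G by fact
  have Ns: "subgroup N G" using assms normal_imp_subgroup by blast
  interpret N: fin_group "G\<lparr>carrier := N\<rparr>" by (rule fin_group_subgroup[OF Ns])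
  obtain S L where S: "S \<in> \<sigma>" and L: "L \<lhd> G\<lparr>carrier := N\<rparr>" "L \<noteq> N" "pi_number S (card N div card L)"
    using hemb_primary_quotient[OF N.fin_group_axioms hemb_subgroup[OF assms(2) Ns]] assms(4) by auto
  obtain K where K: "K \<lhd> G\<lparr>carrier := N\<rparr>" "pi_number S (card N div card K)"
    "\<And>L. L \<lhd> G\<lparr>carrier := N\<rparr> \<Longrightarrow> pi_number S (card N div card L) \<Longrightarrow> K \<subseteq> L"
    using N.ex_least_normal_index[of S] by auto
  have KG: "K \<lhd> G" by (rule least_normal_index_in_normal[OF assms(3) K])
  have "K \<subseteq> L" "L \<subseteq> N" using K(3)[OF L(1,3)] normal_in_imp(2)[OF L(1) Ns] by auto
  then have "K = {\<one>\<^bsub>G\<^esub>}" using min[OF KG] L(2) by blast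
  then have "pi_number S (card N)" using K(2) by simp
  then show ?thesis using S by blast
qed

text \<open>
  By induction the claim holds modulo a minimal normal \<open>N\<close> below \<open>K = O\<^sup>S(G)\<close>, so \<open>K\<close> splits
  over the \<open>S\<close>-group \<open>N\<close> with complement \<open>T\<close>.  The normalizer of \<open>T\<close> has \<open>S\<close>-index and
  supplements \<open>K\<close>, hence is all of \<open>G\<close>.
\<close>

lemma hemb_normal_complement:
  assumes "fin_group G" "hemb \<sigma> G" "S \<in> \<sigma>"
    and "K \<lhd> G" "K \<noteq> carrier G" "pi_number S (card (carrier G) div card K)"
  shows "\<exists>T. T \<lhd> G \<and> pi_number (-S) (card T) \<and> pi_number S (card (carrier G) div card T)"
  using assms
proof (induction "card (carrier G)" arbitrary: G K rule: less_induct)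
  case less
  interpret fin_group G by (rule less.prems(1))
  obtain K where K: "K \<lhd> G" "pi_number S (card (carrier G) div card K)"
    and Kmin: "\<And>L. L \<lhd> G \<Longrightarrow> pi_number S (card (carrier G) div card L) \<Longrightarrow> K \<subseteq> L"
    using ex_least_normal_index[of S] by metis
  have Ks: "subgroup K G" using K normal_imp_subgroup by blast
  have Kc: "K \<subseteq> carrier G" using Ks subgroup.subset by blast
  have KG: "K \<noteq> carrier G"
    using Kmin[OF less.prems(4,6)] less.prems(5) subgroup.subset[OF normal_imp_subgroup[OF less.prems(4)]] by blast
  show ?case
  proof (cases "pi_number (-S) (card K)")
    case True then show ?thesis using K by blast
  next
    case False
    then have "K \<noteq> {\<one>\<^bsub>G\<^esub>}" by auto
    then obtain N where N: "N \<lhd> G" "N \<noteq> {\<one>\<^bsub>G\<^esub>}" "N \<subseteq> K" and Nmin: "\<And>W. W \<lhd> G \<Longrightarrow> W \<subseteq> N \<Longrightarrow> W = {\<one>\<^bsub>G\<^esub>} \<or> W = N"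
      using ex_min_normal[OF K(1)] by metis
    have Ns: "subgroup N G" using N normal_imp_subgroup by blast
    \<comment> \<open>The preimage of a normal S-complement of G/N has S-index and so contains K by
      minimality of K.\<close>
    have KN: "pi_number (-S) (card K div card N)"
    proof -
      obtain Q :: "('a, 'b) monoid_scheme" and f where "fin_epi G Q f" and ker: "kernel G Q f = N"
        using ex_quotient[OF N(1)] by blast
      then interpret E: fin_epi G Q f by simp
      have "card N > 1" using card_eq_1_iff[OF Ns] N(2) card_subgroup_pos[OF Ns] by linarith
      then have "card (carrier Q) < card (carrier G)" using E.card_carrier ker E.H.card_carrier_pos by simp
      moreover have "f ` K \<noteq> carrier Q"
      proof
        assume "f ` K = carrier Q"
        then have "E.pre (f ` K) = carrier G" by (auto simp: E.pre_def)
        then show False using E.pre_image[OF Ks] ker N(3) KG by simp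
      qed
      moreover have "card (carrier Q) div card (f ` K) = card (carrier G) div card K"
        using E.index_image[OF Ks subgroup_self] ker N(3) Kc E.surj by simp
      ultimately obtain T where T: "T \<lhd> Q" "pi_number (-S) (card T)" "pi_number S (card (carrier Q) div card T)"
        using less.hyps[of Q "f ` K"] E.fin_group_codom E.hemb_image[OF less.prems(2)] less.prems(3) E.normal_image[OF K(1)] K(2)
        by auto
      have Ts: "subgroup T Q" using T normal_imp_subgroup by blast
      have "card (carrier G) div card (E.pre T) = card (carrier Q) div card T"
        using E.card_pre[OF Ts] E.card_carrier E.card_kernel_pos by simp
      then have "K \<subseteq> E.pre T" using Kmin[OF E.normal_pre[OF T(1)]] T(3) by simp
      then have "f ` K \<subseteq> T" by (auto simp: E.pre_def)
      then have "card (f ` K) dvd card T" using E.H.card_subgroup_dvd_subgroup[OF E.subgroup_image[OF Ks] Ts] by simp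
      moreover have "card (f ` K) = card K div card N" using E.card_image_ker'[OF Ks] ker N(3) card_subgroup_pos[OF Ns] by simp
      ultimately show ?thesis using T(2) pi_number_dvd by metis
    qed
    have cK: "card K = card N * (card K div card N)" using card_index[OF Ns Ks N(3)] .
    \<comment> \<open>N is primary for some block, and this block is S; otherwise |K| would be prime
      to S.\<close>
    have NS: "pi_number S (card N)"
    proof -
      obtain S' where S': "S' \<in> \<sigma>" "pi_number S' (card N)"
        using hemb_min_normal_primary[OF less.prems(1,2) N(1,2) Nmin] by blast
      have "\<not> pi_number (-S) (card N)" using False KN cK pi_number_mult by metis
      then show ?thesis using pi_number_unique[OF S'(1) less.prems(3) S'(2)] S'(2) by simp
    qed
    interpret K: fin_group "G\<lparr>carrier := K\<rparr>" by (rule fin_group_subgroup[OF Ks])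
    have hK: "hemb \<sigma> (G\<lparr>carrier := K\<rparr>)" by (rule hemb_subgroup[OF less.prems(2) Ks])
    have NK: "N \<lhd> G\<lparr>carrier := K\<rparr>" using normal_in_subgroup[OF N(1) Ks N(3)] .
    \<comment> \<open>O^S(K) is normal in G and of S-index there, so it is K again. Hence
      \<open>hemb_normal_Hall\<close> applies to N inside K.\<close>
    have noK: "L = K" if L: "L \<lhd> G\<lparr>carrier := K\<rparr>" "pi_number S (card K div card L)" for L
    proof -
      obtain M where M: "M \<lhd> G\<lparr>carrier := K\<rparr>" "pi_number S (card K div card M)"
        "\<And>L. L \<lhd> G\<lparr>carrier := K\<rparr> \<Longrightarrow> pi_number S (card K div card L) \<Longrightarrow> M \<subseteq> L"
        using K.ex_least_normal_index[of S] by auto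
      have MG: "M \<lhd> G" by (rule least_normal_index_in_normal[OF K(1) M])
      have "card (carrier G) div card M = (card (carrier G) div card K) * (card K div card M)"
        using index_mult[OF normal_imp_subgroup[OF MG] Ks subgroup_self normal_in_imp(2)[OF M(1) Ks] Kc] .
      then have "K \<subseteq> M" using Kmin[OF MG] K(2) M(2) by (simp add: pi_number_mult)
      then show ?thesis using M(3)[OF L] normal_in_imp(2)[OF L(1) Ks] by blast
    qed
    obtain p k where p: "Factorial_Ring.prime p" "card N = p ^ k"
      using hemb_normal_Hall(1)[OF K.fin_group_axioms hK less.prems(3) _ NK NS] noK KN N(2) by auto
    have cop: "coprime (card N) (card K div card N)" using pi_number_coprime[OF NS KN] .
    have solv: "solvable_in (G\<lparr>carrier := K\<rparr>) N"
      using solvable_in_subgroup[OF p_group_solvable_in[OF Ns p] Ks subset_refl N(3)] .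
    obtain T where T0: "subgroup T (G\<lparr>carrier := K\<rparr>)" "card T = card K div card N"
      using schur_zassenhaus_exists[OF K.fin_group_axioms NK] cop by auto
    have T: "subgroup T G" "T \<subseteq> K" using T0 incl_subgroup[OF Ks] subgroup.subset[OF T0(1)] by auto
    have Tc: "T \<subseteq> carrier G" using T Kc by blast
    define A where "A = norm_of T"
    have A: "subgroup A G" "T \<subseteq> A" unfolding A_def using norm_of_subgroup[OF Tc] subset_norm_of[OF T(1)] by auto
    \<comment> \<open>A conjugate of T is again a complement of N in K, hence conjugate to T under
      K: N is a p-group, so complements are conjugate.\<close>
    have KA: "K <#>\<^bsub>G\<^esub> A = carrier G" unfolding A_def
    proof (rule frattini[OF K(1) Tc])
      fix g assume g: "g \<in> carrier G"
      have gT: "conjs g T \<subseteq> K" using conjs_mono[OF T(2)] conjs_normal[OF K(1) g] by blast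
      have gTs: "subgroup (conjs g T) (G\<lparr>carrier := K\<rparr>)" using subgroup_incl[OF conjs_subgroup[OF g T(1)] Ks gT] .
      have "card (conjs g T) = card T" using conjs_card[OF g Tc] .
      then obtain n where "n \<in> K" "K.conjs n T = conjs g T"
        using schur_zassenhaus_conj[OF K.fin_group_axioms NK _ solv T0(1) _ gTs] cop T0(2) by auto
      then show "\<exists>n\<in>K. conjs g T = conjs n T" using conjs_sub[OF Ks] by metis
    qed
    have I: "subgroup (K \<inter> A) G" using subgroups_Inter_pair[OF Ks A(1)] .
    have "card K = card T * card N" using T0(2) cK by (metis mult.commute)
    then have cTN: "card K div card T = card N" using card_subgroup_pos[OF T(1)] by simp
    have "card K div card (K \<inter> A) dvd card K div card T"
      by (rule index_dvd_mono(2)[OF T(1) I Ks]) (use T A in auto)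
    then have "pi_number S (card (carrier G) div card A)"
      using index_set_mult_normal'[OF K(1) A(1) KA] cTN NS pi_number_dvd by metis
    \<comment> \<open>Otherwise |G : K| = |A : K \<inter> A| would be prime to S as well as an
      S-number, and K would be G.\<close>
    moreover have "\<not> pi_number (-S) (card A)"
    proof
      assume "pi_number (-S) (card A)"
      moreover have "card A div card (K \<inter> A) dvd card A" using card_index[OF I A(1)] by (metis dvd_triv_right inf_le2)
      ultimately have "pi_number (-S) (card (carrier G) div card K)"
        using index_set_mult_normal[OF less.prems(1) K(1) A(1) KA] pi_number_dvd by metis
      then have "card (carrier G) div card K = 1" using K(2) pi_number_both by blast
      then show False using index_1_imp_eq[OF Ks subgroup_self Kc] KG by blast
    qed
    \<comment> \<open>A proper A would lie in a proper subgroup that also contains K, contrary to K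
      A = G.\<close>
    ultimately have AG: "A = carrier G"
    proof (rule_tac ccontr)
      assume a: "pi_number S (card (carrier G) div card A)" "\<not> pi_number (-S) (card A)" "A \<noteq> carrier G"
      obtain E L where E: "subgroup E G" "A \<subseteq> E" "E \<noteq> carrier G" "L \<lhd> G" "L \<subseteq> E" "pi_number S (card (carrier G) div card L)"
        using hemb_index[OF less.prems(1-3) A(1) a] by metis
      have "K \<subseteq> E" using Kmin[OF E(4,6)] E(5) by blast
      then have "carrier G \<subseteq> E" using set_mult_subset_subgroup[OF E(1) _ E(2)] KA by blast
      then show False using E(3) subgroup.subset[OF E(1)] by blast
    qed
    then have Tn: "T \<lhd> G" using norm_of_eq_carrier_iff[OF T(1)] A_def by simp
    have "card (carrier G) div card T = (card (carrier G) div card K) * card N"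
      using index_mult[OF T(1) Ks subgroup_self T(2) Kc] cTN by simp
    then have "pi_number S (card (carrier G) div card T)" using K(2) NS by (simp add: pi_number_mult)
    then show ?thesis using Tn T0(2) KN by auto
  qed
qed

end

section \<open>From embedded subgroups to \<open>H\<sigma>E\<close>-groups\<close>

context fin_group begin

text \<open>A normal Hall subgroup is invariant under every automorphism: the index of V \<inter>
  gVg^-1 in gVg^-1 divides both |V| and |T : V|.\<close>

lemma normal_Hall_trans:
  assumes "T \<lhd> G" "V \<lhd> G\<lparr>carrier := T\<rparr>" "coprime (card V) (card T div card V)"
  shows "V \<lhd> G"
proof -
  have Ts: "subgroup T G" using assms normal_imp_subgroup by blast
  note V = normal_in_imp[OF assms(2) Ts]
  have Vc: "V \<subseteq> carrier G" using V(1) subgroup.subset by blast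
  have "conjs g V = V" if g: "g \<in> carrier G" for g
  proof -
    let ?W = "conjs g V"
    have W: "?W \<lhd> G\<lparr>carrier := T\<rparr>" by (rule conjs_normal_in[OF assms(1,2) g])
    note W' = normal_in_imp[OF W Ts]
    have c: "card ?W = card V" using conjs_card[OF g Vc] .
    have I: "subgroup (V \<inter> ?W) G" using subgroups_Inter_pair V(1) W'(1) by blast
    have "card ?W div card (V \<inter> ?W) dvd card T div card V"
      by (rule index_Int_dvd_in[OF assms(2) Ts W'(1,2)])
    moreover have "card ?W div card (V \<inter> ?W) dvd card V" 
      using card_index[OF I W'(1)] c by (metis dvd_triv_right inf_le2)
    ultimately have "card ?W div card (V \<inter> ?W) = 1" using assms(3) by (metis coprime_common_divisor_nat)
    then have "V \<inter> ?W = ?W" using index_1_imp_eq[OF I W'(1)] by simp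
    then have "?W \<subseteq> V" by blast
    then show ?thesis using c finite_subgroup[OF V(1)] by (metis card_subset_eq)
  qed
  then have "norm_of V = carrier G" by (auto simp: norm_of_def)
  then show ?thesis using norm_of_eq_carrier_iff[OF V(1)] by simp
qed

end

section \<open>Sylow towers\<close>

definition tower_series :: "('a, 'b) monoid_scheme \<Rightarrow> nat \<Rightarrow> (nat \<Rightarrow> 'a set) \<Rightarrow> bool" where
  "tower_series G t C \<longleftrightarrow> C 0 = {\<one>\<^bsub>G\<^esub>} \<and> C t = carrier G \<and>
     (\<forall>i\<le>t. C i \<lhd> G \<and> coprime (card (C i)) (card (carrier G) div card (C i))) \<and>
     (\<forall>i<t. C i \<subset> C (Suc i) \<and> (\<exists>p\<in>primes_of (card (carrier G)).
        card (C (Suc i)) div card (C i) = p ^ multiplicity p (card (carrier G))))"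

context fin_group begin

lemma sylow_subgroup_card_iff:
  "(\<exists>p P. sylow_subgroup p G P \<and> n = card P) \<longleftrightarrow>
   (\<exists>p\<in>primes_of (card (carrier G)). n = p ^ multiplicity p (card (carrier G)))"
proof
  assume "\<exists>p\<in>primes_of (card (carrier G)). n = p ^ multiplicity p (card (carrier G))"
  then obtain p where p: "p \<in> primes_of (card (carrier G))" "n = p ^ multiplicity p (card (carrier G))" by blast
  then have "Factorial_Ring.prime p" by (simp add: primes_of_def)
  then obtain P where P: "subgroup P G" "card P = p ^ multiplicity p (card (carrier G))" using sylow_exists by metis
  then have "sylow_subgroup p G P" using p by (simp add: sylow_subgroup_def order_def)
  moreover have "n = card P" using p P by simp
  ultimately show "\<exists>p P. sylow_subgroup p G P \<and> n = card P" by blast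
qed (auto simp: sylow_subgroup_def order_def)

text \<open>Factors of Sylow order force each term to be a Hall subgroup, which is the extra clause
  of \<open>tower_series\<close>. This clause makes the terms characteristic, so a tower of a normal
  subgroup consists of normal subgroups of the whole group.\<close>

lemma has_Sylow_tower_iff: "has_Sylow_tower G \<longleftrightarrow> (\<exists>t C. tower_series G t C)"
proof -
  have ord: "order (G\<lparr>carrier := B\<rparr> Mod A) = card B div card A" if "A \<lhd> G" "B \<lhd> G" "A \<subseteq> B" for A B
  proof -
    have B: "subgroup B G" using that normal_imp_subgroup by blast
    show ?thesis using fin_group.order_Mod[OF fin_group_subgroup[OF B] normal_in_subgroup[OF that(1) B that(3)]] by simp
  qed
  have 1: "has_Sylow_tower G" if C: "tower_series G t C" for t C
    unfolding has_Sylow_tower_def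
  proof (rule exI[of _ t], rule exI[of _ C], intro conjI allI impI)
    fix i assume i: "i < t"
    then show "C i \<subset> C (Suc i)" using C by (simp add: tower_series_def)
    have s: "C i \<lhd> G" "C (Suc i) \<lhd> G" "C i \<subseteq> C (Suc i)" using C i by (auto simp: tower_series_def)
    show "\<exists>p P. sylow_subgroup p G P \<and> order (G\<lparr>carrier := C (Suc i)\<rparr> Mod C i) = card P"
      unfolding sylow_subgroup_card_iff ord[OF s] using C i by (simp add: tower_series_def)
  qed (use C in \<open>auto simp: tower_series_def\<close>)
  have 2: "\<exists>t C. tower_series G t C" if tow: "has_Sylow_tower G"
  proof -
    obtain t C where C': "C 0 = {\<one>} \<and> C t = carrier G \<and> (\<forall>i\<le>t. C i \<lhd> G) \<and> (\<forall>i<t. C i \<subset> C (Suc i) \<and>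
        (\<exists>p P. sylow_subgroup p G P \<and> order (G\<lparr>carrier := C (Suc i)\<rparr> Mod C i) = card P))"
      using tow[unfolded has_Sylow_tower_def] by (elim exE)
    have C: "C 0 = {\<one>}" "C t = carrier G" "\<And>i. i \<le> t \<Longrightarrow> C i \<lhd> G" "\<And>i. i < t \<Longrightarrow> C i \<subset> C (Suc i)"
      "\<And>i. i < t \<Longrightarrow> \<exists>p P. sylow_subgroup p G P \<and> order (G\<lparr>carrier := C (Suc i)\<rparr> Mod C i) = card P"
      using C' by (simp_all del: ex_simps)
    have Cs: "subgroup (C i) G" if "i \<le> t" for i using C(3)[OF that] normal_imp_subgroup by blast
    have fac: "\<exists>p\<in>primes_of (card (carrier G)). card (C (Suc i)) div card (C i) = p ^ multiplicity p (card (carrier G))"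
      if "i < t" for i
    proof -
      have s: "C i \<lhd> G" "C (Suc i) \<lhd> G" "C i \<subseteq> C (Suc i)"
        using C(3)[of i] C(3)[of "Suc i"] C(4)[OF that] that by auto
      show ?thesis using C(5)[OF that] unfolding sylow_subgroup_card_iff ord[OF s] .
    qed
    have mono: "C i \<subseteq> C j" if "i \<le> j" "j \<le> t" for i j
      using that
    proof (induction j rule: dec_induct)
      case (step n)
      then show ?case using C(4)[of n] by auto
    qed simp
    \<comment> \<open>A factor divisible by q is the whole q-part of |G|, so the index between two
      terms contains this q-part as soon as q divides it.\<close>
    have full: "q ^ multiplicity q (card (carrier G)) dvd card (C j) div card (C i)"
      if "i \<le> j" "j \<le> t" "Factorial_Ring.prime q" "q dvd card (C j) div card (C i)" for i j q
      using that
    proof (induction j rule: dec_induct)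
      case base
      then show ?case using card_subgroup_pos[OF Cs, of i] by simp
    next
      case (step j)
      have e: "card (C (Suc j)) div card (C i) = (card (C (Suc j)) div card (C j)) * (card (C j) div card (C i))"
        by (rule index_mult) (use Cs step.prems step.hyps mono in auto)
      obtain p where p: "Factorial_Ring.prime p" "card (C (Suc j)) div card (C j) = p ^ multiplicity p (card (carrier G))"
        using fac[of j] step.prems by (auto simp: primes_of_def)
      have "q dvd p ^ multiplicity p (card (carrier G)) \<or> q dvd card (C j) div card (C i)"
        using step.prems e p by (simp add: prime_dvd_mult_iff)
      then show ?case
      proof
        assume "q dvd p ^ multiplicity p (card (carrier G))"
        then have "q = p" using p(1) step.prems by (metis prime_dvd_power primes_dvd_imp_eq)
        then show ?thesis using e p by simp
      next
        assume "q dvd card (C j) div card (C i)"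
        then show ?thesis using step e by simp
      qed
    qed
    \<comment> \<open>A common prime divisor would occur with its full multiplicity m both in the
      order and in the index, so that 2 m \<le> m although m > 0.\<close>
    have cop: "coprime (card (C i)) (card (carrier G) div card (C i))" if i: "i \<le> t" for i
    proof (rule ccontr)
      assume "\<not> ?thesis"
      then obtain q where q: "Factorial_Ring.prime q" "q dvd card (C i)" "q dvd card (carrier G) div card (C i)"
        using prime_factor_nat[of "gcd (card (C i)) (card (carrier G) div card (C i))"] by (auto simp: coprime_iff_gcd_eq_1)
      let ?m = "multiplicity q (card (carrier G))"
      have cG: "card (carrier G) = card (C i) * (card (carrier G) div card (C i))" 
        using card_subgroup_dvd[OF Cs[OF i]] by simp
      have "q ^ ?m dvd card (C i)" using full[of 0 i q] i q C(1) by simp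
      moreover have "q ^ ?m dvd card (carrier G) div card (C i)" using full[of i t q] i q C(2) by simp
      ultimately have "q ^ ?m * q ^ ?m dvd card (carrier G)" using cG by (metis mult_dvd_mono)
      then have "q ^ (?m + ?m) dvd card (carrier G)" by (simp add: power_add)
      moreover have nu: "\<not> is_unit q" using q(1) not_prime_unit by blast
      moreover have "card (carrier G) \<noteq> 0" using card_carrier_pos by simp
      ultimately have "?m + ?m \<le> ?m" by (metis multiplicity_geI)
      moreover have "?m > 0" using q cG card_carrier_pos by (metis dvd_mult2 multiplicity_gt_zero_iff not_prime_unit less_numeral_extra(3))
      ultimately show False by simp
    qed
    show ?thesis
      unfolding tower_series_def using C fac cop by (intro exI[of _ t] exI[of _ C]) blast
  qed
  show ?thesis using 1 2 by blast
qed

section \<open>Centralizers of factors, and complements\<close>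

lemma factor_centralizer_normal:
  assumes "H \<lhd> G" "K \<lhd> G" "K \<subseteq> H"
  shows "factor_centralizer G H K \<lhd> G"
proof -
  interpret K: normal K G by fact
  have Hc: "h \<in> carrier G" if "h \<in> H" for h using that assms(1) normal_imp_subgroup subgroup.mem_carrier by metis
  have Hn: "g \<otimes> h \<otimes> inv g \<in> H" if "g \<in> carrier G" "h \<in> H" for g h
    using that assms(1) by (simp add: normal_iff)
  let ?C = "factor_centralizer G H K"
  have Cc: "g \<in> carrier G" if "g \<in> ?C" for g using that by (simp add: factor_centralizer_def)
  have kk: "K #> (g \<otimes> x \<otimes> inv g) = K #> (g \<otimes> y \<otimes> inv g)" 
    if "K #> x = K #> y" "g \<in> carrier G" "x \<in> carrier G" "y \<in> carrier G" for g x y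
  proof -
    interpret E: fin_epi G "G Mod K" "\<lambda>g. K #> g" using fin_epi_Mod[OF assms(2)] by simp
    show ?thesis using E.hom_mult[of "g \<otimes> x" "inv g"] E.hom_mult[of g x] E.hom_mult[of "g \<otimes> y" "inv g"] E.hom_mult[of g y] that
      by (simp del: mult_FactGroup E.hom_mult)
  qed
  have C: "K #> (g \<otimes> h \<otimes> inv g) = K #> h" if "g \<in> ?C" "h \<in> H" for g h
    using that by (simp add: factor_centralizer_def)
  have one: "\<one> \<in> ?C" using Hc by (simp add: factor_centralizer_def)
  have mult: "a \<otimes> b \<in> ?C" if a: "a \<in> ?C" and b: "b \<in> ?C" for a b
  proof -
    have "K #> ((a \<otimes> b) \<otimes> h \<otimes> inv (a \<otimes> b)) = K #> h" if h: "h \<in> H" for h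
    proof -
      have "(a \<otimes> b) \<otimes> h \<otimes> inv (a \<otimes> b) = a \<otimes> (b \<otimes> h \<otimes> inv b) \<otimes> inv a"
        using conj_conj[OF Cc[OF a] Cc[OF b] Hc[OF h]] by simp
      then show ?thesis using C[OF a Hn[OF Cc[OF b] h]] C[OF b h] by simp
    qed
    then show ?thesis using Cc a b by (simp add: factor_centralizer_def)
  qed
  have conj: "x \<otimes> a \<otimes> inv x \<in> ?C" if x: "x \<in> carrier G" and a: "a \<in> ?C" for x a
  proof -
    have "K #> ((x \<otimes> a \<otimes> inv x) \<otimes> h \<otimes> inv (x \<otimes> a \<otimes> inv x)) = K #> h" if h: "h \<in> H" for h
    proof -
      let ?h = "inv x \<otimes> h \<otimes> x"
      have hH: "?h \<in> H" using Hn[of "inv x" h] x h by simp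
      have "(x \<otimes> a \<otimes> inv x) \<otimes> h \<otimes> inv (x \<otimes> a \<otimes> inv x) = x \<otimes> (a \<otimes> ?h \<otimes> inv a) \<otimes> inv x"
        using x Cc[OF a] Hc[OF h] by (simp add: inv_mult_group m_assoc mult_inv_cancel)
      moreover have "K #> (x \<otimes> (a \<otimes> ?h \<otimes> inv a) \<otimes> inv x) = K #> (x \<otimes> ?h \<otimes> inv x)"
        by (rule kk[OF C[OF a hH] x]) (use x Cc[OF a] Hc[OF hH] in auto)
      moreover have "x \<otimes> ?h \<otimes> inv x = h" using x Hc[OF h] by (simp add: m_assoc mult_inv_cancel)
      ultimately show ?thesis by simp
    qed
    then show ?thesis using x Cc[OF a] by (simp add: factor_centralizer_def)
  qed
  have inv: "inv a \<in> ?C" if a: "a \<in> ?C" for a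
  proof -
    have "K #> (inv a \<otimes> h \<otimes> inv (inv a)) = K #> h" if h: "h \<in> H" for h
    proof -
      have "K #> (inv a \<otimes> (a \<otimes> h \<otimes> inv a) \<otimes> inv (inv a)) = K #> (inv a \<otimes> h \<otimes> inv (inv a))"
        by (rule kk[OF C[OF a h]]) (use Cc[OF a] Hc[OF h] in auto)
      moreover have "inv a \<otimes> (a \<otimes> h \<otimes> inv a) \<otimes> inv (inv a) = h"
        using Cc[OF a] Hc[OF h] by (simp add: m_assoc mult_inv_cancel)
      ultimately show ?thesis by simp
    qed
    then show ?thesis using Cc[OF a] by (simp add: factor_centralizer_def)
  qed
  have "subgroup ?C G" by (rule subgroupI) (use Cc one mult inv in auto)
  then show ?thesis unfolding normal_iff using conj by blast
qed

text \<open>Being \<sigma>-primary is read off the order, and a semidirect product has the product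
  of the two orders.\<close>

lemma sigma_central_factor_iff:
  assumes "H \<lhd> G" "K \<lhd> G" "K \<subseteq> H"
  shows "sigma_central_factor \<sigma> G H K \<longleftrightarrow>
    (\<exists>S\<in>\<sigma>. pi_number S (card H div card K) \<and> pi_number S (card (carrier G) div card (factor_centralizer G H K)))"
proof -
  have Hs: "subgroup H G" using assms normal_imp_subgroup by blast
  interpret H: fin_group "G\<lparr>carrier := H\<rparr>" by (rule fin_group_subgroup[OF Hs])
  have "card (carrier (G\<lparr>carrier := H\<rparr> Mod K)) = card H div card K"
    using H.order_Mod[OF normal_in_subgroup[OF assms(2) Hs assms(3)]] by (simp add: order_def)
  moreover have "card (carrier (G Mod factor_centralizer G H K)) = card (carrier G) div card (factor_centralizer G H K)"
    using order_Mod[OF factor_centralizer_normal[OF assms]] by (simp add: order_def)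
  ultimately have "order (semidirect_product (G\<lparr>carrier := H\<rparr> Mod K) (G Mod factor_centralizer G H K) (coset_conj G))
    = (card H div card K) * (card (carrier G) div card (factor_centralizer G H K))"
    by (simp add: order_def semidirect_product_def card_cartesian_product)
  then show ?thesis unfolding sigma_central_factor_def sigma_primary_def pi_number_def[symmetric]
    by (simp add: pi_number_mult)
qed

lemma conj_invariant_iff:
  assumes "M \<subseteq> carrier G" "R \<subseteq> carrier G"
  shows "conj_invariant G M R \<longleftrightarrow> M \<subseteq> norm_of R"
proof -
  have "(m <# R) #> inv m = conjs m R" if "m \<in> M" for m using conjs_eq_coset[OF subsetD[OF assms(1) that] assms(2)] .
  then show ?thesis using assms(1) unfolding conj_invariant_def norm_of_def by auto
qed

lemma complement_props:
  assumes "D \<lhd> G" "coprime (card D) (card (carrier G) div card D)"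
    "subgroup M G" "card M = card (carrier G) div card D"
  shows "D \<inter> M = {\<one>}" "D <#> M = carrier G"
proof -
  have Ds: "subgroup D G" using assms normal_imp_subgroup by blast
  have I: "subgroup (D \<inter> M) G" using subgroups_Inter_pair[OF Ds assms(3)] .
  have "card (D \<inter> M) dvd card D" "card (D \<inter> M) dvd card M"
    using card_subgroup_dvd_subgroup I Ds assms(3) by auto
  then have "card (D \<inter> M) = 1" using assms(2,4) by (metis coprime_common_divisor_nat)
  then show i: "D \<inter> M = {\<one>}" using card_eq_1_iff[OF I] by simp
  have "card (D <#> M) = card D * card M" using card_set_mult_normal(1)[OF assms(1,3)] i by simp
  also have "\<dots> = card (carrier G)" using assms(4) card_subgroup_dvd[OF Ds] by simp
  finally show "D <#> M = carrier G"
    using card_set_mult_normal(2)[OF assms(1,3)] card_eq_imp_eq subgroup_self subgroup.subset by metis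
qed

end

section \<open>The part of G belonging to one block\<close>

context prime_partition begin

text \<open>Sending a prime to its block maps \<pi>(n) onto \<sigma>(n), so the two finite sets have
  the same size iff the map is injective.\<close>

lemma card_sigma_of_iff:
  assumes "n > 0"
  shows "card (sigma_of \<sigma> n) = card (primes_of n) \<longleftrightarrow>
    (\<forall>S\<in>\<sigma>. \<forall>p\<in>S. \<forall>q\<in>S. p \<in> primes_of n \<longrightarrow> q \<in> primes_of n \<longrightarrow> p = q)"
proof -
  define blk where "blk p = (THE S. S \<in> \<sigma> \<and> p \<in> S)" for p
  have blk: "blk p = S" if "S \<in> \<sigma>" "p \<in> S" for p S
    unfolding blk_def using that block_unique by (intro the_equality) auto
  have "sigma_of \<sigma> n = blk ` primes_of n"
  proof (intro equalityI subsetI)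
    fix S assume "S \<in> sigma_of \<sigma> n"
    then obtain p where "S \<in> \<sigma>" "p \<in> S" "p \<in> primes_of n" by (auto simp: sigma_of_def)
    then show "S \<in> blk ` primes_of n" using blk by (metis imageI)
  next
    fix S assume "S \<in> blk ` primes_of n"
    then obtain p where p: "p \<in> primes_of n" "S = blk p" by blast
    then obtain T where "T \<in> \<sigma>" "p \<in> T" using block_ex[of p] by (auto simp: primes_of_def)
    then show "S \<in> sigma_of \<sigma> n" using p blk by (auto simp: sigma_of_def)
  qed
  then have "card (sigma_of \<sigma> n) = card (primes_of n) \<longleftrightarrow> inj_on blk (primes_of n)"
    using finite_primes_of[OF assms] by (metis card_image eq_card_imp_inj_on)
  also have "\<dots> \<longleftrightarrow> (\<forall>S\<in>\<sigma>. \<forall>p\<in>S. \<forall>q\<in>S. p \<in> primes_of n \<longrightarrow> q \<in> primes_of n \<longrightarrow> p = q)"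
  proof
    assume inj: "inj_on blk (primes_of n)"
    show "\<forall>S\<in>\<sigma>. \<forall>p\<in>S. \<forall>q\<in>S. p \<in> primes_of n \<longrightarrow> q \<in> primes_of n \<longrightarrow> p = q"
      using inj blk by (metis inj_onD)
  next
    assume a: "\<forall>S\<in>\<sigma>. \<forall>p\<in>S. \<forall>q\<in>S. p \<in> primes_of n \<longrightarrow> q \<in> primes_of n \<longrightarrow> p = q"
    show "inj_on blk (primes_of n)"
    proof (rule inj_onI)
      fix p q assume pq: "p \<in> primes_of n" "q \<in> primes_of n" "blk p = blk q"
      obtain S T where S: "S \<in> \<sigma>" "p \<in> S" and T: "T \<in> \<sigma>" "q \<in> T"
        using block_ex[of p] block_ex[of q] pq by (auto simp: primes_of_def)
      then have "S = T" using blk[OF S] blk[OF T] pq by simp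
      then show "p = q" using a S T pq by blast
    qed
  qed
  finally show ?thesis .
qed

lemma hemb_normal_Hall_complement:
  assumes "fin_group G" "hemb \<sigma> G" "carrier G \<noteq> {\<one>\<^bsub>G\<^esub>}"
  obtains S T where "S \<in> \<sigma>" "T \<lhd> G" "T \<noteq> carrier G" "pi_number (-S) (card T)" "pi_number S (card (carrier G) div card T)"
proof -
  interpret fin_group G by fact
  obtain S L where S: "S \<in> \<sigma>" and L: "L \<lhd> G" "L \<noteq> carrier G" "pi_number S (card (carrier G) div card L)"
    using hemb_primary_quotient[OF assms] by blast
  obtain T where T: "T \<lhd> G" "pi_number (-S) (card T)" "pi_number S (card (carrier G) div card T)"
    using hemb_normal_complement[OF assms(1,2) S L] by blast
  have Ls: "subgroup L G" using L normal_imp_subgroup by blast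
  have "T \<noteq> carrier G"
  proof
    assume "T = carrier G"
    moreover have "card (carrier G) div card L dvd card (carrier G)"
      using card_index[OF Ls subgroup_self subgroup.subset[OF Ls]] by (metis dvd_triv_right)
    ultimately have "card (carrier G) div card L = 1"
      using L(3) T(2) pi_number_dvd pi_number_both by blast
    then show False using index_1_imp_eq[OF Ls subgroup_self subgroup.subset[OF Ls]] L(2) by blast
  qed
  then show ?thesis using that S T by blast
qed

text \<open>The S-part of G is located in a single factor U/V between normal Hall subgroups. One
  descends along normal complements until the block S occurs; Hall subgroups normal in T remain
  normal in G.\<close>

lemma hemb_layer:
  assumes "fin_group G" "hemb \<sigma> G" "S \<in> \<sigma>"
  shows "\<exists>V U. V \<lhd> G \<and> U \<lhd> G \<and> V \<subseteq> U \<and> pi_number (-S) (card V) \<and> pi_number S (card U div card V) \<and>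
    pi_number (-S) (card (carrier G) div card U) \<and> coprime (card V) (card (carrier G) div card V) \<and>
    coprime (card U) (card (carrier G) div card U)"
  using assms
proof (induction "card (carrier G)" arbitrary: G rule: less_induct)
  case less
  interpret fin_group G by (rule less.prems(1))
  show ?case
  proof (cases "carrier G = {\<one>\<^bsub>G\<^esub>}")
    case True
    then have c: "card (carrier G) = 1" by simp
    show ?thesis by (rule exI[of _ "carrier G"], rule exI[of _ "carrier G"]) (use c normal_self in auto)
  next
    case False
    obtain S' T where S': "S' \<in> \<sigma>" and T: "T \<lhd> G" "T \<noteq> carrier G" "pi_number (-S') (card T)" "pi_number S' (card (carrier G) div card T)"
      using hemb_normal_Hall_complement[OF less.prems(1,2) False] by metis
    have Ts: "subgroup T G" using T normal_imp_subgroup by blast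
    have Tc: "T \<subseteq> carrier G" using Ts subgroup.subset by blast
    show ?thesis
    proof (cases "S' = S")
      case True
      then have "coprime (card T) (card (carrier G) div card T)" 
        using T pi_number_coprime by (metis coprime_commute)
      then show ?thesis using T True normal_self Tc card_carrier_pos
        by (intro exI[of _ T] exI[of _ "carrier G"]) simp
    next
      case False
      interpret T: fin_group "G\<lparr>carrier := T\<rparr>" by (rule fin_group_subgroup[OF Ts])
      have "card T < card (carrier G)" using T(2) Tc fin by (metis psubsetI psubset_card_mono)
      then obtain V U where VU: "V \<lhd> G\<lparr>carrier := T\<rparr>" "U \<lhd> G\<lparr>carrier := T\<rparr>" "V \<subseteq> U" 
        "pi_number (-S) (card V)" "pi_number S (card U div card V)"
        "pi_number (-S) (card T div card U)" "coprime (card V) (card T div card V)" "coprime (card U) (card T div card U)"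
        using less.hyps[of "G\<lparr>carrier := T\<rparr>"] T.fin_group_axioms hemb_subgroup[OF less.prems(2) Ts] less.prems(3) by auto
      have n: "V \<lhd> G" "U \<lhd> G" using normal_Hall_trans[OF T(1)] VU by auto
      have hall: "coprime (card W) (card (carrier G) div card W)" and ind: "card (carrier G) div card W = (card (carrier G) div card T) * (card T div card W)"
        if W: "W \<lhd> G\<lparr>carrier := T\<rparr>" "coprime (card W) (card T div card W)" for W
      proof -
        note W' = normal_in_imp(1,2)[OF W(1) Ts]
        show ind: "card (carrier G) div card W = (card (carrier G) div card T) * (card T div card W)"
          using index_mult[OF W'(1) Ts subgroup_self W'(2) Tc] .
        have "pi_number (-S') (card W)" using T(3) card_subgroup_dvd_subgroup[OF W'(1) Ts W'(2)] pi_number_dvd by blast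
        then have "coprime (card W) (card (carrier G) div card T)"
          using pi_number_coprime[OF T(4)] by (simp add: coprime_commute)
        then show "coprime (card W) (card (carrier G) div card W)" using ind W(2) by simp
      qed
      have "pi_number (-S) (card (carrier G) div card U)"
        using ind[OF VU(2,8)] VU(6) pi_number_other[OF S' less.prems(3) False T(4)] by (simp add: pi_number_mult)
      then show ?thesis using n VU hall by blast
    qed
  qed
qed

text \<open>Modulo V the layer U/V is a normal Hall S-subgroup, and by
  \<open>hemb_normal_Hall\<close> it is trivial or a minimal normal p-subgroup. Hence S contributes
  at most one prime, and a normal subgroup takes all of the S-part or none.\<close>

lemma hemb_block_part:
  assumes "fin_group G" "hemb \<sigma> G" "S \<in> \<sigma>"
    and no: "\<And>L. L \<lhd> G \<Longrightarrow> pi_number S (card (carrier G) div card L) \<Longrightarrow> L = carrier G"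
  shows "p \<in> S \<Longrightarrow> q \<in> S \<Longrightarrow> p \<in> primes_of (card (carrier G)) \<Longrightarrow> q \<in> primes_of (card (carrier G)) \<Longrightarrow> p = q"
    and "W \<lhd> G \<Longrightarrow> pi_number (-S) (card W) \<or> pi_number (-S) (card (carrier G) div card W)"
proof -
  interpret fin_group G by fact
  obtain V U where VU: "V \<lhd> G" "U \<lhd> G" "V \<subseteq> U" "pi_number (-S) (card V)" "pi_number S (card U div card V)"
    "pi_number (-S) (card (carrier G) div card U)" using hemb_layer[OF assms(1-3)] by blast
  have s: "subgroup V G" "subgroup U G" using VU normal_imp_subgroup by auto
  have Uc: "U \<subseteq> carrier G" using s subgroup.subset by blast
  have cU: "card U = card V * (card U div card V)" using card_index[OF s VU(3)] .
  have cG: "card (carrier G) = card U * (card (carrier G) div card U)" using card_index[OF s(2) subgroup_self Uc] .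
  obtain Q :: "('a, 'b) monoid_scheme" and f where "fin_epi G Q f" and ker: "kernel G Q f = V"
    using ex_quotient[OF VU(1)] by blast
  then interpret E: fin_epi G Q f by simp
  let ?N = "f ` U"
  have N: "?N \<lhd> Q" using E.normal_image[OF VU(2)] .
  have cN: "card ?N = card U div card V" 
    using E.card_image_ker'[OF s(2)] ker VU(3) card_subgroup_pos[OF s(1)] by simp
  have iN: "card (carrier Q) div card ?N = card (carrier G) div card U"
    using E.index_image[OF s(2) subgroup_self] ker VU(3) Uc E.surj by simp
  have noQ: "L = carrier Q" if L: "L \<lhd> Q" "pi_number S (card (carrier Q) div card L)" for L
  proof -
    have Ls: "subgroup L Q" using L normal_imp_subgroup by blast
    have "card (carrier G) div card (E.pre L) = card (carrier Q) div card L"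
      using E.card_pre[OF Ls] E.card_carrier E.card_kernel_pos by simp
    then have "E.pre L = carrier G" using no[OF E.normal_pre[OF L(1)]] L(2) by simp
    then show ?thesis using E.image_pre[OF subgroup.subset[OF Ls]] E.surj by simp
  qed
  have N1: "?N = {\<one>\<^bsub>Q\<^esub>} \<or> ((\<exists>p k. Factorial_Ring.prime p \<and> card ?N = p ^ k) \<and> (\<forall>W. W \<lhd> Q \<longrightarrow> W \<subseteq> ?N \<longrightarrow> W = {\<one>\<^bsub>Q\<^esub>} \<or> W = ?N))"
  proof (cases "?N = {\<one>\<^bsub>Q\<^esub>}")
    case False
    have "pi_number S (card ?N)" "pi_number (-S) (card (carrier Q) div card ?N)" using cN iN VU(5,6) by simp_all
    from hemb_normal_Hall[OF E.fin_group_codom E.hemb_image[OF assms(2)] assms(3) noQ N this False]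
    show ?thesis by blast
  qed simp
  show "p = q" if "p \<in> S" "q \<in> S" "p \<in> primes_of (card (carrier G))" "q \<in> primes_of (card (carrier G))" for p q
  proof -
    have d: "r \<in> primes_of (card ?N)" if "r \<in> S" "r \<in> primes_of (card (carrier G))" for r
    proof -
      have "r \<notin> primes_of (card V)" "r \<notin> primes_of (card (carrier G) div card U)"
        using that VU(4,6) by (auto simp: pi_number_def)
      moreover have "primes_of (card (carrier G)) = primes_of (card V) \<union> primes_of (card ?N) \<union> primes_of (card (carrier G) div card U)"
        using cU cG cN by (metis primes_of_mult)
      ultimately show ?thesis using that by blast
    qed
    have "primes_of (card ?N) = {} \<or> (\<exists>r. primes_of (card ?N) \<subseteq> {r})"
      using N1
    proof (elim disjE conjE exE)
      fix p k assume "Factorial_Ring.prime p" "card ?N = p ^ k"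
      then show ?thesis using pi_number_prime_power[of p k] by (auto simp: pi_number_def)
    qed simp
    then show ?thesis using d that by blast
  qed
  show "pi_number (-S) (card W) \<or> pi_number (-S) (card (carrier G) div card W)" if W: "W \<lhd> G" for W
  proof -
    have Ws: "subgroup W G" using W normal_imp_subgroup by blast
    have fW: "f ` W \<lhd> Q" "subgroup (f ` W) Q" using E.normal_image[OF W] E.subgroup_image[OF Ws] by auto
    have WV: "subgroup (W \<inter> V) G" using subgroups_Inter_pair[OF Ws s(1)] .
    have cW: "card W = card (f ` W) * card (W \<inter> V)" using E.card_image_ker[OF Ws] ker by simp
    \<comment> \<open>Minimality decides: if U/V meets the image of W trivially, |W| is prime to S;
      otherwise it lies in that image and |G : W| is prime to S.\<close>
    have "?N \<inter> f ` W = {\<one>\<^bsub>Q\<^esub>} \<or> ?N \<inter> f ` W = ?N"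
    proof (cases "?N = {\<one>\<^bsub>Q\<^esub>}")
      case True
      then show ?thesis using subgroup.one_closed[OF fW(2)] by auto
    next
      case False
      then show ?thesis using N1 E.H.normal_Int[OF N fW(1)] by blast
    qed
    then show ?thesis
    proof
      assume i: "?N \<inter> f ` W = {\<one>\<^bsub>Q\<^esub>}"
      have "card (f ` W) dvd card (carrier Q) div card ?N" using E.H.index_Int_dvd[OF N fW(2)] i by simp
      then have "pi_number (-S) (card (f ` W))" using iN VU(6) pi_number_dvd by metis
      moreover have "card (W \<inter> V) dvd card V" using card_subgroup_dvd_subgroup[OF WV s(1)] by simp
      then have "pi_number (-S) (card (W \<inter> V))" using VU(4) pi_number_dvd by blast
      ultimately show ?thesis using cW by (simp add: pi_number_mult)
    next
      assume "?N \<inter> f ` W = ?N"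
      then have NW: "?N \<subseteq> f ` W" by blast
      define a where "a = card (carrier Q) div card (f ` W)"
      define b where "b = card V div card (W \<inter> V)"
      have a: "card (carrier Q) = card (f ` W) * a" unfolding a_def 
        using E.H.card_index[OF fW(2) E.H.subgroup_self subgroup.subset[OF fW(2)]] .
      have b: "card V = card (W \<inter> V) * b" unfolding b_def using card_index[OF WV s(1)] by simp
      have "card (carrier G) = card W * (a * b)" using E.card_carrier ker a b cW by (simp add: ac_simps)
      then have "card (carrier G) div card W = a * b" using card_subgroup_pos[OF Ws] by simp
      moreover have "a dvd card (carrier Q) div card ?N" unfolding a_def
        by (rule E.H.index_dvd_mono(2)[OF E.subgroup_image[OF s(2)] fW(2) E.H.subgroup_self NW subgroup.subset[OF fW(2)]])
      then have "pi_number (-S) a" using iN VU(6) pi_number_dvd by metis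
      moreover have "pi_number (-S) b" using b VU(4) pi_number_mult by metis
      ultimately show ?thesis by (simp add: pi_number_mult)
    qed
  qed
qed

text \<open>A normal S-complement T has a tower by induction, and G is put on top of it as term
  \<open>Suc t\<close>.\<close>

lemma hemb_tower:
  assumes "fin_group G" "hemb \<sigma> G"
    and "\<And>S p q. S \<in> \<sigma> \<Longrightarrow> p \<in> S \<Longrightarrow> q \<in> S \<Longrightarrow> p \<in> primes_of (card (carrier G)) \<Longrightarrow> q \<in> primes_of (card (carrier G)) \<Longrightarrow> p = q"
  shows "\<exists>t C. tower_series G t C"
  using assms
proof (induction "card (carrier G)" arbitrary: G rule: less_induct)
  case less
  interpret fin_group G by (rule less.prems(1))
  show ?case
  proof (cases "carrier G = {\<one>\<^bsub>G\<^esub>}")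
    case True
    then have "tower_series G 0 (\<lambda>_. {\<one>\<^bsub>G\<^esub>})" using one_is_normal by (simp add: tower_series_def)
    then show ?thesis by blast
  next
    case False
    obtain S T where S: "S \<in> \<sigma>" and T: "T \<lhd> G" "T \<noteq> carrier G" "pi_number (-S) (card T)" "pi_number S (card (carrier G) div card T)"
      using hemb_normal_Hall_complement[OF less.prems(1,2) False] by metis
    have Ts: "subgroup T G" using T normal_imp_subgroup by blast
    have Tc: "T \<subseteq> carrier G" using Ts subgroup.subset by blast
    have cG: "card (carrier G) = card T * (card (carrier G) div card T)" using card_index[OF Ts subgroup_self Tc] .
    have ind0: "card (carrier G) div card T > 0" using index_pos[OF Ts subgroup_self Tc] .
    have cT0: "card T > 0" using card_subgroup_pos[OF Ts] .
    interpret T: fin_group "G\<lparr>carrier := T\<rparr>" by (rule fin_group_subgroup[OF Ts])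
    have lt: "card T < card (carrier G)" using T(2) Tc fin by (metis psubsetI psubset_card_mono)
    have pTG: "primes_of (card T) \<subseteq> primes_of (card (carrier G))" using card_subgroup_dvd[OF Ts] primes_of_mono by blast
    have "\<exists>t C. tower_series (G\<lparr>carrier := T\<rparr>) t C"
      by (rule less.hyps) (use lt T.fin_group_axioms hemb_subgroup[OF less.prems(2) Ts] less.prems(3) pTG in auto)
    then obtain t C where C: "tower_series (G\<lparr>carrier := T\<rparr>) t C" by blast
    have copT: "coprime (card T) (card (carrier G) div card T)" using pi_number_coprime[OF T(4,3)] by (simp add: coprime_commute)
    have mult: "multiplicity p (card (carrier G)) = multiplicity p (card T) + multiplicity p (card (carrier G) div card T)"
      if "Factorial_Ring.prime p" for p
      using that cT0 ind0 cG by (metis prime_elem_multiplicity_mult_distrib prime_imp_prime_elem less_numeral_extra(3))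
    let ?C = "C(Suc t := carrier G)"
    have Cn: "C i \<lhd> G \<and> coprime (card (C i)) (card (carrier G) div card (C i))" if i: "i \<le> t" for i
    proof -
      have Ci: "C i \<lhd> G\<lparr>carrier := T\<rparr>" "coprime (card (C i)) (card T div card (C i))"
        using C i by (auto simp: tower_series_def)
      note Ci' = normal_in_imp(1,2)[OF Ci(1) Ts]
      have "card (carrier G) div card (C i) = (card (carrier G) div card T) * (card T div card (C i))"
        using index_mult[OF Ci'(1) Ts subgroup_self Ci'(2) Tc] .
      moreover have "coprime (card (C i)) (card (carrier G) div card T)"
        using copT card_subgroup_dvd_subgroup[OF Ci'(1) Ts Ci'(2)] by (metis coprime_divisors dvd_refl)
      ultimately show ?thesis using normal_Hall_trans[OF T(1) Ci] Ci(2) by simp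
    qed
    have "tower_series G (Suc t) ?C" unfolding tower_series_def
    proof (intro conjI allI impI)
      show "?C 0 = {\<one>\<^bsub>G\<^esub>}" using C by (simp add: tower_series_def)
      fix i
      show "?C i \<lhd> G" if "i \<le> Suc t" using that Cn normal_self by (auto simp: le_Suc_eq)
      show "coprime (card (?C i)) (card (carrier G) div card (?C i))" if "i \<le> Suc t" 
        using that Cn card_carrier_pos by (auto simp: le_Suc_eq)
      assume i: "i < Suc t"
      have Ct: "C t = T" using C by (simp add: tower_series_def)
      show "?C i \<subset> ?C (Suc i)"
      proof (cases "i = t")
        case True
        have "T \<subset> carrier G" using Tc T(2) by blast
        then show ?thesis using True Ct by simp
      next
        case False
        then have "i < t" using i by simp
        then show ?thesis using C by (simp add: tower_series_def)
      qed
      show "\<exists>p\<in>primes_of (card (carrier G)). card (?C (Suc i)) div card (?C i) = p ^ multiplicity p (card (carrier G))"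
      proof (cases "i = t")
        case False
        then have it: "i < t" using i by simp
        moreover have "\<forall>i<t. \<exists>p\<in>primes_of (card T). card (C (Suc i)) div card (C i) = p ^ multiplicity p (card T)"
          using C unfolding tower_series_def by simp
        ultimately obtain p where p: "p \<in> primes_of (card T)" "card (C (Suc i)) div card (C i) = p ^ multiplicity p (card T)"
          by blast
        then have pp: "Factorial_Ring.prime p" "p dvd card T" by (auto simp: primes_of_def)
        then have "\<not> p dvd card (carrier G) div card T" using copT by (metis coprime_common_divisor_nat not_prime_1)
        then have "multiplicity p (card (carrier G)) = multiplicity p (card T)"
          using mult[OF pp(1)] by (simp add: not_dvd_imp_multiplicity_0)
        then show ?thesis using p pTG it by (intro bexI[of _ p]) auto
      next
        case True
        \<comment> \<open>The top factor is an S-number, so with one prime per block it is a power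
          of a single p; as T is a Hall subgroup, this is the full p-part of |G|.\<close>
        have "card (carrier G) div card T \<noteq> 1" using index_1_imp_eq[OF Ts subgroup_self Tc] T(2) by blast
        then obtain p where p: "Factorial_Ring.prime p" "p dvd card (carrier G) div card T" using prime_factor_nat by blast
        have sub: "primes_of (card (carrier G) div card T) \<subseteq> primes_of (card (carrier G))" 
          using cG by (metis dvd_triv_right primes_of_mono)
        have pS: "p \<in> S" "p \<in> primes_of (card (carrier G))" using p T(4) sub by (auto simp: pi_number_def primes_of_def)
        have "pi_number {p} (card (carrier G) div card T)"
          unfolding pi_number_def
        proof
          fix q assume "q \<in> primes_of (card (carrier G) div card T)"
          then have "q \<in> S" "q \<in> primes_of (card (carrier G))" using T(4) sub by (auto simp: pi_number_def)
          then show "q \<in> {p}" using less.prems(3)[OF S _ pS(1) _ pS(2)] by simp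
        qed
        then have e: "card (carrier G) div card T = p ^ multiplicity p (card (carrier G) div card T)"
          using pi_number_singleton_imp_power ind0 p(1) by blast
        have "\<not> p dvd card T" using copT p by (metis coprime_common_divisor_nat not_prime_1)
        then have "multiplicity p (card (carrier G)) = multiplicity p (card (carrier G) div card T)"
          using mult[OF p(1)] by (simp add: not_dvd_imp_multiplicity_0)
        then show ?thesis using e pS(2) True Ct by (intro bexI[of _ p]) auto
      qed
    qed simp
    then show ?thesis by blast
  qed
qed

theorem hemb_imp_HsigmaE_group:
  fixes G :: "('a, 'b) monoid_scheme"
  assumes "fin_group G" "hemb \<sigma> G"
  shows "HsigmaE_group \<sigma> G"
proof -
  interpret fin_group G by fact
  define D where "D = sigma_nilpotent_residual \<sigma> G"
  have nD: "nilq \<sigma> G D" and Dmin: "\<And>N. nilq \<sigma> G N \<Longrightarrow> D \<subseteq> N"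
    using residual_props[OF assms(1)] by (auto simp: D_def)
  have Dn: "D \<lhd> G" using nD by (simp add: nilq_def)
  have Ds: "subgroup D G" using Dn normal_imp_subgroup by blast
  have Dc: "D \<subseteq> carrier G" using Ds subgroup.subset by blast
  have cG: "card (carrier G) = card D * (card (carrier G) div card D)" using card_index[OF Ds subgroup_self Dc] .
  have Dprim: "D \<subseteq> L" if "L \<lhd> G" "S \<in> \<sigma>" "pi_number S (card (carrier G) div card L)" for L S
    using Dmin[OF nilq_primary[OF assms(1) that]] .
  \<comment> \<open>If S divides |G : D|, nilpotency of G/D gives a proper normal subgroup of
    S-index, hence a normal S-complement U. As G/U is primary, D lies in U.\<close>
  have hall: "pi_number (-S) (card D) \<or> pi_number (-S) (card (carrier G) div card D)" if S: "S \<in> \<sigma>" for S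
  proof (rule disjCI)
    assume ns: "\<not> pi_number (-S) (card (carrier G) div card D)"
    obtain T where T: "T \<lhd> G" "D \<subseteq> T" "pi_number (-S) (card T div card D)" "pi_number S (card (carrier G) div card T)"
      using nD S unfolding nilq_def by blast
    have "T \<noteq> carrier G" using T(3) ns by auto
    then obtain U where U: "U \<lhd> G" "pi_number (-S) (card U)" "pi_number S (card (carrier G) div card U)"
      using hemb_normal_complement[OF assms S T(1) _ T(4)] by blast
    have "card D dvd card U" 
      using card_subgroup_dvd_subgroup[OF Ds normal_imp_subgroup[OF U(1)] Dprim[OF U(1) S U(3)]] .
    then show "pi_number (-S) (card D)" using U(2) pi_number_dvd by blast
  qed
  have cop: "coprime (card D) (card (carrier G) div card D)"
  proof (rule ccontr)
    assume "\<not> ?thesis"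
    then obtain q where q: "Factorial_Ring.prime q" "q dvd card D" "q dvd card (carrier G) div card D"
      using prime_factor_nat[of "gcd (card D) (card (carrier G) div card D)"] by (auto simp: coprime_iff_gcd_eq_1)
    obtain S where "S \<in> \<sigma>" "q \<in> S" using block_ex[OF q(1)] by blast
    then show False using hall[of S] q by (auto simp: pi_number_def primes_of_def)
  qed
  obtain M where M: "subgroup M G" "card M = card (carrier G) div card D"
    using schur_zassenhaus_exists[OF assms(1) Dn cop] by blast
  have Mc: "M \<subseteq> carrier G" using M subgroup.subset by blast
  note DM = complement_props[OF Dn cop M]
  \<comment> \<open>A block dividing |D| does not divide |G : D|, while every normal L of S-index
    contains D. This gives O^S(G) = G, as \<open>hemb_block_part\<close> requires.\<close>
  have no: "L = carrier G" if S: "S \<in> \<sigma>" "\<not> pi_number (-S) (card D)" 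
    and L: "L \<lhd> G" "pi_number S (card (carrier G) div card L)" for S L
  proof -
    have Ls: "subgroup L G" "L \<subseteq> carrier G" using L normal_imp_subgroup subgroup.subset by blast+
    have "card (carrier G) div card L dvd card (carrier G) div card D"
      by (rule index_dvd_mono(2)[OF Ds Ls(1) subgroup_self Dprim[OF L(1) S(1) L(2)] Ls(2)])
    then have "pi_number (-S) (card (carrier G) div card L)" using hall[OF S(1)] S(2) pi_number_dvd by blast
    then have "card (carrier G) div card L = 1" using L(2) pi_number_both by blast
    then show ?thesis using index_1_imp_eq[OF Ls(1) subgroup_self Ls(2)] by blast
  qed
  have DpG: "primes_of (card D) \<subseteq> primes_of (card (carrier G))" using card_subgroup_dvd[OF Ds] primes_of_mono by blast
  have single: "p = q" if "S \<in> \<sigma>" "p \<in> S" "q \<in> S" "p \<in> primes_of (card D)" "q \<in> primes_of (card D)" for S p q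
  proof -
    have "\<not> pi_number (-S) (card D)" using that by (auto simp: pi_number_def)
    from hemb_block_part(1)[OF assms that(1) no[OF that(1) this] that(2,3)] show ?thesis using that DpG by blast
  qed
  have 1: "is_semidirect G D M" using Dn M(1) DM by (simp add: is_semidirect_def)
  have 2: "sigma_Hall_subgroup \<sigma> G D"
  proof -
    have "\<not> (S \<in> sigma_of \<sigma> (card D) \<and> S \<in> sigma_of \<sigma> (card (carrier G) div card D))" for S
      using hall[of S] by (auto simp: sigma_of_iff)
    then show ?thesis unfolding sigma_Hall_subgroup_def card_rcosets[OF Ds] using Ds by blast
  qed
  have 3: "card (sigma_of \<sigma> (card D)) = card (primes_of (card D))"
    unfolding card_sigma_of_iff[OF card_subgroup_pos[OF Ds]] using single by blast
  have 4: "has_Sylow_tower (G\<lparr>carrier := D\<rparr>)"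
    unfolding fin_group.has_Sylow_tower_iff[OF fin_group_subgroup[OF Ds]]
    by (rule hemb_tower[OF fin_group_subgroup[OF Ds] hemb_subgroup[OF assms(2) Ds]]) (use single in simp)
  \<comment> \<open>If H/K were central, its centralizer would have S-index and so be G, and by
    \<open>hemb_block_part\<close> H/K would be a Hall S-subgroup of G/K. A complement of it is then
    normal of S-index, hence everything, and H = K.\<close>
  have 5: "sigma_eccentric_factor \<sigma> G H K" if chief: "chief_factor G H K" and HD: "H \<subseteq> D" for H K
  proof
    assume central: "sigma_central_factor \<sigma> G H K"
    have HK: "H \<lhd> G" "K \<lhd> G" "K \<subseteq> H" "K \<noteq> H" using chief by (auto simp: chief_factor_def)
    have Hs: "subgroup H G" "subgroup K G" "H \<subseteq> carrier G" using HK normal_imp_subgroup subgroup.subset by blast+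
    let ?C = "factor_centralizer G H K"
    obtain S where S: "S \<in> \<sigma>" "pi_number S (card H div card K)" "pi_number S (card (carrier G) div card ?C)"
      using central sigma_central_factor_iff[OF HK(1-3)] by blast
    have HK1: "card H div card K \<noteq> 1" using index_1_imp_eq[OF Hs(2,1) HK(3)] HK(4) by blast
    have nS: "\<not> pi_number (-S) n" if "card H div card K dvd n" for n
      using S(2) HK1 that pi_number_both pi_number_dvd by blast
    have dH: "card H div card K dvd card H" using card_index[OF Hs(2,1) HK(3)] by (metis dvd_triv_right)
    have dHD: "card H dvd card D" using card_subgroup_dvd_subgroup[OF Hs(1) Ds HD] .
    have nD: "\<not> pi_number (-S) (card D)" using nS dH dHD dvd_trans by blast
    note noS = no[OF S(1) nD]
    have C: "?C = carrier G" using noS[OF factor_centralizer_normal[OF HK(1-3)] S(3)] .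
    have Hp: "pi_number (-S) (card (carrier G) div card H)"
      using hemb_block_part(2)[OF assms S(1) noS HK(1)] nS[OF dH] by blast
    have Kp: "pi_number (-S) (card K)"
      using hemb_block_part(2)[OF assms S(1) noS HK(2)] nS index_dvd_mono(1)[OF Hs(2,1) subgroup_self HK(3) Hs(3)] by blast
    obtain Q :: "('a, 'b) monoid_scheme" and f where "fin_epi G Q f" and ker: "kernel G Q f = K"
      using ex_quotient[OF HK(2)] by blast
    then interpret E: fin_epi G Q f by simp
    let ?Z = "f ` H"
    have Z: "?Z \<lhd> Q" "subgroup ?Z Q" using E.normal_image[OF HK(1)] E.subgroup_image[OF Hs(1)] by auto
    have cZ: "card ?Z = card H div card K" 
      using E.card_image_ker'[OF Hs(1)] ker HK(3) card_subgroup_pos[OF Hs(2)] by simp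
    have iZ: "card (carrier Q) div card ?Z = card (carrier G) div card H"
      using E.index_image[OF Hs(1) subgroup_self] ker HK(3) Hs(3) E.surj by simp
    have copZ: "coprime (card ?Z) (card (carrier Q) div card ?Z)"
      using pi_number_coprime[OF S(2) Hp] iZ cZ by metis
    obtain L where L: "subgroup L Q" "card L = card (carrier Q) div card ?Z"
      using schur_zassenhaus_exists[OF E.fin_group_codom Z(1) copZ] by blast
    note ZL = E.H.complement_props[OF Z(1) copZ L]
    have Lc: "l \<in> carrier Q" if "l \<in> L" for l using that L(1) subgroup.mem_carrier by metis
    have zcomm: "z \<otimes>\<^bsub>Q\<^esub> x = x \<otimes>\<^bsub>Q\<^esub> z" if z: "z \<in> ?Z" and x: "x \<in> carrier Q" for z x
    proof -
      obtain h where h: "h \<in> H" "z = f h" using z by blast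
      have "x \<in> f ` carrier G" using x by (simp only: E.surj)
      then obtain g where g: "g \<in> carrier G" "x = f g" by blast
      have hc: "h \<in> carrier G" using h Hs(3) by blast
      have "K #>\<^bsub>G\<^esub> (g \<otimes>\<^bsub>G\<^esub> h \<otimes>\<^bsub>G\<^esub> inv\<^bsub>G\<^esub> g) = K #>\<^bsub>G\<^esub> h"
        using C g h by (auto simp: factor_centralizer_def)
      moreover have "g \<otimes>\<^bsub>G\<^esub> h \<otimes>\<^bsub>G\<^esub> inv\<^bsub>G\<^esub> g \<in> K #>\<^bsub>G\<^esub> (g \<otimes>\<^bsub>G\<^esub> h \<otimes>\<^bsub>G\<^esub> inv\<^bsub>G\<^esub> g)"
        using rcos_self[OF _ Hs(2)] g hc by simp
      ultimately obtain k where k: "k \<in> K" "g \<otimes>\<^bsub>G\<^esub> h \<otimes>\<^bsub>G\<^esub> inv\<^bsub>G\<^esub> g = k \<otimes>\<^bsub>G\<^esub> h" by (auto simp: r_coset_def)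
      have kc: "k \<in> carrier G" and fk: "f k = \<one>\<^bsub>Q\<^esub>" using k(1) ker by (auto simp: kernel_def)
      have "f (g \<otimes>\<^bsub>G\<^esub> h \<otimes>\<^bsub>G\<^esub> inv\<^bsub>G\<^esub> g) = f h" using k(2) kc fk hc by simp
      then have "f g \<otimes>\<^bsub>Q\<^esub> f h \<otimes>\<^bsub>Q\<^esub> inv\<^bsub>Q\<^esub> (f g) = f h" using g hc by simp
      then show ?thesis using h g hc E.H.inv_solve_right'[of "f h" "f g \<otimes>\<^bsub>Q\<^esub> f h" "f g"] by simp
    qed
    \<comment> \<open>Writing x = z l' with z central, conjugation by x acts on L as conjugation by
      l'.\<close>
    have "L \<lhd> Q" unfolding E.H.normal_iff
    proof (intro conjI ballI L(1))
      fix x l assume x: "x \<in> carrier Q" and l: "l \<in> L"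
      have "x \<in> ?Z <#>\<^bsub>Q\<^esub> L" using x ZL(2) by simp
      then obtain z l' where zl: "z \<in> ?Z" "l' \<in> L" "x = z \<otimes>\<^bsub>Q\<^esub> l'" by (auto simp: set_mult_def)
      have zc: "z \<in> carrier Q" using zl(1) Z(2) subgroup.mem_carrier by metis
      let ?y = "l' \<otimes>\<^bsub>Q\<^esub> l \<otimes>\<^bsub>Q\<^esub> inv\<^bsub>Q\<^esub> l'"
      have yL: "?y \<in> L" using zl l L(1) by (simp add: subgroup.m_closed subgroup.m_inv_closed)
      have "x \<otimes>\<^bsub>Q\<^esub> l \<otimes>\<^bsub>Q\<^esub> inv\<^bsub>Q\<^esub> x = z \<otimes>\<^bsub>Q\<^esub> ?y \<otimes>\<^bsub>Q\<^esub> inv\<^bsub>Q\<^esub> z"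
        unfolding zl(3) using E.H.conj_conj[OF zc Lc[OF zl(2)] Lc[OF l]] by simp
      also have "\<dots> = ?y" using zcomm[OF zl(1) Lc[OF yL]] zc Lc[OF yL] by (simp only: E.H.m_assoc E.H.inv_closed E.H.r_inv E.H.r_one)
      finally show "x \<otimes>\<^bsub>Q\<^esub> l \<otimes>\<^bsub>Q\<^esub> inv\<^bsub>Q\<^esub> x \<in> L" using yL by simp
    qed
    moreover have cQ: "card (carrier Q) = card ?Z * card L" using L(2) E.H.card_subgroup_dvd[OF Z(2)] by simp
    then have iL: "card (carrier Q) div card L = card ?Z" using E.H.card_subgroup_pos[OF L(1)] by simp
    moreover have "card (carrier G) div card (E.pre L) = card (carrier Q) div card L"
      using E.card_pre[OF L(1)] E.card_carrier E.card_kernel_pos by simp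
    ultimately have "E.pre L = carrier G" using noS[OF E.normal_pre] S(2) cZ by simp
    then have "L = carrier Q" using E.image_pre[OF subgroup.subset[OF L(1)]] E.surj by simp
    then have "card ?Z = 1" using cQ E.H.card_carrier_pos by simp
    then show False using cZ HK1 by simp
  qed
  have 6: "acts_irreducibly G M P" if P: "sylow_subgroup p (G\<lparr>carrier := D\<rparr>) P" and inv: "conj_invariant G M P" for p P
  proof -
    have p: "Factorial_Ring.prime p" "p dvd card D" and P0: "subgroup P (G\<lparr>carrier := D\<rparr>)" 
      and cP: "card P = p ^ multiplicity p (card D)"
      using P by (auto simp: sylow_subgroup_def order_def primes_of_def)
    have Ps: "subgroup P G" "P \<subseteq> D" using incl_subgroup[OF Ds P0] subgroup.subset[OF P0] by auto
    have "multiplicity p (card D) > 0" using p card_subgroup_pos[OF Ds] 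
      by (metis multiplicity_gt_zero_iff not_prime_unit less_numeral_extra(3))
    then have pP: "p dvd card P" using cP by simp
    then have "card P \<noteq> 1" using p(1) by (metis nat_dvd_1_iff_1 not_prime_1)
    then have P1: "P \<noteq> {\<one>\<^bsub>G\<^esub>}" by auto
    \<comment> \<open>R M turns out to be \<sigma>-Hall in G itself. Its order is divisible by p, so
      its index is not, and the p-power |P : R| is 1.\<close>
    have "R = P" if R: "subgroup R G" "R \<subseteq> P" "conj_invariant G M R" and R1: "R \<noteq> {\<one>\<^bsub>G\<^esub>}" for R
    proof -
      have Rc: "R \<subseteq> carrier G" using R(1) subgroup.subset by blast
      let ?N = "norm_of R"
      have N: "subgroup ?N G" using norm_of_subgroup[OF Rc] .
      have MN: "M \<subseteq> ?N" using R(3) conj_invariant_iff[OF Mc Rc] by simp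
      interpret N: fin_group "G\<lparr>carrier := ?N\<rparr>" by (rule fin_group_subgroup[OF N])
      have MNs: "subgroup M (G\<lparr>carrier := ?N\<rparr>)" using subgroup_incl[OF M(1) N MN] .
      let ?A = "R <#>\<^bsub>G\<^esub> M"
      have "R \<inter> M \<subseteq> {\<one>\<^bsub>G\<^esub>}" using DM(1) R(2) Ps(2) by blast
      then have RM: "R \<inter> M = {\<one>\<^bsub>G\<^esub>}" using subgroup.one_closed[OF R(1)] subgroup.one_closed[OF M(1)] by blast
      have A: "subgroup ?A G" "card ?A = card R * card M" "R \<subseteq> ?A" "M \<subseteq> ?A"
        using N.card_set_mult_normal[OF norm_of_normal[OF R(1)] MNs] RM incl_subgroup[OF N] by auto
      obtain B where B: "sigma_subnormal \<sigma> G B" "?A \<subseteq> B" 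
        "\<forall>S\<in>\<sigma>. pi_number (-S) (card ?A) \<or> pi_number (-S) (card B div card ?A)"
        using assms(2) A(1) unfolding hemb_def by blast
      \<comment> \<open>No proper subgroup above E contains D, because it contains M. If the last
        step is primary, D lies in E as the residual; otherwise E is normal, and a primary quotient
        of G/E provides a proper subgroup above E and D.\<close>
      have "B = carrier G"
      proof (rule ccontr)
        assume "B \<noteq> carrier G"
        then obtain E where E: "subgroup E G" "B \<subseteq> E" "E \<noteq> carrier G" "sstep \<sigma> G E (carrier G)"
          using sigma_subnormal_last_step[OF B(1)] by metis
        have notD: "\<not> D \<subseteq> F" if F: "subgroup F G" "E \<subseteq> F" "F \<noteq> carrier G" for F
        proof
          assume "D \<subseteq> F"
          moreover have "M \<subseteq> F" using A(4) B(2) E(2) F(2) by blast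
          ultimately have "carrier G \<subseteq> F" using set_mult_subset_subgroup[OF F(1)] DM(2) by blast
          then show False using F subgroup.subset by blast
        qed
        obtain N where N: "N \<lhd> G" "N \<subseteq> E" and NE: "N = E \<or> (\<exists>S\<in>\<sigma>. pi_number S (card (carrier G) div card N))"
          using E(4) by (auto simp: sstep_def)
        show False
        proof (cases "N = E")
          case False
          then show False using NE Dprim[OF N(1)] N(2) notD[OF E(1) subset_refl E(3)] by blast
        next
          case True
          then have En: "E \<lhd> G" using N by simp
          obtain Q :: "('a, 'b) monoid_scheme" and f where "fin_epi G Q f" and ker: "kernel G Q f = E"
            using ex_quotient[OF En] by blast
          then interpret E: fin_epi G Q f by simp
          have "carrier Q \<noteq> {\<one>\<^bsub>Q\<^esub>}"
          proof
            assume "carrier Q = {\<one>\<^bsub>Q\<^esub>}"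
            then have "card (carrier G) = card E" using E.card_carrier ker by simp
            then show False using card_eq_imp_eq[OF E(1) subgroup_self subgroup.subset[OF E(1)]] E(3) by simp
          qed
          then obtain S L where S: "S \<in> \<sigma>" and L: "L \<lhd> Q" "L \<noteq> carrier Q" "pi_number S (card (carrier Q) div card L)"
            using hemb_primary_quotient[OF E.fin_group_codom E.hemb_image[OF assms(2)]] by blast
          have Ls: "subgroup L Q" using L normal_imp_subgroup by blast
          have "card (carrier G) div card (E.pre L) = card (carrier Q) div card L"
            using E.card_pre[OF Ls] E.card_carrier E.card_kernel_pos by simp
          then have "D \<subseteq> E.pre L" using Dprim[OF E.normal_pre[OF L(1)] S] L(3) by simp
          moreover have "E \<subseteq> E.pre L" using E.ker_subset_pre[OF Ls] ker by simp
          moreover have "E.pre L \<noteq> carrier G"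
            using E.image_pre[OF subgroup.subset[OF Ls]] E.surj L(2) by metis
          ultimately show False using notD[OF E.subgroup_pre[OF Ls]] by blast
        qed
      qed
      then have emb: "\<forall>S\<in>\<sigma>. pi_number (-S) (card ?A) \<or> pi_number (-S) (card (carrier G) div card ?A)" using B(3) by simp
      obtain S where S: "S \<in> \<sigma>" "p \<in> S" using block_ex[OF p(1)] by blast
      have RPdvd: "card R dvd p ^ multiplicity p (card D)" using card_subgroup_dvd_subgroup[OF R(1) Ps(1) R(2)] cP by simp
      have pdvd: "p dvd n" if "n dvd p ^ k" "n \<noteq> 1" for n k
        using that p(1) by (metis divides_primepow_nat dvd_power neq0_conv power_0)
      have "card R \<noteq> 1" using card_eq_1_iff[OF R(1)] R1 by simp
      then have "p dvd card ?A" using A(2) pdvd[OF RPdvd] by simp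
      then have "\<not> pi_number (-S) (card ?A)" using S(2) p(1) by (auto simp: pi_number_def primes_of_def)
      then have nA: "pi_number (-S) (card (carrier G) div card ?A)" using emb S(1) by blast
      define r where "r = card P div card R"
      define s where "s = card D div card P"
      have r: "card P = card R * r" unfolding r_def using card_index[OF R(1) Ps(1) R(2)] .
      have s: "card D = card P * s" unfolding s_def using card_index[OF Ps(1) Ds Ps(2)] .
      have "card (carrier G) = card D * card M" using cG M(2) by simp
      then have "card (carrier G) = card ?A * (r * s)" using A(2) r s by (simp add: ac_simps)
      then have "card (carrier G) div card ?A = r * s" using card_subgroup_pos[OF A(1)] by simp
      then have "pi_number (-S) r" using nA by (simp add: pi_number_mult)
      then have "\<not> p dvd r" using S(2) p(1) by (auto simp: pi_number_def primes_of_def)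
      moreover have "r dvd p ^ multiplicity p (card D)" using r cP by (metis dvd_triv_right)
      ultimately have "r = 1" using pdvd by blast
      then show ?thesis using card_eq_imp_eq[OF R(1) Ps(1) R(2)] r by simp
    qed
    then show ?thesis using P1 unfolding acts_irreducibly_def by blast
  qed
  have "HsigmaE_group_form \<sigma> G D M" unfolding HsigmaE_group_form_def
    using 1 2 3 4 5 6 D_def by blast
  then show ?thesis unfolding HsigmaE_group_def by blast
qed

end

section \<open>Structure of \<open>H\<sigma>E\<close>-groups\<close>

context fin_group begin

text \<open>At the first term C i containing A, the image of A in the top factor of C i is a
  nontrivial p-group, hence not perfect.\<close>

lemma tower_series_solvable:
  assumes "tower_series G t C"
  shows "solvable_in G (carrier G)"
  unfolding solvable_in_def
proof (intro allI impI; elim conjE)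
  fix A assume A: "subgroup A G" "A \<subseteq> carrier G" "A \<noteq> {\<one>}"
  define i where "i = (LEAST i. A \<subseteq> C i)"
  have Ct: "C t = carrier G" "C 0 = {\<one>}" using assms by (auto simp: tower_series_def)
  have ex: "A \<subseteq> C t" using A Ct by simp
  have Ai: "A \<subseteq> C i" unfolding i_def using ex by (rule LeastI)
  have it: "i \<le> t" unfolding i_def using ex by (rule Least_le)
  have "i \<noteq> 0"
  proof
    assume "i = 0"
    then have "A \<subseteq> {\<one>}" using Ai Ct by simp
    then show False using A(3) subgroup.one_closed[OF A(1)] by blast
  qed
  then obtain j where j: "i = Suc j" using not0_implies_Suc by blast
  have nAj: "\<not> A \<subseteq> C j" using not_less_Least[of j "\<lambda>i. A \<subseteq> C i"] j by (simp add: i_def)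
  have jt: "j < t" using j it by simp
  have Cj: "C j \<lhd> G" "C (Suc j) \<lhd> G" "C j \<subseteq> C (Suc j)" using assms jt by (auto simp: tower_series_def)
  obtain p where p: "p \<in> primes_of (card (carrier G))" "card (C (Suc j)) div card (C j) = p ^ multiplicity p (card (carrier G))"
    using assms jt unfolding tower_series_def by blast
  have pp: "Factorial_Ring.prime p" using p by (simp add: primes_of_def)
  have Cs: "subgroup (C j) G" "subgroup (C (Suc j)) G" using Cj normal_imp_subgroup by auto
  obtain Q :: "('a, 'b) monoid_scheme" and f where "fin_epi G Q f" and ker: "kernel G Q f = C j"
    using ex_quotient[OF Cj(1)] by blast
  then interpret E: fin_epi G Q f by simp
  have "card (f ` C (Suc j)) = p ^ multiplicity p (card (carrier G))"
    using E.card_image_ker'[OF Cs(2)] ker Cj(3) card_subgroup_pos[OF Cs(1)] p(2) by simp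
  moreover have "f ` A \<subseteq> f ` C (Suc j)" using Ai j by blast
  then have "card (f ` A) dvd card (f ` C (Suc j))"
    using E.H.card_subgroup_dvd_subgroup[OF E.subgroup_image[OF A(1)] E.subgroup_image[OF Cs(2)]] by simp
  ultimately obtain k where k: "card (f ` A) = p ^ k" using divides_primepow_nat[OF pp] by metis
  have "f ` A \<noteq> {\<one>\<^bsub>Q\<^esub>}"
  proof
    assume "f ` A = {\<one>\<^bsub>Q\<^esub>}"
    then have "A \<subseteq> kernel G Q f" using A(2) by (auto simp: kernel_def)
    then show False using ker nAj by simp
  qed
  then have "derived Q (f ` A) \<noteq> f ` A"
    using E.H.p_group_solvable_in[OF E.subgroup_image[OF A(1)] pp k] E.subgroup_image[OF A(1)]
    by (auto simp: solvable_in_def)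
  then show "derived G A \<noteq> A" using E.derived_img[OF A(2)] by auto
qed

section \<open>Subgroups of D invariant under a complement\<close>

lemma norm_of_conjs:
  assumes "g \<in> carrier G" "M \<subseteq> norm_of P" "P \<subseteq> carrier G"
  shows "conjs g M \<subseteq> norm_of (conjs g P)"
proof
  fix x assume "x \<in> conjs g M"
  then obtain m where m: "m \<in> M" "x = g \<otimes> m \<otimes> inv g" by (auto simp: conjs_def)
  have mc: "m \<in> carrier G" "conjs m P = P" using m assms(2) by (auto simp: norm_of_def)
  have xc: "x \<in> carrier G" using m mc assms(1) by simp
  have "conjs x (conjs g P) = conjs (x \<otimes> g) P" using conjs_mult[OF xc assms(1,3)] .
  also have "x \<otimes> g = g \<otimes> m" using m mc assms(1) by (simp add: m_assoc)
  also have "conjs (g \<otimes> m) P = conjs g P" using conjs_mult[OF assms(1) mc(1) assms(3)] mc(2) by simp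
  finally show "x \<in> norm_of (conjs g P)" using xc by (simp add: norm_of_def)
qed

lemma norm_of_sub: 
  assumes "subgroup H G"
  shows "fin_group.norm_of (G\<lparr>carrier := H\<rparr>) A = norm_of A \<inter> H"
proof -
  interpret H: fin_group "G\<lparr>carrier := H\<rparr>" by (rule fin_group_subgroup[OF assms])
  show ?thesis using conjs_sub[OF assms] subgroup.mem_carrier[OF assms] by (auto simp: H.norm_of_def norm_of_def)
qed

lemma multiplicity_card_index:
  assumes "subgroup H G" "subgroup K G" "H \<subseteq> K" "Factorial_Ring.prime p"
  shows "multiplicity p (card K) = multiplicity p (card H) + multiplicity p (card K div card H)"
proof -
  have "card H \<noteq> 0" "card K div card H \<noteq> 0" using card_subgroup_pos[OF assms(1)] index_pos[OF assms(1-3)] by auto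
  then have "multiplicity p (card H * (card K div card H)) = multiplicity p (card H) + multiplicity p (card K div card H)"
    using assms(4) by (intro prime_elem_multiplicity_mult_distrib) auto
  then show ?thesis using card_index[OF assms(1-3)] by simp
qed

text \<open>By Frattini the normalizer of any Sylow subgroup of D contains a complement of D;
  conjugating this complement to M carries the Sylow subgroup along.\<close>

lemma invariant_sylow_exists:
  assumes D: "D \<lhd> G" "coprime (card D) (card (carrier G) div card D)" "solvable_in G D"
    and M: "subgroup M G" "card M = card (carrier G) div card D" and p: "Factorial_Ring.prime p"
  obtains P where "subgroup P G" "P \<subseteq> D" "card P = p ^ multiplicity p (card D)" "M \<subseteq> norm_of P"
proof -
  have Ds: "subgroup D G" using D normal_imp_subgroup by blast
  interpret D: fin_group "G\<lparr>carrier := D\<rparr>" by (rule fin_group_subgroup[OF Ds])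
  obtain P where P0: "subgroup P (G\<lparr>carrier := D\<rparr>)" "card P = p ^ multiplicity p (card D)" 
      "\<not> p dvd card D div card P" using D.sylow_exists[OF p] by auto
  have P: "subgroup P G" "P \<subseteq> D" using P0 incl_subgroup[OF Ds] subgroup.subset[OF P0(1)] by auto
  have Pc: "P \<subseteq> carrier G" using P subgroup.subset by blast
  let ?N = "norm_of P"
  have N: "subgroup ?N G" by (rule norm_of_subgroup[OF Pc])
  have DN: "D <#> ?N = carrier G"
    by (rule frattini_sylow[OF D(1) P p P0(2,3)])
  interpret N: fin_group "G\<lparr>carrier := ?N\<rparr>" by (rule fin_group_subgroup[OF N])
  have I: "subgroup (D \<inter> ?N) G" using subgroups_Inter_pair[OF Ds N] .
  have i: "card ?N div card (D \<inter> ?N) = card (carrier G) div card D"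
    by (rule index_set_mult_normal[OF fin_group_axioms D(1) N DN])
  have "card (D \<inter> ?N) dvd card D" using card_subgroup_dvd_subgroup[OF I Ds] by simp
  then have cop: "coprime (card (D \<inter> ?N)) (card ?N div card (D \<inter> ?N))"
    using D(2) i by (metis coprime_divisors dvd_refl)
  have n: "D \<inter> ?N \<lhd> G\<lparr>carrier := ?N\<rparr>" using normal_Int_subgroup[OF N D(1)] by (simp add: Int_commute)
  obtain M' where "subgroup M' (G\<lparr>carrier := ?N\<rparr>)" "card M' = card (carrier G) div card D"
    using schur_zassenhaus_exists[OF N.fin_group_axioms n] cop i by auto
  then have M': "subgroup M' G" "M' \<subseteq> ?N" "card M' = card (carrier G) div card D"
    using incl_subgroup[OF N] subgroup.subset by fastforce+
  obtain g where g: "g \<in> carrier G" "conjs g M' = M"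
    using schur_zassenhaus_conj[OF fin_group_axioms D M'(1,3) M] by blast
  show ?thesis
  proof
    show "subgroup (conjs g P) G" using conjs_subgroup[OF g(1) P(1)] .
    show "conjs g P \<subseteq> D" using conjs_mono[OF P(2), of g] conjs_normal[OF D(1) g(1)] by simp
    show "card (conjs g P) = p ^ multiplicity p (card D)" using conjs_card[OF g(1) Pc] P0(2) by simp
    show "M \<subseteq> norm_of (conjs g P)" using norm_of_conjs[OF g(1) M'(2) Pc] g(2) by simp
  qed
qed

text \<open>A maximal M-invariant p-subgroup R above Q is compared with an M-invariant Sylow
  subgroup of its normalizer in D. They agree by maximality, so R is Sylow in its normalizer, and
  since normalizers grow it is Sylow in D.\<close>

lemma invariant_p_subgroup_in_sylow:
  assumes D: "D \<lhd> G" "coprime (card D) (card (carrier G) div card D)" "solvable_in G D"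
    and M: "subgroup M G" "card M = card (carrier G) div card D" and p: "Factorial_Ring.prime p"
    and Q: "subgroup Q G" "Q \<subseteq> D" "card Q = p ^ k" "M \<subseteq> norm_of Q"
  obtains P where "subgroup P G" "P \<subseteq> D" "card P = p ^ multiplicity p (card D)" "M \<subseteq> norm_of P" "Q \<subseteq> P"
proof -
  have Ds: "subgroup D G" using D normal_imp_subgroup by blast
  let ?P = "\<lambda>R. subgroup R G \<and> Q \<subseteq> R \<and> R \<subseteq> D \<and> (\<exists>k. card R = p ^ k) \<and> M \<subseteq> norm_of R"
  have "?P Q" using Q by blast
  then obtain R where R': "?P R" and max: "\<And>K. ?P K \<Longrightarrow> card K \<le> card R"
    using ex_max_subgroup[of ?P Q] by blast
  then obtain j where R: "subgroup R G" "Q \<subseteq> R" "R \<subseteq> D" "card R = p ^ j" "M \<subseteq> norm_of R" by blast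
  have Rc: "R \<subseteq> carrier G" using R(1) subgroup.subset by blast
  let ?N = "norm_of R"
  have N: "subgroup ?N G" by (rule norm_of_subgroup[OF Rc])
  have "carrier G = D <#> M" using complement_props(2)[OF D(1,2) M] by simp
  also have "\<dots> \<subseteq> D <#> ?N" using R(5) by (intro mono_set_mult) auto
  finally have DN: "D <#> ?N = carrier G"
    using setmult_subset_G[of D ?N] norm_of_subset subgroup.subset[OF Ds] by blast
  interpret N: fin_group "G\<lparr>carrier := ?N\<rparr>" by (rule fin_group_subgroup[OF N])
  let ?E = "D \<inter> ?N"
  have I: "subgroup ?E G" using subgroups_Inter_pair[OF Ds N] .
  have i: "card ?N div card ?E = card (carrier G) div card D"
    by (rule index_set_mult_normal[OF fin_group_axioms D(1) N DN])
  have "card ?E dvd card D" using card_subgroup_dvd_subgroup[OF I Ds] by simp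
  then have cop: "coprime (card ?E) (card ?N div card ?E)"
    using D(2) i by (metis coprime_divisors dvd_refl)
  have n: "?E \<lhd> G\<lparr>carrier := ?N\<rparr>" using normal_Int_subgroup[OF N D(1)] by (simp add: Int_commute)
  have solv: "solvable_in (G\<lparr>carrier := ?N\<rparr>) ?E" using solvable_in_subgroup[OF D(3) N] by simp
  obtain P where P0: "subgroup P (G\<lparr>carrier := ?N\<rparr>)" "P \<subseteq> ?E" "card P = p ^ multiplicity p (card ?E)" "M \<subseteq> N.norm_of P"
    using N.invariant_sylow_exists[of ?E M p] n cop solv subgroup_incl[OF M(1) N R(5)] M(2) i p by auto
  have P: "subgroup P G" "M \<subseteq> norm_of P" using P0 incl_subgroup[OF N] norm_of_sub[OF N] by auto
  have npE: "\<not> p dvd card ?E div card P"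
  proof -
    have "multiplicity p (card P) = multiplicity p (card ?E)" using P0(3) p by simp
    then have "multiplicity p (card ?E div card P) = 0" using multiplicity_card_index[OF P(1) I P0(2) p] by simp
    moreover have "card ?E div card P \<noteq> 0" using index_pos[OF P(1) I P0(2)] by simp
    ultimately show ?thesis using p by (metis multiplicity_gt_zero_iff not_prime_unit less_irrefl)
  qed
  interpret I: fin_group "G\<lparr>carrier := ?E\<rparr>" by (rule fin_group_subgroup[OF I])
  have RE: "R \<subseteq> ?E" using R(3) subset_norm_of[OF R(1)] by blast
  \<comment> \<open>R is normal here, so being conjugate into P means lying in P.\<close>
  have RP: "R \<subseteq> P"
  proof -
    obtain g where g: "g \<in> ?E" "I.conjs g R \<subseteq> P"
      using I.sylow_conj_into[of P p R j] subgroup_incl[OF P(1) I P0(2)] subgroup_incl[OF R(1) I RE] p npE R(4) by auto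
    then show ?thesis using conjs_sub[OF I g(1)] by (auto simp: norm_of_def)
  qed
  have "card P \<le> card R" by (rule max) (use P P0 R RP in blast)
  then have "P = R" using card_seteq[OF finite_subgroup[OF P(1)] RP] by simp
  then have npR: "\<not> p dvd card ?E div card R" using npE by simp
  interpret D: fin_group "G\<lparr>carrier := D\<rparr>" by (rule fin_group_subgroup[OF Ds])
  have "\<not> p dvd card D div card R"
  proof
    assume "p dvd card D div card R"
    then have "p dvd card (D.norm_of R) div card R"
      using D.normalizers_grow[OF subgroup_incl[OF R(1) Ds R(3)] p R(4)] by simp
    then show False using npR norm_of_sub[OF Ds, of R] by (simp add: Int_commute)
  qed
  then have "multiplicity p (card D) = multiplicity p (card R)"
    using multiplicity_card_index[OF R(1) Ds R(3) p] by (simp add: not_dvd_imp_multiplicity_0)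
  then have "card R = p ^ multiplicity p (card D)" using R(4) p by simp
  then show ?thesis using that R by blast
qed

text \<open>On a group of prime order conjugation is raising to a power, and exponents
  commute.\<close>

lemma prime_order_conj_commute:
  assumes "Z \<lhd> G" "Factorial_Ring.prime (card Z)" "x \<in> carrier G" "y \<in> carrier G" "z \<in> Z"
  shows "x \<otimes> (y \<otimes> z \<otimes> inv y) \<otimes> inv x = y \<otimes> (x \<otimes> z \<otimes> inv x) \<otimes> inv y"
proof -
  have Zs: "subgroup Z G" using assms normal_imp_subgroup by blast
  have "Z \<noteq> {\<one>}" using assms(2) by auto
  then obtain u where u: "u \<in> Z" "u \<noteq> \<one>" using subgroup.one_closed[OF Zs] by blast
  have uc: "u \<in> carrier G" using u Zs subgroup.mem_carrier by metis
  have "subgroup (generate G {u}) G" "generate G {u} \<subseteq> Z" "u \<in> generate G {u}"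
    using uc generate_is_subgroup[of "{u}"] generate_subgroup_incl[of "{u}" Z] Zs u by (auto intro: generate.incl)
  then have gen: "Z = generate G {u}" using prime_order_subgroup[OF Zs assms(2)] u by blast
  have pow: "\<exists>k::int. w = u [^] k" if "w \<in> Z" for w
    using that gen generate_pow[OF uc] by auto
  have conj_pow: "g \<otimes> (u [^] k) \<otimes> inv g = (g \<otimes> u \<otimes> inv g) [^] k" if "g \<in> carrier G" for g and k :: int
    using hom_int_pow[OF conjs_hom[OF that] uc is_group is_group] .
  have cl: "g \<otimes> u \<otimes> inv g \<in> Z" if "g \<in> carrier G" for g using assms(1) that u by (simp add: normal_iff)
  obtain a b k :: int where a: "x \<otimes> u \<otimes> inv x = u [^] a" and b: "y \<otimes> u \<otimes> inv y = u [^] b" and k: "z = u [^] k"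
    using pow[OF cl[OF assms(3)]] pow[OF cl[OF assms(4)]] pow[OF assms(5)] by blast
  have "x \<otimes> (y \<otimes> z \<otimes> inv y) \<otimes> inv x = u [^] (a * (b * k))"
    unfolding k conj_pow[OF assms(4)] b int_pow_pow[OF uc] conj_pow[OF assms(3)] a ..
  moreover have "y \<otimes> (x \<otimes> z \<otimes> inv x) \<otimes> inv y = u [^] (b * (a * k))"
    unfolding k conj_pow[OF assms(3)] a int_pow_pow[OF uc] conj_pow[OF assms(4)] b ..
  ultimately show ?thesis by (simp add: mult.left_commute)
qed

text \<open>Equivalently, G/C_G(H/K) is abelian: it acts faithfully on a group of prime
  order.\<close>

lemma commutator_centralizes_prime_factor:
  assumes "H \<lhd> G" "K \<lhd> G" "K \<subseteq> H" "Factorial_Ring.prime (card H div card K)"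
    and x: "x \<in> carrier G" and y: "y \<in> carrier G"
  shows "x \<otimes> y \<otimes> inv x \<otimes> inv y \<in> factor_centralizer G H K"
proof -
  have Hs: "subgroup H G" "subgroup K G" using assms normal_imp_subgroup by auto
  obtain Q :: "('a, 'b) monoid_scheme" and f where "fin_epi G Q f" and ker: "kernel G Q f = K"
    using ex_quotient[OF assms(2)] by blast
  then interpret E: fin_epi G Q f by simp
  let ?Z = "f ` H"
  have Z: "?Z \<lhd> Q" using E.normal_image[OF assms(1)] .
  have pZ: "Factorial_Ring.prime (card ?Z)" 
    using E.card_image_ker'[OF Hs(1)] ker assms(3,4) card_subgroup_pos[OF Hs(2)] by simp
  let ?w = "x \<otimes> y \<otimes> inv x \<otimes> inv y"
  have wc: "?w \<in> carrier G" using x y by simp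
  have "K #> (?w \<otimes> h \<otimes> inv ?w) = K #> h" if h: "h \<in> H" for h
  proof -
    have hc: "h \<in> carrier G" using h Hs subgroup.mem_carrier by metis
    \<comment> \<open>Chosen so that conjugating h by the commutator is conjugating ?z by y and then
      by x; the opposite order gives back h.\<close>
    let ?z = "inv x \<otimes> (inv y \<otimes> h \<otimes> y) \<otimes> x"
    have zH: "?z \<in> H" using normal.inv_op_closed1[OF assms(1) x] normal.inv_op_closed1[OF assms(1) y h] by blast
    have zc: "?z \<in> carrier G" using x y hc by simp
    have "?w \<otimes> h \<otimes> inv ?w = x \<otimes> (y \<otimes> ?z \<otimes> inv y) \<otimes> inv x"
      using x y hc by (simp add: inv_mult_group m_assoc)
    then have "f (?w \<otimes> h \<otimes> inv ?w) = f x \<otimes>\<^bsub>Q\<^esub> (f y \<otimes>\<^bsub>Q\<^esub> f ?z \<otimes>\<^bsub>Q\<^esub> inv\<^bsub>Q\<^esub> (f y)) \<otimes>\<^bsub>Q\<^esub> inv\<^bsub>Q\<^esub> (f x)"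
      using x y zc E.hom_mult E.hom_inv by (simp del: m_assoc)
    also have "\<dots> = f y \<otimes>\<^bsub>Q\<^esub> (f x \<otimes>\<^bsub>Q\<^esub> f ?z \<otimes>\<^bsub>Q\<^esub> inv\<^bsub>Q\<^esub> (f x)) \<otimes>\<^bsub>Q\<^esub> inv\<^bsub>Q\<^esub> (f y)"
      by (rule E.H.prime_order_conj_commute[OF Z pZ]) (use x y zH in auto)
    also have "\<dots> = f (y \<otimes> (x \<otimes> ?z \<otimes> inv x) \<otimes> inv y)" using x y zc by simp
    also have "y \<otimes> (x \<otimes> ?z \<otimes> inv x) \<otimes> inv y = h"
      using x y hc by (simp add: m_assoc mult_inv_cancel)
    finally have e: "f (?w \<otimes> h \<otimes> inv ?w) = f h" .
    let ?v = "?w \<otimes> h \<otimes> inv ?w"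
    have vc: "?v \<in> carrier G" using wc hc by simp
    have "f (?v \<otimes> inv h) = \<one>\<^bsub>Q\<^esub>" using e vc hc by (metis E.H.r_inv E.hom_closed E.hom_inv E.hom_mult inv_closed)
    then have "?v \<otimes> inv h \<in> K" using ker vc hc by (auto simp: kernel_def)
    then have "K #> (?v \<otimes> inv h) = K" using coset_join2[OF _ Hs(2)] vc hc by simp
    then have "K #> (?v \<otimes> inv h) #> h = K #> h" by simp
    then show ?thesis using vc hc subgroup.subset[OF Hs(2)] by (simp add: coset_mult_assoc m_assoc)
  qed
  then show ?thesis using wc by (simp add: factor_centralizer_def)
qed

end

context prime_partition begin

text \<open>For a prime p dividing |G : B|, let S be its block and T the S-complement over D. Then T
  B has a step of S-index to G, and it is proper: otherwise |G : B| would divide |T : D|, which is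
  prime to S.\<close>

lemma nilq_proper_subgroup_step:
  assumes "fin_group G" "nilq \<sigma> G D" "subgroup B G" "D \<subseteq> B" "B \<noteq> carrier G"
  obtains F where "subgroup F G" "B \<subseteq> F" "F \<noteq> carrier G" "sstep \<sigma> G F (carrier G)"
proof -
  interpret fin_group G by fact
  have Ds: "subgroup D G" using assms(2) normal_imp_subgroup by (auto simp: nilq_def)
  have Bc: "B \<subseteq> carrier G" using assms(3) subgroup.subset by blast
  have "card (carrier G) div card B \<noteq> 1" using index_1_imp_eq[OF assms(3) subgroup_self Bc] assms(5) by blast
  then obtain p where p: "Factorial_Ring.prime p" "p dvd card (carrier G) div card B" using prime_factor_nat by blast
  obtain S where S: "S \<in> \<sigma>" "p \<in> S" using block_ex[OF p(1)] by blast
  obtain T where T: "T \<lhd> G" "D \<subseteq> T" "pi_number (-S) (card T div card D)" "pi_number S (card (carrier G) div card T)"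
    using assms(2) S unfolding nilq_def by blast
  have Ts: "subgroup T G" using T normal_imp_subgroup by blast
  let ?F = "T <#>\<^bsub>G\<^esub> B"
  note F = card_set_mult_normal[OF T(1) assms(3)]
  have "?F \<noteq> carrier G"
  proof
    assume e: "?F = carrier G"
    have I: "subgroup (T \<inter> B) G" using subgroups_Inter_pair[OF Ts assms(3)] .
    have "card T div card (T \<inter> B) dvd card T div card D"
      by (rule index_dvd_mono(2)[OF Ds I Ts]) (use T assms in auto)
    then have "pi_number (-S) (card (carrier G) div card B)"
      using index_set_mult_normal'[OF T(1) assms(3) e] T(3) pi_number_dvd by metis
    then show False using p S(2) by (auto simp: pi_number_def primes_of_def)
  qed
  moreover have "sstep \<sigma> G ?F (carrier G)"
    unfolding sstep_def using F(2,3) subgroup_self subgroup.subset[OF F(2)] T(1,4) S(1) by auto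
  ultimately show ?thesis using that F by blast
qed

end

section \<open>Supplements of D and the complement M\<close>

locale HsigmaE = prime_partition + fin_group G for G :: "('a, 'b) monoid_scheme" (structure) +
  fixes D M
  assumes form: "HsigmaE_group_form \<sigma> G D M"
begin

lemma D_normal: "D \<lhd> G" and M_subgroup: "subgroup M G" and D_Int_M: "D \<inter> M = {\<one>}" and D_mult_M: "D <#> M = carrier G"
  using form by (auto simp: HsigmaE_group_form_def is_semidirect_def)

lemma D_subgroup: "subgroup D G" using D_normal normal_imp_subgroup by blast

lemma mult_above_M:
  assumes "subgroup A G" "M \<subseteq> A"
  shows "D <#> A = carrier G"
proof
  show "D <#> A \<subseteq> carrier G"
    using setmult_subset_G[of D A] subgroup.subset[OF D_subgroup] subgroup.subset[OF assms(1)] by blast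
  show "carrier G \<subseteq> D <#> A"
    unfolding D_mult_M[symmetric] using assms(2) by (auto simp: set_mult_def)
qed

lemma D_residual: "D = sigma_nilpotent_residual \<sigma> G"
  using form by (simp add: HsigmaE_group_form_def)

lemma D_nilq: "nilq \<sigma> G D" and D_least: "nilq \<sigma> G N \<Longrightarrow> D \<subseteq> N"
  using residual_props[OF fin_group_axioms] D_residual by auto

lemma card_M: "card M = card (carrier G) div card D"
  using card_set_mult_normal(1)[OF D_normal M_subgroup] D_Int_M D_mult_M card_subgroup_pos[OF D_subgroup]
  by simp

lemma D_Hall: "S \<in> \<sigma> \<Longrightarrow> pi_number (-S) (card D) \<or> pi_number (-S) (card M)"
  using form card_rcosets[OF D_subgroup] card_M
  by (auto simp: HsigmaE_group_form_def sigma_Hall_subgroup_def sigma_of_iff set_eq_iff)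

lemma D_coprime: "coprime (card D) (card (carrier G) div card D)"
proof (rule ccontr)
  assume "\<not> ?thesis"
  then obtain q where q: "Factorial_Ring.prime q" "q dvd card D" "q dvd card M"
    using prime_factor_nat[of "gcd (card D) (card M)"] card_M by (auto simp: coprime_iff_gcd_eq_1)
  obtain S where "S \<in> \<sigma>" "q \<in> S" using block_ex[OF q(1)] by blast
  then show False using D_Hall[of S] q by (auto simp: pi_number_def primes_of_def)
qed

lemma D_single:
  "S \<in> \<sigma> \<Longrightarrow> p \<in> S \<Longrightarrow> q \<in> S \<Longrightarrow> p \<in> primes_of (card D) \<Longrightarrow> q \<in> primes_of (card D) \<Longrightarrow> p = q"
proof -
  have "card (sigma_of \<sigma> (card D)) = card (primes_of (card D))"
    using form unfolding HsigmaE_group_form_def by (elim conjE)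
  then show "S \<in> \<sigma> \<Longrightarrow> p \<in> S \<Longrightarrow> q \<in> S \<Longrightarrow> p \<in> primes_of (card D) \<Longrightarrow> q \<in> primes_of (card D) \<Longrightarrow> p = q"
    using card_sigma_of_iff[OF card_subgroup_pos[OF D_subgroup]] by blast
qed

lemma D_tower: "\<exists>t C. tower_series (G\<lparr>carrier := D\<rparr>) t C"
  using form fin_group.has_Sylow_tower_iff[OF fin_group_subgroup[OF D_subgroup]] by (auto simp: HsigmaE_group_form_def)

lemma D_solvable: "solvable_in G D"
proof -
  obtain t C where "tower_series (G\<lparr>carrier := D\<rparr>) t C" using D_tower by blast
  then have s: "solvable_in (G\<lparr>carrier := D\<rparr>) D"
    using fin_group.tower_series_solvable[OF fin_group_subgroup[OF D_subgroup]] by fastforce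
  show ?thesis unfolding solvable_in_def
  proof (intro allI impI; elim conjE)
    fix A assume A: "subgroup A G" "A \<subseteq> D" "A \<noteq> {\<one>}"
    then have "derived (G\<lparr>carrier := D\<rparr>) A \<noteq> A"
      using s subgroup_incl[OF A(1) D_subgroup A(2)] by (auto simp: solvable_in_def)
    then show "derived G A \<noteq> A" using derived_consistent[OF A(2) D_subgroup] by simp
  qed
qed

lemma irreducible:
  assumes "Factorial_Ring.prime p" "p dvd card D" "subgroup P G" "P \<subseteq> D" "card P = p ^ multiplicity p (card D)"
    "M \<subseteq> norm_of P" and R: "subgroup R G" "R \<subseteq> P" "M \<subseteq> norm_of R"
  shows "R = {\<one>} \<or> R = P"
proof -
  have Mc: "M \<subseteq> carrier G" "P \<subseteq> carrier G" "R \<subseteq> carrier G" using M_subgroup assms R subgroup.subset by blast+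
  have "sylow_subgroup p (G\<lparr>carrier := D\<rparr>) P"
    using assms subgroup_incl[OF assms(3) D_subgroup assms(4)] by (simp add: sylow_subgroup_def order_def primes_of_def)
  moreover have "conj_invariant G M P" "conj_invariant G M R" using conj_invariant_iff Mc assms(6) R(3) by auto
  ultimately show ?thesis using form R unfolding HsigmaE_group_form_def acts_irreducibly_def by blast
qed

lemma eccentric: "chief_factor G H K \<Longrightarrow> H \<subseteq> D \<Longrightarrow> \<not> sigma_central_factor \<sigma> G H K"
  using form by (auto simp: HsigmaE_group_form_def)

text \<open>An M-invariant Sylow p-subgroup of D \<inter> A lies in an M-invariant Sylow p-subgroup
  of D, and irreducibility makes them equal.\<close>

lemma supplement_above_M:
  assumes A: "subgroup A G" "M \<subseteq> A" and p: "Factorial_Ring.prime p" "p dvd card (D \<inter> A)"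
  obtains P where "subgroup P G" "P \<subseteq> D \<inter> A" "card P = p ^ multiplicity p (card D)" "M \<subseteq> norm_of P"
    "multiplicity p (card (D \<inter> A)) = multiplicity p (card D)"
proof -
  interpret A: fin_group "G\<lparr>carrier := A\<rparr>" by (rule fin_group_subgroup[OF A(1)])
  let ?E = "D \<inter> A"
  have E: "subgroup ?E G" using subgroups_Inter_pair[OF D_subgroup A(1)] .
  have DA: "D <#> A = carrier G" by (rule mult_above_M[OF A(1,2)])
  have i: "card A div card ?E = card (carrier G) div card D"
    by (rule index_set_mult_normal[OF fin_group_axioms D_normal A(1) DA])
  have ED: "card ?E dvd card D" using card_subgroup_dvd_subgroup[OF E D_subgroup] by simp
  have cop: "coprime (card ?E) (card A div card ?E)" using D_coprime i ED by (metis coprime_divisors dvd_refl)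
  have n: "?E \<lhd> G\<lparr>carrier := A\<rparr>" using normal_Int_subgroup[OF A(1) D_normal] by (simp add: Int_commute)
  have solv: "solvable_in (G\<lparr>carrier := A\<rparr>) ?E" using solvable_in_subgroup[OF D_solvable A(1)] by simp
  obtain Q where Q0: "subgroup Q (G\<lparr>carrier := A\<rparr>)" "Q \<subseteq> ?E" "card Q = p ^ multiplicity p (card ?E)" "M \<subseteq> A.norm_of Q"
    using A.invariant_sylow_exists[of ?E M p] n cop solv subgroup_incl[OF M_subgroup A(1,2)] card_M i p by auto
  have Q: "subgroup Q G" "M \<subseteq> norm_of Q" "Q \<subseteq> D" using Q0 incl_subgroup[OF A(1)] norm_of_sub[OF A(1)] by auto
  have "multiplicity p (card ?E) > 0" using p card_subgroup_pos[OF E]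
    by (metis multiplicity_gt_zero_iff not_prime_unit less_numeral_extra(3))
  then have "p dvd card Q" using Q0(3) by simp
  then have Q1: "Q \<noteq> {\<one>}" using p(1) not_prime_1 by (metis card_eq_1_iff Q(1) nat_dvd_1_iff_1)
  obtain P where P: "subgroup P G" "P \<subseteq> D" "card P = p ^ multiplicity p (card D)" "M \<subseteq> norm_of P" "Q \<subseteq> P"
    using invariant_p_subgroup_in_sylow[OF D_normal D_coprime D_solvable M_subgroup card_M p(1) Q(1,3) Q0(3) Q(2)] by metis
  have "Q = P" using irreducible[OF p(1) _ P(1-4) Q(1) P(5) Q(2)] Q1 p(2) ED dvd_trans by blast
  then have "multiplicity p (card ?E) = multiplicity p (card D)"
    using Q0(3) P(3) p(1) by (metis multiplicity_same_power not_prime_0 not_prime_unit)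
  then show ?thesis using that P Q0 \<open>Q = P\<close> by blast
qed

lemma Hall_of_supplement:
  assumes A: "subgroup A G" "D <#> A = carrier G" and S: "S \<in> \<sigma>"
  shows "pi_number (-S) (card A) \<or> pi_number (-S) (card (carrier G) div card A)"
proof -
  interpret A: fin_group "G\<lparr>carrier := A\<rparr>" by (rule fin_group_subgroup[OF A(1)])
  let ?E = "D \<inter> A"
  have E: "subgroup ?E G" using subgroups_Inter_pair[OF D_subgroup A(1)] .
  have i: "card A div card ?E = card (carrier G) div card D"
    by (rule index_set_mult_normal[OF fin_group_axioms D_normal A])
  have ED: "card ?E dvd card D" using card_subgroup_dvd_subgroup[OF E D_subgroup] by simp
  have cop: "coprime (card ?E) (card A div card ?E)" using D_coprime i ED by (metis coprime_divisors dvd_refl)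
  have n: "?E \<lhd> G\<lparr>carrier := A\<rparr>" using normal_Int_subgroup[OF A(1) D_normal] by (simp add: Int_commute)
  obtain M' where "subgroup M' (G\<lparr>carrier := A\<rparr>)" "card M' = card (carrier G) div card D"
    using schur_zassenhaus_exists[OF A.fin_group_axioms n] cop i by auto
  then have M': "subgroup M' G" "M' \<subseteq> A" "card M' = card (carrier G) div card D"
    using incl_subgroup[OF A(1)] subgroup.subset by fastforce+
  obtain g where g: "g \<in> carrier G" "conjs g M' = M"
    using schur_zassenhaus_conj[OF fin_group_axioms D_normal D_coprime D_solvable M'(1,3) M_subgroup card_M] by blast
  have Ac: "A \<subseteq> carrier G" using A(1) subgroup.subset by blast
  \<comment> \<open>The conjugate of A that contains M; orders and indices are those of A.\<close>
  define B where "B = conjs g A"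
  have B: "subgroup B G" "M \<subseteq> B" "card B = card A"
    using conjs_subgroup[OF g(1) A(1)] conjs_mono[OF M'(2), of g] g(2) conjs_card[OF g(1) Ac] by (auto simp: B_def)
  have DB: "D <#> B = carrier G" by (rule mult_above_M[OF B(1,2)])
  have F: "subgroup (D \<inter> B) G" using subgroups_Inter_pair[OF D_subgroup B(1)] .
  have iB: "card (carrier G) div card B = card D div card (D \<inter> B)"
    by (rule index_set_mult_normal'[OF D_normal B(1) DB])
  have iB': "card B div card (D \<inter> B) = card M"
    using index_set_mult_normal[OF fin_group_axioms D_normal B(1) DB] card_M by simp
  have cB: "card B = card (D \<inter> B) * card M" using card_index[OF F B(1)] iB' by simp
  have cD: "card D = card (D \<inter> B) * (card D div card (D \<inter> B))" using card_index[OF F D_subgroup] by simp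
  show ?thesis
  proof (rule ccontr)
    assume "\<not> ?thesis"
    then have "\<not> pi_number (-S) (card B)" "\<not> pi_number (-S) (card D div card (D \<inter> B))" using B(3) iB by auto
    \<comment> \<open>p divides |D|, so M is prime to S and q divides |D \<inter> B|; one prime per
      block gives p = q. But D \<inter> B contains the full p-part of D, so p cannot divide its
      index.\<close>
    then obtain p q where p: "p \<in> S" "p \<in> primes_of (card D div card (D \<inter> B))"
      and q: "q \<in> S" "q \<in> primes_of (card B)" by (auto simp: pi_number_def)
    have pD: "p \<in> primes_of (card D)" using p(2) cD primes_of_mult by (metis UnI2)
    then have "\<not> pi_number (-S) (card D)" using p(1) by (auto simp: pi_number_def)
    then have "q \<notin> primes_of (card M)" using D_Hall[OF S] q(1) by (auto simp: pi_number_def)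
    then have qF: "q \<in> primes_of (card (D \<inter> B))" using q(2) cB primes_of_mult by (metis UnE)
    then have "q \<in> primes_of (card D)" using cD primes_of_mult by (metis UnI1)
    then have "p = q" using D_single[OF S p(1) q(1) pD] by simp
    then have pF: "Factorial_Ring.prime p" "p dvd card (D \<inter> B)" using qF by (auto simp: primes_of_def)
    obtain P where "multiplicity p (card (D \<inter> B)) = multiplicity p (card D)"
      using supplement_above_M[OF B(1,2) pF] by metis
    then have "multiplicity p (card D div card (D \<inter> B)) = 0"
      using multiplicity_card_index[OF F D_subgroup _ pF(1)] by simp
    moreover have "card D div card (D \<inter> B) \<noteq> 0" using index_pos[OF F D_subgroup] by simp
    moreover have "p dvd card D div card (D \<inter> B)" using p(2) by (simp add: primes_of_def)
    ultimately show False using pF(1) by (metis multiplicity_gt_zero_iff not_prime_unit less_irrefl)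
  qed
qed

text \<open>M is a copy of G/D; intersecting the witnesses for G/D with M avoids naming the
  isomorphism.\<close>

lemma M_nilpotent: "sigma_nilpotent \<sigma> (G\<lparr>carrier := M\<rparr>)"
proof -
  interpret M: fin_group "G\<lparr>carrier := M\<rparr>" by (rule fin_group_subgroup[OF M_subgroup])
  have "nilq \<sigma> (G\<lparr>carrier := M\<rparr>) {\<one>\<^bsub>G\<lparr>carrier := M\<rparr>\<^esub>}" unfolding nilq_def
  proof (intro conjI ballI M.one_is_normal)
    fix S assume "S \<in> \<sigma>"
    then obtain T where T: "T \<lhd> G" "D \<subseteq> T" "pi_number (-S) (card T div card D)" "pi_number S (card (carrier G) div card T)"
      using D_nilq unfolding nilq_def by blast
    have Ts: "subgroup T G" using T normal_imp_subgroup by blast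
    have I: "subgroup (T \<inter> M) G" using subgroups_Inter_pair[OF Ts M_subgroup] .
    have "card M div card (T \<inter> M) dvd card (carrier G) div card T" by (rule index_Int_dvd[OF T(1) M_subgroup])
    moreover have "D \<inter> (T \<inter> M) = {\<one>}" using D_Int_M subgroup.one_closed[OF I] subgroup.one_closed[OF D_subgroup] by blast
    then have "card (T \<inter> M) dvd card T div card D"
      using index_Int_dvd_in[OF normal_in_subgroup[OF D_normal Ts T(2)] Ts I] by simp
    moreover have "T \<inter> M \<lhd> G\<lparr>carrier := M\<rparr>" using normal_Int_subgroup[OF M_subgroup T(1)] by (simp add: Int_commute)
    ultimately show "\<exists>T. T \<lhd> G\<lparr>carrier := M\<rparr> \<and> {\<one>\<^bsub>G\<lparr>carrier := M\<rparr>\<^esub>} \<subseteq> T \<and>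
        pi_number (-S) (card T div card {\<one>\<^bsub>G\<lparr>carrier := M\<rparr>\<^esub>}) \<and> pi_number S (card (carrier (G\<lparr>carrier := M\<rparr>)) div card T)"
      using T(3,4) pi_number_dvd subgroup.one_closed[OF I] by (intro exI[of _ "T \<inter> M"]) auto
  qed
  then show ?thesis using sigma_nilpotent_iff[OF M.fin_group_axioms] by blast
qed

text \<open>
  If \<open>M\<close> centralized a Sylow subgroup of order \<open>p\<close> of \<open>D\<close>, it would centralize the tower factor
  \<open>H/K\<close> of order \<open>p\<close>.  Since \<open>G/C\<^sub>G(H/K)\<close> is abelian, \<open>D\<close> centralizes it as well, so
  \<open>H/K\<close> would be a \<sigma>-central chief factor.
\<close>

lemma M_not_centralizing_sylow:
  assumes p: "Factorial_Ring.prime p" "p dvd card D" "multiplicity p (card D) = 1"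
    and P: "subgroup P G" "P \<subseteq> D" "card P = p"
    and comm: "\<And>m x. m \<in> M \<Longrightarrow> x \<in> P \<Longrightarrow> m \<otimes> x = x \<otimes> m"
  shows False
proof -
  have Mc: "m \<in> carrier G" if "m \<in> M" for m using that M_subgroup subgroup.mem_carrier by metis
  obtain t C where C: "tower_series (G\<lparr>carrier := D\<rparr>) t C" using D_tower by blast
  have C0: "C 0 = {\<one>}" "C t = D" using C by (auto simp: tower_series_def)
  have Cn: "C i \<lhd> G\<lparr>carrier := D\<rparr>" "coprime (card (C i)) (card D div card (C i))" if "i \<le> t" for i
    using C that by (auto simp: tower_series_def)
  have CG: "C i \<lhd> G" if "i \<le> t" for i by (rule normal_Hall_trans[OF D_normal Cn[OF that]])
  have Cs: "subgroup (C i) G" if "i \<le> t" for i using CG[OF that] normal_imp_subgroup by blast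
  have step: "C i \<subset> C (Suc i)" if "i < t" for i using C that by (auto simp: tower_series_def)
  have fac: "\<exists>q\<in>primes_of (card D). card (C (Suc i)) div card (C i) = q ^ multiplicity q (card D)" if "i < t" for i
    using C that unfolding tower_series_def by simp
  \<comment> \<open>Some tower factor involves p; it has Sylow order, so it equals p, since p
    divides |D| only once.\<close>
  have "\<exists>i<t. p dvd card (C (Suc i)) div card (C i)"
  proof (rule ccontr)
    assume no: "\<not> ?thesis"
    have "\<not> p dvd card (C i)" if "i \<le> t" for i
      using that
    proof (induction i)
      case 0
      then show ?case using C0(1) p(1) not_prime_unit[of p] by auto
    next
      case (Suc i)
      have "card (C (Suc i)) = card (C i) * (card (C (Suc i)) div card (C i))"
        by (rule card_index) (use Suc.prems Cs step[of i] in auto)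
      then show ?case using Suc no p(1) by (metis Suc_le_lessD prime_dvd_mult_iff less_imp_le_nat)
    qed
    from this[of t] show False using C0 p(2) by simp
  qed
  then obtain i where i: "i < t" "p dvd card (C (Suc i)) div card (C i)" by blast
  obtain q where q: "q \<in> primes_of (card D)" "card (C (Suc i)) div card (C i) = q ^ multiplicity q (card D)"
    using fac[OF i(1)] by blast
  have "q = p" using i(2) q p(1) by (metis (no_types, lifting) mem_Collect_eq primes_of_def prime_dvd_power primes_dvd_imp_eq)
  then have ip: "card (C (Suc i)) div card (C i) = p" using q(2) p(3) by simp
  let ?H = "C (Suc i)" and ?K = "C i"
  have H: "?H \<lhd> G" "subgroup ?H G" "?H \<subseteq> D" using CG Cs i normal_in_imp(2)[OF Cn(1) D_subgroup, of "Suc i"] by auto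
  have K: "?K \<lhd> G" "subgroup ?K G" using CG Cs i by auto
  have KH: "?K \<subseteq> ?H" "?K \<subset> ?H" using step[OF i(1)] by auto
  have cH: "card ?H = card ?K * p" using card_index[OF K(2) H(2) KH(1)] ip by simp
  have npK: "\<not> p dvd card ?K"
  proof
    assume a: "p dvd card ?K"
    have "card ?H div card ?K dvd card D div card ?K"
      by (rule index_dvd_mono(1)[OF K(2) H(2) D_subgroup KH(1) H(3)])
    then have "p dvd card D div card ?K" using ip by simp
    then show False using Cn(2)[of i] i(1) a p(1) by (metis coprime_common_divisor_nat less_imp_le_nat not_prime_1)
  qed
  have npH: "\<not> p dvd card D div card ?H"
    using Cn(2)[of "Suc i"] i(1) cH p(1) by (metis Suc_leI coprime_common_divisor_nat dvd_triv_right not_prime_1)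
  have I: "subgroup (?H \<inter> P) G" "subgroup (?K \<inter> P) G" using subgroups_Inter_pair H K P by auto
  \<comment> \<open>Both terms are Hall subgroups of D: P lies in the upper one, whose index is
    prime to p, and meets the lower one, whose order is prime to p, trivially.\<close>
  have PH: "P \<subseteq> ?H"
  proof -
    have "?H \<inter> P = {\<one>} \<or> ?H \<inter> P = P" using prime_order_subgroup[OF P(1) _ I(1)] P(3) p(1) by simp
    moreover have "?H \<inter> P \<noteq> {\<one>}"
    proof
      assume "?H \<inter> P = {\<one>}"
      then have "p dvd card D div card ?H"
        using index_Int_dvd_in[OF Cn(1)[of "Suc i"] D_subgroup P(1,2)] i(1) P(3) by simp
      then show False using npH by simp
    qed
    ultimately show ?thesis by blast
  qed
  have KP: "?K \<inter> P = {\<one>}"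
  proof -
    have "?K \<inter> P = {\<one>} \<or> ?K \<inter> P = P" using prime_order_subgroup[OF P(1) _ I(2)] P(3) p(1) by simp
    moreover have "?K \<inter> P \<noteq> P" using card_subgroup_dvd_subgroup[OF I(2) K(2)] npK P(3) by auto
    ultimately show ?thesis by blast
  qed
  note KPm = card_set_mult_normal[OF K(1) P(1)]
  have "card (?K <#> P) = card ?H" using KPm(1) KP cH P(3) by simp
  then have HKP: "?K <#> P = ?H"
    using card_eq_imp_eq[OF KPm(2) H(2) set_mult_subset_subgroup[OF H(2) KH(1) PH]] by simp
  have chief: "chief_factor G ?H ?K"
    unfolding chief_factor_def
  proof (intro conjI H K KH notI)
    assume "\<exists>L. L \<lhd> G \<and> ?K \<subset> L \<and> L \<subset> ?H"
    then obtain L where L: "L \<lhd> G" "?K \<subset> L" "L \<subset> ?H" by blast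
    have Ls: "subgroup L G" using L normal_imp_subgroup by blast
    have "p = (card ?H div card L) * (card L div card ?K)" using index_mult[OF K(2) Ls H(2)] L ip by auto
    then have "card ?H div card L = 1 \<or> card L div card ?K = 1" using p(1) by (metis prime_product)
    then show False using index_1_imp_eq[OF Ls H(2)] index_1_imp_eq[OF K(2) Ls] L by blast
  qed
  let ?C = "factor_centralizer G ?H ?K"
  have Csub: "subgroup ?C G" using factor_centralizer_normal[OF H(1) K(1) KH(1)] normal_imp_subgroup by blast
  \<comment> \<open>Modulo K every element of H is represented in P, which M centralizes.\<close>
  have MC: "M \<subseteq> ?C"
  proof
    fix m assume m: "m \<in> M"
    have mc: "m \<in> carrier G" using Mc[OF m] .
    have "?K #> (m \<otimes> h \<otimes> inv m) = ?K #> h" if h: "h \<in> ?H" for h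
    proof -
      have "h \<in> ?K <#> P" using h HKP by simp
      then obtain k x where kx: "k \<in> ?K" "x \<in> P" "h = k \<otimes> x" by (auto simp: set_mult_def)
      have c: "k \<in> carrier G" "x \<in> carrier G" using kx K(2) P(1) subgroup.mem_carrier by metis+
      have k': "m \<otimes> k \<otimes> inv m \<in> ?K" using K(1) mc kx(1) by (simp add: normal_iff)
      have k'c: "m \<otimes> k \<otimes> inv m \<in> carrier G" using mc c by simp
      have "m \<otimes> h \<otimes> inv m = (m \<otimes> k \<otimes> inv m) \<otimes> (m \<otimes> x \<otimes> inv m)"
        unfolding kx(3) using mc c by (simp add: m_assoc mult_inv_cancel)
      also have "m \<otimes> x \<otimes> inv m = x" using comm[OF m kx(2)] mc c by (simp add: m_assoc)
      finally have "m \<otimes> h \<otimes> inv m = (m \<otimes> k \<otimes> inv m) \<otimes> x" .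
      moreover have "?K #> (j \<otimes> x) = ?K #> x" if "j \<in> ?K" "j \<in> carrier G" for j
        using coset_mult_assoc[OF subgroup.subset[OF K(2)] that(2) c(2)] coset_join2[OF that(2) K(2) that(1)] by simp
      ultimately show ?thesis using k' k'c kx c by simp
    qed
    then show "m \<in> ?C" using mc by (simp add: factor_centralizer_def)
  qed
  \<comment> \<open>Otherwise a maximal proper L above C contains all commutators, so it is normal
    of prime index. As G/L is \<sigma>-primary, D lies in L, and so does M; but D M = G.\<close>
  have "?C = carrier G"
  proof (rule ccontr)
    assume "?C \<noteq> carrier G"
    let ?P = "\<lambda>L. subgroup L G \<and> ?C \<subseteq> L \<and> L \<noteq> carrier G"
    have "?P ?C" using Csub \<open>?C \<noteq> carrier G\<close> by simp
    then obtain L where L': "?P L" and max: "\<And>F. ?P F \<Longrightarrow> card F \<le> card L"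
      using ex_max_subgroup[of ?P ?C] by blast
    then have L: "subgroup L G" "?C \<subseteq> L" "L \<noteq> carrier G" by simp_all
    have Ln: "L \<lhd> G" unfolding normal_iff
    proof (intro conjI ballI L(1))
      fix x l assume x: "x \<in> carrier G" and l: "l \<in> L"
      have lc: "l \<in> carrier G" using l L(1) subgroup.mem_carrier by metis
      have "x \<otimes> l \<otimes> inv x \<otimes> inv l \<in> L"
        using commutator_centralizes_prime_factor[OF H(1) K(1) KH(1) _ x lc] ip p(1) L(2) by auto
      then have "(x \<otimes> l \<otimes> inv x \<otimes> inv l) \<otimes> l \<in> L" using l L(1) by (simp add: subgroup.m_closed)
      then show "x \<otimes> l \<otimes> inv x \<in> L" using x lc by (simp add: m_assoc)
    qed
    obtain Q :: "('a, 'b) monoid_scheme" and f where "fin_epi G Q f" and ker: "kernel G Q f = L"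
      using ex_quotient[OF Ln] by blast
    then interpret E: fin_epi G Q f by simp
    have cQ: "card (carrier Q) = card (carrier G) div card L"
      using E.card_carrier ker card_subgroup_pos[OF L(1)] by simp
    then have "card (carrier Q) \<noteq> 1"
      using index_1_imp_eq[OF L(1) subgroup_self subgroup.subset[OF L(1)]] L(3) by auto
    then obtain r where r: "Factorial_Ring.prime r" "r dvd card (carrier Q)" using prime_factor_nat by blast
    obtain R where R: "subgroup R Q" "card R = r" using E.H.cauchy[OF r] by blast
    have cR: "card (E.pre R) = r * card L" using E.card_pre[OF R(1)] R(2) ker by simp
    have "E.pre R = carrier G"
    proof (rule ccontr)
      assume "E.pre R \<noteq> carrier G"
      moreover have "?C \<subseteq> E.pre R" using E.ker_subset_pre[OF R(1)] ker L(2) by blast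
      ultimately have "card (E.pre R) \<le> card L" using max E.subgroup_pre[OF R(1)] by blast
      then show False using cR card_subgroup_pos[OF L(1)] prime_gt_1_nat[OF r(1)] by simp
    qed
    then have iL: "card (carrier G) div card L = r" using cR card_subgroup_pos[OF L(1)] by simp
    obtain S where S: "S \<in> \<sigma>" "r \<in> S" using block_ex[OF r(1)] by blast
    have "pi_number S (card (carrier G) div card L)"
      unfolding iL using pi_number_prime_power[OF r(1), of 1] S(2) by (auto simp: pi_number_def)
    then have "D \<subseteq> L" using D_least[OF nilq_primary[OF fin_group_axioms Ln S(1)]] by blast
    then have "carrier G \<subseteq> L" using set_mult_subset_subgroup[OF L(1)] D_mult_M MC L(2) by blast
    then show False using L subgroup.subset by blast
  qed
  moreover obtain S where S: "S \<in> \<sigma>" "p \<in> S" using block_ex[OF p(1)] by blast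
  moreover have "pi_number S p" using pi_number_prime_power[OF p(1), of 1] S(2) by (auto simp: pi_number_def)
  ultimately have "sigma_central_factor \<sigma> G ?H ?K"
    unfolding sigma_central_factor_iff[OF H(1) K(1) KH(1)] using ip card_carrier_pos by auto
  then show False using eccentric[OF chief H(3)] by simp
qed

text \<open>If N M has an index in E divisible by p, the subgroup T over N with E/T the S-part of
  E/N separates M from p: it contains M but meets an M-invariant Sylow p-subgroup of D
  trivially.\<close>

lemma M_Carter: "sigma_Carter_subgroup \<sigma> G M"
  unfolding sigma_Carter_subgroup_def
proof (intro conjI M_subgroup M_nilpotent allI impI; elim conjE)
  fix E N assume E: "subgroup E G" "M \<subseteq> E" and N: "N \<lhd> G\<lparr>carrier := E\<rparr>"
    and nil: "sigma_nilpotent \<sigma> (G\<lparr>carrier := E\<rparr> Mod N)"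
  interpret E: fin_group "G\<lparr>carrier := E\<rparr>" by (rule fin_group_subgroup[OF E(1)])
  have nq: "nilq \<sigma> (G\<lparr>carrier := E\<rparr>) N" using E.sigma_nilpotent_Mod_iff[OF prime_partition_axioms N] nil by blast
  note N' = normal_in_imp[OF N E(1)]
  have ME: "subgroup M (G\<lparr>carrier := E\<rparr>)" using subgroup_incl[OF M_subgroup E] .
  let ?F = "N <#> M"
  have F: "subgroup ?F G" "?F \<subseteq> E" "N \<subseteq> ?F" "M \<subseteq> ?F"
    using E.card_set_mult_normal[OF N ME] incl_subgroup[OF E(1)] subgroup.subset[of ?F "G\<lparr>carrier := E\<rparr>"] by auto
  show "E = ?F"
  proof (rule ccontr)
    assume ne: "E \<noteq> ?F"
    have "card E div card ?F \<noteq> 1" using index_1_imp_eq[OF F(1) E(1) F(2)] ne by blast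
    then obtain p where p: "Factorial_Ring.prime p" "p dvd card E div card ?F" using prime_factor_nat by blast
    obtain S where S: "S \<in> \<sigma>" "p \<in> S" using block_ex[OF p(1)] by blast
    obtain T where T: "T \<lhd> G\<lparr>carrier := E\<rparr>" "N \<subseteq> T" "pi_number (-S) (card T div card N)" "pi_number S (card E div card T)"
      using nq S(1) unfolding nilq_def by auto
    note T' = normal_in_imp[OF T(1) E(1)]
    let ?D = "D \<inter> E"
    have D0: "subgroup ?D G" using subgroups_Inter_pair[OF D_subgroup E(1)] .
    have DE: "D <#> E = carrier G" by (rule mult_above_M[OF E])
    have iE: "card E div card ?D = card M"
      using index_set_mult_normal[OF fin_group_axioms D_normal E(1) DE] card_M by simp
    have cE: "card E = card ?D * card M" using card_index[OF D0 E(1)] iE by simp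
    have "card E div card ?F dvd card E div card M"
      by (rule index_dvd_mono(2)[OF M_subgroup F(1) E(1) F(4,2)])
    also have "card E div card M = card ?D" using cE card_subgroup_pos[OF M_subgroup] by simp
    finally have pD0: "p dvd card ?D" using p(2) dvd_trans by blast
    have "card ?D dvd card D" using card_subgroup_dvd_subgroup[OF D0 D_subgroup] by simp
    then have pD: "p dvd card D" using pD0 dvd_trans by blast
    then have "\<not> pi_number (-S) (card D)" using p(1) S(2) by (auto simp: pi_number_def primes_of_def)
    then have Mp: "pi_number (-S) (card M)" using D_Hall[OF S(1)] by blast
    \<comment> \<open>|M| is prime to S, because p in S divides |D| and D is \<sigma>-Hall; E/T is
      an S-group.\<close>
    have MT: "M \<subseteq> T"
    proof -
      have I: "subgroup (T \<inter> M) G" using subgroups_Inter_pair[OF T'(1) M_subgroup] .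
      have "card M div card (T \<inter> M) dvd card E div card T" by (rule index_Int_dvd_in[OF T(1) E(1) M_subgroup E(2)])
      moreover have "card M div card (T \<inter> M) dvd card M" using card_index[OF I M_subgroup] by (metis dvd_triv_right inf_le2)
      ultimately have "card M div card (T \<inter> M) = 1" using T(4) Mp pi_number_dvd pi_number_both by blast
      then have "T \<inter> M = M" using index_1_imp_eq[OF I M_subgroup] by blast
      then show ?thesis by blast
    qed
    have FT: "?F \<subseteq> T" using set_mult_subset_subgroup[OF T'(1) T(2) MT] .
    have pT: "p dvd card E div card T"
    proof -
      have "card E div card ?F = (card E div card T) * (card T div card ?F)"
        by (rule index_mult[OF F(1) T'(1) E(1) FT T'(2)])
      moreover have "card T div card ?F dvd card T div card N" by (rule index_dvd_mono(2)[OF N'(1) F(1) T'(1) F(3) FT])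
      then have "pi_number (-S) (card T div card ?F)" using T(3) pi_number_dvd by blast
      then have "\<not> p dvd card T div card ?F" using p(1) S(2) by (auto simp: pi_number_def primes_of_def)
      ultimately show ?thesis using p by (metis prime_dvd_mult_iff)
    qed
    obtain P where P: "subgroup P G" "P \<subseteq> ?D" "card P = p ^ multiplicity p (card D)" "M \<subseteq> norm_of P"
      "multiplicity p (card ?D) = multiplicity p (card D)"
      using supplement_above_M[OF E p(1) pD0] by metis
    note irr = irreducible[OF p(1) pD P(1) _ P(3,4)]
    have PD: "P \<subseteq> D" using P(2) by blast
    have Pc: "x \<in> carrier G" if "x \<in> P" for x using that P(1) subgroup.mem_carrier by metis
    have Mc: "x \<in> carrier G" if "x \<in> M" for x using that M_subgroup subgroup.mem_carrier by metis
    have MP: "m \<otimes> x \<otimes> inv m \<in> P" if "m \<in> M" "x \<in> P" for m x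
      using that P(4) by (auto simp: norm_of_def conjs_def)
    have PT: "subgroup (P \<inter> T) G" using subgroups_Inter_pair[OF P(1) T'(1)] .
    have "M \<subseteq> norm_of (P \<inter> T)"
    proof
      fix m assume m: "m \<in> M"
      show "m \<in> norm_of (P \<inter> T)"
        by (rule norm_ofI[OF Mc[OF m] PT]) (use MP m MT E(2) T'(3) in auto)
    qed
    then have "P \<inter> T = {\<one>} \<or> P \<inter> T = P" using irr[OF PD PT] by simp
    \<comment> \<open>p divides |E : T|, whereas P already accounts for the whole p-part of |E|, as
      |M| is prime to p.\<close>
    moreover have "P \<inter> T \<noteq> P"
    proof
      assume "P \<inter> T = P"
      then have "card P dvd card T" using card_subgroup_dvd_subgroup[OF P(1) T'(1)] by blast
      then have "card P * p dvd card T * (card E div card T)" using pT by (rule mult_dvd_mono)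
      then have "p ^ Suc (multiplicity p (card D)) dvd card E" using card_index[OF T'(1) E(1) T'(2)] P(3) by (simp add: mult.commute)
      moreover have "card E \<noteq> 0" using card_subgroup_pos[OF E(1)] by simp
      moreover have "\<not> is_unit p" using p(1) not_prime_unit by blast
      ultimately have le: "Suc (multiplicity p (card D)) \<le> multiplicity p (card E)" by (metis multiplicity_geI)
      have "\<not> p dvd card M" using Mp p(1) S(2) by (auto simp: pi_number_def primes_of_def)
      then have "multiplicity p (card E) = multiplicity p (card ?D)"
        using multiplicity_card_index[OF D0 E(1) _ p(1)] iE by (simp add: not_dvd_imp_multiplicity_0)
      then show False using le P(5) by simp
    qed
    ultimately have PT1: "P \<inter> T = {\<one>}" by blast
    \<comment> \<open>The commutator lies in T, which is normal in E and contains M, and in P, which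
      M normalizes.\<close>
    have comm: "m \<otimes> x = x \<otimes> m" if m: "m \<in> M" and x: "x \<in> P" for m x
    proof -
      have c: "m \<in> carrier G" "x \<in> carrier G" using m x Mc Pc by auto
      let ?c = "x \<otimes> m \<otimes> inv x \<otimes> inv m"
      have "x \<otimes> m \<otimes> inv x \<in> T" using T'(3)[of x m] x m P(2) MT by blast
      then have "?c \<in> T" using m MT T'(1) by (auto simp: subgroup.m_closed subgroup.m_inv_closed)
      moreover have "x \<otimes> (m \<otimes> inv x \<otimes> inv m) \<in> P"
        using MP[OF m, of "inv x"] x P(1) by (simp add: subgroup.m_closed subgroup.m_inv_closed)
      then have "?c \<in> P" using c by (simp add: m_assoc)
      ultimately have "?c = \<one>" using PT1 by blast
      then have "(x \<otimes> m) \<otimes> inv (m \<otimes> x) = \<one>" using c by (simp add: m_assoc inv_mult_group)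
      then have "x \<otimes> m = m \<otimes> x" using c inv_equality[of "x \<otimes> m" "inv (m \<otimes> x)"] by simp
      then show ?thesis by simp
    qed
    have m0: "multiplicity p (card D) > 0" using p(1) pD card_subgroup_pos[OF D_subgroup]
      by (metis multiplicity_gt_zero_iff not_prime_unit less_numeral_extra(3))
    then have pP: "p dvd card P" using P(3) by simp
    interpret P: fin_group "G\<lparr>carrier := P\<rparr>" by (rule fin_group_subgroup[OF P(1)])
    \<comment> \<open>M centralizes P, so a subgroup of order p is M-invariant, and irreducibility
      makes it all of P.\<close>
    obtain R where R0: "subgroup R (G\<lparr>carrier := P\<rparr>)" "card R = p" using P.cauchy[OF p(1)] pP by auto
    have R: "subgroup R G" "R \<subseteq> P" using R0 incl_subgroup[OF P(1)] subgroup.subset[OF R0(1)] by auto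
    have "M \<subseteq> norm_of R"
    proof
      fix m assume m: "m \<in> M"
      show "m \<in> norm_of R"
      proof (rule norm_ofI[OF Mc[OF m] R(1)])
        fix x assume x: "x \<in> R"
        have "m \<otimes> x \<otimes> inv m = x" using comm[OF m, of x] x R(2) Mc[OF m] Pc by (auto simp: m_assoc)
        then show "m \<otimes> x \<otimes> inv m \<in> R" using x by simp
      qed
    qed
    then have "R = {\<one>} \<or> R = P" using irr[OF PD R] by blast
    moreover have "R \<noteq> {\<one>}" using R0(2) p(1) by auto
    ultimately have cP: "card P = p" using R0(2) by blast
    then have "p ^ multiplicity p (card D) = p ^ 1" using P(3) by simp
    then have "multiplicity p (card D) = 1" using p(1) prime_gt_1_nat power_inject_exp by blast
    then show False using M_not_centralizing_sylow[OF p(1) pD _ P(1) PD cP comm] by blast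
  qed
qed

end

lemma (in prime_partition) HsigmaE_imp_hemb:
  fixes G :: "('a, 'b) monoid_scheme"
  assumes "fin_group G" and E: "\<And>H. sigma_subnormal \<sigma> G H \<Longrightarrow> HsigmaE_group \<sigma> (G\<lparr>carrier := H\<rparr>)"
  shows "hemb \<sigma> G"
  unfolding hemb_def
proof (intro allI impI)
  interpret fin_group G by fact
  fix A assume A: "subgroup A G"
  let ?P = "\<lambda>H. sigma_subnormal \<sigma> G H \<and> A \<subseteq> H"
  have "?P (carrier G)" using sigma_subnormal_self subgroup.subset[OF A] by simp
  then obtain H where H: "sigma_subnormal \<sigma> G H" "A \<subseteq> H" and min: "\<And>L. ?P L \<Longrightarrow> card H \<le> card L"
    using ex_has_least_nat[of ?P "carrier G" card] by blast
  have Hs: "subgroup H G" using H sigma_subnormal_iff by blast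
  obtain D M where form: "HsigmaE_group_form \<sigma> (G\<lparr>carrier := H\<rparr>) D M"
    using E[OF H(1)] unfolding HsigmaE_group_def by blast
  interpret H: HsigmaE \<sigma> "G\<lparr>carrier := H\<rparr>" D M
    by (rule HsigmaE.intro[OF prime_partition_axioms fin_group_subgroup[OF Hs] HsigmaE_axioms.intro[OF form]])
  have AH: "subgroup A (G\<lparr>carrier := H\<rparr>)" using subgroup_incl[OF A Hs H(2)] .
  note DA = H.card_set_mult_normal[OF H.D_normal AH]
  \<comment> \<open>If D A were proper, some proper F above it would be one step below H, hence
    \<sigma>-subnormal in G, contrary to minimality of H.\<close>
  have "D <#>\<^bsub>G\<^esub> A = H"
  proof (rule ccontr)
    assume "D <#>\<^bsub>G\<^esub> A \<noteq> H"
    then obtain F where F: "subgroup F (G\<lparr>carrier := H\<rparr>)" "D <#>\<^bsub>G\<^esub> A \<subseteq> F" "F \<noteq> H" "sstep \<sigma> (G\<lparr>carrier := H\<rparr>) F H"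
      using nilq_proper_subgroup_step[OF H.fin_group_axioms H.D_nilq DA(2,3)] by auto
    have "sigma_subnormal \<sigma> G F"
      using sigma_subnormal_trans[OF H(1)] H.sigma_subnormal_step F(4) by simp
    then have "card H \<le> card F" using min[of F] DA(4) F(2) by auto
    moreover have "F \<subseteq> H" using subgroup.subset[OF F(1)] by simp
    ultimately show False using F(3) finite_subgroup[OF Hs] by (metis card_seteq)
  qed
  then have "\<forall>S\<in>\<sigma>. pi_number (-S) (card A) \<or> pi_number (-S) (card H div card A)"
    using H.Hall_of_supplement[OF AH] by simp
  then show "\<exists>B. sigma_subnormal \<sigma> G B \<and> A \<subseteq> B \<and>
     (\<forall>S\<in>\<sigma>. pi_number (-S) (card A) \<or> pi_number (-S) (card B div card A))"
    using H by blast
qed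

theorem theorem1p4:
  fixes G :: "('a, 'b) monoid_scheme" and \<sigma> :: "nat set set"
  assumes "partition_on {p. Factorial_Ring.prime p} \<sigma>"
    and "group G" and "finite (carrier G)" and "sigma_full \<sigma> G"
  shows
    "let i = (\<forall>A. subgroup A G \<longrightarrow> H_sigma_subnormally_embedded \<sigma> G A);
         ii = (\<forall>H. sigma_subnormal \<sigma> G H \<longrightarrow>
                 (\<exists>D M. HsigmaE_group_form \<sigma> (G\<lparr>carrier := H\<rparr>) D M \<and>
                      D = sigma_nilpotent_residual \<sigma> (G\<lparr>carrier := H\<rparr>) \<and>
                      sigma_Carter_subgroup \<sigma> (G\<lparr>carrier := H\<rparr>) M));
         iii = (\<forall>H. sigma_subnormal \<sigma> G H \<longrightarrow> HsigmaE_group \<sigma> (G\<lparr>carrier := H\<rparr>))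
     in (i \<longleftrightarrow> ii) \<and> (ii \<longleftrightarrow> iii) \<and> (i \<longleftrightarrow> iii)"
proof -
  interpret prime_partition \<sigma> by (rule prime_partition.intro[OF assms(1)])
  interpret fin_group G by (rule fin_group.intro[OF assms(2) fin_group_axioms.intro[OF assms(3)]])
  define i where "i \<longleftrightarrow> (\<forall>A. subgroup A G \<longrightarrow> H_sigma_subnormally_embedded \<sigma> G A)"
  define ii where "ii \<longleftrightarrow> (\<forall>H. sigma_subnormal \<sigma> G H \<longrightarrow>
                 (\<exists>D M. HsigmaE_group_form \<sigma> (G\<lparr>carrier := H\<rparr>) D M \<and>
                      D = sigma_nilpotent_residual \<sigma> (G\<lparr>carrier := H\<rparr>) \<and>
                      sigma_Carter_subgroup \<sigma> (G\<lparr>carrier := H\<rparr>) M))"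
  define iii where "iii \<longleftrightarrow> (\<forall>H. sigma_subnormal \<sigma> G H \<longrightarrow> HsigmaE_group \<sigma> (G\<lparr>carrier := H\<rparr>))"
  have i_iff: "i \<longleftrightarrow> hemb \<sigma> G" unfolding i_def by (rule hemb_iff)
  have "iii" if i
    unfolding iii_def
  proof (intro allI impI)
    fix H assume "sigma_subnormal \<sigma> G H"
    then have H: "subgroup H G" using sigma_subnormal_iff by blast
    \<comment> \<open>Condition (i) passes to all subgroups, so the structure theorem applies to H
      directly.\<close>
    show "HsigmaE_group \<sigma> (G\<lparr>carrier := H\<rparr>)"
      using hemb_imp_HsigmaE_group[OF fin_group_subgroup[OF H] hemb_subgroup[OF _ H]] that i_iff by blast
  qed
  moreover have "i" if iii
    using HsigmaE_imp_hemb[OF fin_group_axioms] that i_iff unfolding iii_def by blast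
  moreover have "ii" if h: iii
    unfolding ii_def
  proof (intro allI impI)
    fix H assume sH: "sigma_subnormal \<sigma> G H"
    then have H: "subgroup H G" using sigma_subnormal_iff by blast
    obtain D M where form: "HsigmaE_group_form \<sigma> (G\<lparr>carrier := H\<rparr>) D M"
      using h sH unfolding iii_def HsigmaE_group_def by blast
    interpret H: HsigmaE \<sigma> "G\<lparr>carrier := H\<rparr>" D M
      by (rule HsigmaE.intro[OF prime_partition_axioms fin_group_subgroup[OF H] HsigmaE_axioms.intro[OF form]])
    \<comment> \<open>The complement of the given form is already a Carter subgroup, so the same D
      and M serve.\<close>
    show "\<exists>D M. HsigmaE_group_form \<sigma> (G\<lparr>carrier := H\<rparr>) D M \<and>
        D = sigma_nilpotent_residual \<sigma> (G\<lparr>carrier := H\<rparr>) \<and> sigma_Carter_subgroup \<sigma> (G\<lparr>carrier := H\<rparr>) M"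
      using form H.D_residual H.M_Carter by blast
  qed
  moreover have "iii" if ii
    using that unfolding ii_def iii_def HsigmaE_group_def by blast
  ultimately have "(i \<longleftrightarrow> ii) \<and> (ii \<longleftrightarrow> iii) \<and> (i \<longleftrightarrow> iii)" by blast
  then show ?thesis unfolding Let_def i_def ii_def iii_def .
qed

end
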